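(* Let $G=(V,E)$ be a locally finite, connected, infinite graph. Suppose that each tree in the Wired Uniform Spanning Forest on $G$ has one end almost surely. Then there exists a unique probability measure $\nu$ on the space $\prod_{x\in V}\{0,\dots,\deg_G(x)-1\}$ such that along any exhaustion $V_1\subset V_2\subset\dots\subset V$ of $G$ the sandpile measures $\nu_{V_n}$ converge weakly to $\nu$; that is, for every exhaustion $(V_n)$, every finite $Q\subset V$ and every $\xi\in\prod_{x\in Q}\{0,\dots,\deg_G(x)-1\}$, one has $\lim_{n\to\infty}\nu_{V_n}[\eta:\eta_Q=\xi]=\nu[\eta:\eta_Q=\xi]$.
   Context: Sandpiles on a finite graph with sink. Let $H=(U\cup\{s\},F)$ be a finite connected multigraph (multiple edges allowed, no loops) with distinguished vertex $s\notin U$, the sink. A sandpile on $H$ is a map $\eta:U\to\{0,1,2,\dots\}$. It is stable if $\eta(x)<\deg_H(x)$ for all $x\in U$ (degrees count multiplicity). A vertex $x\in U$ with $\eta(x)\ge\deg_H(x)$ can topple: it sends one particle along each edge incident with $x$; particles reaching $s$ are lost. Consider the Markov chain on stable sandpiles in which at each step a particle is added at a uniformly random vertex of $U$ and all possible topplings are carried out until a stable sandpile is reached (the result does not depend on the order of topplings). Let $\mathcal{R}_H$ be its set of recurrent states. The chain has a unique stationary distribution, denoted $\nu_H$, which is the uniform distribution on $\mathcal{R}_H$. Exhaustions and wired graphs. Let $G=(V,E)$ be a locally finite, connected, infinite graph. An exhaustion of $G$ is a sequence of finite subsets $V_1\subset V_2\subset\dots\subset V$ with $\bigcup_n V_n=V$.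 For finite $V_1\subset V$, $G_{V_1}$ is the finite multigraph with vertex set $V_1\cup\{s\}$ obtained from $G$ by identifying all vertices of $V\setminus V_1$ to a single vertex $s$ (the sink) and removing loop-edges at $s$. Its edges are regarded as elements of $E$. Write $\nu_{V_1}:=\nu_{G_{V_1}}$. For $\eta$ defined on a set containing $Q$, $\eta_Q$ denotes its restriction to $Q$; the limits are along those $n$ with $Q\subset V_n$. Wired Uniform Spanning Forest. For an exhaustion $(V_n)$, let $\mu_n$ be the uniform probability measure on the spanning trees of $G_{V_n}$, viewed as a measure on subsets of the edge set of $G_{V_n}$. The weak limit $\mu=\lim_n\mu_n$ exists as a measure on $\{0,1\}^E$ (convergence of probabilities of all events depending on finitely many edges) and does not depend on the exhaustion; $\mu$ is the Wired Uniform Spanning Forest measure of $G$. It is supported on spanning subgraphs of $G$ all of whose components are infinite trees. A ray in an infinite tree is an infinite self-avoiding path; an end is an equivalence class of rays, where two rays are equivalent if they have finite symmetric difference. Thus an infinite tree has one end if and only if it contains no two disjoint infinite self-avoiding paths. *)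

theory Defs
  imports "HOL-Probability.Probability"
begin

section \<open>Loopless multigraphs\<close>

text \<open>Edges are abstract labels, so that parallel edges remain distinguishable. A simple graph is the
  special case in which the edges are two-element sets of vertices and \<open>ends = id\<close>.\<close>

record ('v, 'e) mgraph =
  verts :: "'v set"
  edges :: "'e set"
  ends :: "'e \<Rightarrow> 'v set"

definition wf_mgraph :: "('v, 'e) mgraph \<Rightarrow> bool" where
  "wf_mgraph G \<longleftrightarrow> (\<forall>e\<in>edges G. ends G e \<subseteq> verts G \<and> card (ends G e) = 2)"

definition incident :: "('v, 'e) mgraph \<Rightarrow> 'v \<Rightarrow> 'e set" where
  "incident G x = {e \<in> edges G. x \<in> ends G e}"

definition deg :: "('v, 'e) mgraph \<Rightarrow> 'v \<Rightarrow> nat" where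
  "deg G x = card (incident G x)"

definition edges_between :: "('v, 'e) mgraph \<Rightarrow> 'v \<Rightarrow> 'v \<Rightarrow> 'e set" where
  "edges_between G x y = {e \<in> edges G. ends G e = {x, y}}"

definition adj :: "('v, 'e) mgraph \<Rightarrow> ('v \<times> 'v) set" where
  "adj G = {(x, y). edges_between G x y \<noteq> {}}"

definition locally_finite_mgraph :: "('v, 'e) mgraph \<Rightarrow> bool" where
  "locally_finite_mgraph G \<longleftrightarrow> (\<forall>x\<in>verts G. finite (incident G x))"

definition connected_mgraph :: "('v, 'e) mgraph \<Rightarrow> bool" where
  "connected_mgraph G \<longleftrightarrow> verts G \<noteq> {} \<and> (\<forall>x\<in>verts G. \<forall>y\<in>verts G. (x, y) \<in> (adj G)\<^sup>*)"

definition component :: "('v, 'e) mgraph \<Rightarrow> 'v \<Rightarrow> 'v set" where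
  "component G x = {y \<in> verts G. (x, y) \<in> (adj G)\<^sup>*}"

text \<open>Two distinct parallel edges form a cycle (of length 2).\<close>

definition is_cycle :: "('v, 'e) mgraph \<Rightarrow> 'v list \<Rightarrow> 'e list \<Rightarrow> bool" where
  "is_cycle G vs es \<longleftrightarrow>
     vs \<noteq> [] \<and> length es = length vs \<and> distinct vs \<and> distinct es \<and>
     (\<forall>i<length vs. es ! i \<in> edges_between G (vs ! i) (vs ! (Suc i mod length vs)))"

definition is_tree :: "('v, 'e) mgraph \<Rightarrow> bool" where
  "is_tree G \<longleftrightarrow> connected_mgraph G \<and> \<not> (\<exists>vs es. is_cycle G vs es)"

definition spanning_trees :: "('v, 'e) mgraph \<Rightarrow> 'e set set" where
  "spanning_trees G = {T. T \<subseteq> edges G \<and> is_tree (G\<lparr>edges := T\<rparr>)}"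


section \<open>Sandpiles on a finite graph with sink\<close>

text \<open>The vertex set \<open>U \<union> {s}\<close> is encoded in an option type, with \<open>None\<close> as the sink \<open>s\<close>.
  A sandpile is a function on \<open>U\<close>, represented as an extensional function.\<close>

definition nonsink :: "('v option, 'e) mgraph \<Rightarrow> 'v set" where
  "nonsink H = {x. Some x \<in> verts H}"

definition stable_sandpiles :: "('v option, 'e) mgraph \<Rightarrow> ('v \<Rightarrow> nat) set" where
  "stable_sandpiles H = (\<Pi>\<^sub>E x\<in>nonsink H. {0..<deg H (Some x)})"

definition topple :: "('v option, 'e) mgraph \<Rightarrow> 'v \<Rightarrow> ('v \<Rightarrow> nat) \<Rightarrow> ('v \<Rightarrow> nat)" where
  "topple H x \<eta> =
     (\<lambda>y\<in>nonsink H. if y = x then \<eta> x - deg H (Some x)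
                    else \<eta> y + card (edges_between H (Some x) (Some y)))"

definition toppling :: "('v option, 'e) mgraph \<Rightarrow> (('v \<Rightarrow> nat) \<times> ('v \<Rightarrow> nat)) set" where
  "toppling H = {(\<eta>, topple H x \<eta>) | \<eta> x. x \<in> nonsink H \<and> deg H (Some x) \<le> \<eta> x}"

definition stabilization :: "('v option, 'e) mgraph \<Rightarrow> ('v \<Rightarrow> nat) \<Rightarrow> ('v \<Rightarrow> nat)" where
  "stabilization H \<eta> = (THE \<xi>. (\<eta>, \<xi>) \<in> (toppling H)\<^sup>* \<and> \<xi> \<in> stable_sandpiles H)"

definition sandpile_kernel :: "('v option, 'e) mgraph \<Rightarrow> ('v \<Rightarrow> nat) \<Rightarrow> ('v \<Rightarrow> nat) pmf" where
  "sandpile_kernel H \<eta> =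
     map_pmf (\<lambda>x. stabilization H (\<eta>(x := \<eta> x + 1))) (pmf_of_set (nonsink H))"

definition stationary_sandpile :: "('v option, 'e) mgraph \<Rightarrow> ('v \<Rightarrow> nat) pmf \<Rightarrow> bool" where
  "stationary_sandpile H p \<longleftrightarrow>
     set_pmf p \<subseteq> stable_sandpiles H \<and> bind_pmf p (sandpile_kernel H) = p"

text \<open>For finite connected \<open>H\<close> with nonempty \<open>U\<close> the stationary distribution is unique; it is the
  uniform distribution on the recurrent states of the chain.\<close>

definition sandpile_measure :: "('v option, 'e) mgraph \<Rightarrow> ('v \<Rightarrow> nat) pmf" where
  "sandpile_measure H = (THE p. stationary_sandpile H p)"


section \<open>Exhaustions and wired graphs\<close>

definition exhaustion :: "('v, 'e) mgraph \<Rightarrow> (nat \<Rightarrow> 'v set) \<Rightarrow> bool" where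
  "exhaustion G W \<longleftrightarrow> (\<forall>n. finite (W n)) \<and> incseq W \<and> (\<Union>n. W n) = verts G"

text \<open>An edge with no endpoint in \<open>W\<close> would become a loop at the sink and is removed; all other edges
  keep their labels.\<close>

definition wired :: "('v, 'e) mgraph \<Rightarrow> 'v set \<Rightarrow> ('v option, 'e) mgraph" where
  "wired G W =
     \<lparr>verts = insert None (Some ` W),
      edges = {e \<in> edges G. ends G e \<inter> W \<noteq> {}},
      ends = (\<lambda>e. (\<lambda>x. if x \<in> W then Some x else None) ` ends G e)\<rparr>"


section \<open>The wired uniform spanning forest\<close>

text \<open>A configuration \<open>\<omega>\<close> in \<open>{0,1}^E\<close> is a Boolean function on the edges, true at the open edges.
  The set \<open>B\<close> below ranges over all events that depend only on the finitely many edges in \<open>F\<close>.\<close>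

definition is_wusf :: "('v, 'e) mgraph \<Rightarrow> ('e \<Rightarrow> bool) measure \<Rightarrow> bool" where
  "is_wusf G \<mu> \<longleftrightarrow>
     prob_space \<mu> \<and> sets \<mu> = sets (\<Pi>\<^sub>M e\<in>edges G. count_space UNIV) \<and>
     (\<forall>W. exhaustion G W \<longrightarrow>
       (\<forall>F B. finite F \<and> F \<subseteq> edges G \<and> B \<subseteq> Pow F \<longrightarrow>
         (\<lambda>n. measure_pmf.prob (pmf_of_set (spanning_trees (wired G (W n)))) {T. T \<inter> F \<in> B})
           \<longlonglongrightarrow> measure \<mu> {\<omega> \<in> space \<mu>. {e \<in> F. \<omega> e} \<in> B}))"

definition open_subgraph :: "('v, 'e) mgraph \<Rightarrow> ('e \<Rightarrow> bool) \<Rightarrow> ('v, 'e) mgraph" where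
  "open_subgraph G \<omega> = G\<lparr>edges := {e \<in> edges G. \<omega> e}\<rparr>"

definition rays :: "('v, 'e) mgraph \<Rightarrow> 'v set \<Rightarrow> (nat \<Rightarrow> 'v) set" where
  "rays G C = {r. inj r \<and> range r \<subseteq> C \<and> (\<forall>i. (r i, r (Suc i)) \<in> adj G)}"

text \<open>In a tree a ray is determined by its starting point and its vertex set, so rays are compared through
  their vertex sets.\<close>

definition ray_equiv :: "('v, 'e) mgraph \<Rightarrow> 'v set \<Rightarrow> ((nat \<Rightarrow> 'v) \<times> (nat \<Rightarrow> 'v)) set" where
  "ray_equiv G C =
     {(r, r'). r \<in> rays G C \<and> r' \<in> rays G C \<and> finite (sym_diff (range r) (range r'))}"

definition tree_ends :: "('v, 'e) mgraph \<Rightarrow> 'v set \<Rightarrow> (nat \<Rightarrow> 'v) set set" where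
  "tree_ends G C = rays G C // ray_equiv G C"

end

theory Submission
  imports Defs
begin

text \<open>A recurrent sandpile is one in which every nonempty vertex set \<open>A\<close> contains a vertex with at least
  as many particles as it has neighbours in \<open>A\<close>; deletion and contraction of an edge at the sink shows
  that there are as many of them as spanning trees. Fix a finite set \<open>Q\<close> and burn from the sink while
  treating \<open>Q\<close> as unburnable, and let \<open>W \<supseteq> Q\<close> be the set left over. The sandpiles with left-over set \<open>W\<close>
  are products of a configuration outside \<open>W\<close> and a recurrent configuration on \<open>W\<close> from which only \<open>Q\<close>
  is joined to the sink, so the conditional law on \<open>W\<close> does not depend on the surrounding graph. The
  spanning trees in which \<open>W\<close> is the set of descendants of \<open>Q\<close> factorise in the same way, and
  therefore the left-over set has the law of the descendants of \<open>Q\<close> in the uniform spanning tree.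
  Being equal to a given finite \<open>W\<close> is a local event for the tree, whence its probability converges, and
  one-endedness says that no mass escapes to infinite sets.\<close>

section \<open>Recurrent configurations and spanning trees\<close>

text \<open>The obstacle is that the left-over set of the burning is not a local function of the
  sandpile: deciding it takes the whole configuration outside, so nothing about it passes to the
  limit directly. Locality comes from the tree side alone. No bijection between sandpiles and trees
  that respects \<open>W\<close> is built; counting suffices. Both events have probability (outer
  count) * (inner count) / (total count), and the equality of the numbers of recurrent
  configurations and spanning trees is applied three times, to the whole graph, to the graph with
  \<open>W\<close> deleted and to the graph on \<open>W\<close>, so that the factors agree one by
  one. For the limit, the sandpiles whose left-over set is not in a given finite family form an
  error event whose probability is known exactly from the trees, so one approximating constant
  serves every exhaustion. Uniqueness of the stationary law is part of the work, because the
  sandpile measure is defined by stationarity and not as the uniform law on recurrent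
  configurations.\<close>

text \<open>A graph with sink is given by its vertices \<open>U\<close> and its edges \<open>E\<close>; every point outside \<open>U\<close> stands for
  the sink, so wiring, contraction into the sink and restriction to fewer vertices all amount to shrinking \<open>U\<close>.
  Connectedness to the sink is expressed by cuts, and a spanning tree by its number of edges.\<close>

definition vdeg :: "('e \<Rightarrow> 'v set) \<Rightarrow> 'e set \<Rightarrow> 'v \<Rightarrow> nat" where
  "vdeg N E x = card {e \<in> E. x \<in> N e}"

definition ideg :: "('e \<Rightarrow> 'v set) \<Rightarrow> 'e set \<Rightarrow> 'v set \<Rightarrow> 'v \<Rightarrow> nat" where
  "ideg N E A x = card {e \<in> E. x \<in> N e \<and> N e \<subseteq> A}"

definition sink_graph :: "('e \<Rightarrow> 'v set) \<Rightarrow> 'v set \<Rightarrow> 'e set \<Rightarrow> bool" where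
  "sink_graph N U E \<longleftrightarrow> finite U \<and> finite E \<and> (\<forall>e\<in>E. card (N e) = 2 \<and> N e \<inter> U \<noteq> {})"

text \<open>Dhar's criterion: no \<open>A\<close> is a forbidden subconfiguration.\<close>

definition ample :: "('e \<Rightarrow> 'v set) \<Rightarrow> 'v set \<Rightarrow> 'e set \<Rightarrow> ('v \<Rightarrow> nat) \<Rightarrow> bool" where
  "ample N U E \<eta> \<longleftrightarrow> (\<forall>A\<subseteq>U. A \<noteq> {} \<longrightarrow> (\<exists>x\<in>A. ideg N E A x \<le> \<eta> x))"

definition recs :: "('e \<Rightarrow> 'v set) \<Rightarrow> 'v set \<Rightarrow> 'e set \<Rightarrow> ('v \<Rightarrow> nat) set" where
  "recs N U E = {\<eta> \<in> (\<Pi>\<^sub>E x\<in>U. {0..<vdeg N E x}). ample N U E \<eta>}"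

definition linked :: "('e \<Rightarrow> 'v set) \<Rightarrow> 'v set \<Rightarrow> 'e set \<Rightarrow> bool" where
  "linked N U S \<longleftrightarrow> (\<forall>A\<subseteq>U. A \<noteq> {} \<longrightarrow> (\<exists>e\<in>S. N e \<inter> A \<noteq> {} \<and> \<not> N e \<subseteq> A))"

definition trees :: "('e \<Rightarrow> 'v set) \<Rightarrow> 'v set \<Rightarrow> 'e set \<Rightarrow> 'e set set" where
  "trees N U E = {S. S \<subseteq> E \<and> linked N U S \<and> card S = card U}"

text \<open>The edges that survive when everything outside \<open>U\<close> is merged into the sink;
  the others have become loops there.\<close>

definition touching :: "('e \<Rightarrow> 'v set) \<Rightarrow> 'e set \<Rightarrow> 'v set \<Rightarrow> 'e set" where
  "touching N E U = {e \<in> E. N e \<inter> U \<noteq> {}}"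

section \<open>Cuts, exit edges and contraction into the sink\<close>

lemma touching_subset: "touching N E U \<subseteq> E"
  by (auto simp: touching_def)

lemma linkedD: "linked N U S \<Longrightarrow> A \<subseteq> U \<Longrightarrow> A \<noteq> {} \<Longrightarrow> \<exists>e\<in>S. N e \<inter> A \<noteq> {} \<and> \<not> N e \<subseteq> A"
  by (auto simp: linked_def)

lemma linked_touching: "linked N U (touching N S U) \<longleftrightarrow> linked N U S"
  unfolding linked_def touching_def by blast

lemma linked_subset: "linked N U S \<Longrightarrow> U' \<subseteq> U \<Longrightarrow> linked N U' S"
  unfolding linked_def by (meson subset_trans)

lemma linked_exit:
  assumes "linked N U S" "U \<noteq> {}"
  obtains e x where "e \<in> S" "x \<in> N e" "x \<in> U" "\<not> N e \<subseteq> U"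
  using linkedD[OF assms(1) subset_refl assms(2)] by blast

lemma exit_edge_inter:
  assumes "card (N e) = 2" "x \<in> N e" "x \<in> U" "\<not> N e \<subseteq> U"
  shows "N e \<inter> U = {x}"
proof -
  obtain a b where "N e = {a, b}" "a \<noteq> b" using assms(1) by (meson card_2_iff)
  then show ?thesis using assms by auto
qed

text \<open>The edge \<open>e\<close> joins \<open>x\<close> to the sink. It crosses every cut
  around a set that contains \<open>x\<close> and no cut around a set that avoids \<open>x\<close>,
  so only the latter cuts constrain the other edges.\<close>

lemma linked_contract:
  assumes "card (N e) = 2" "x \<in> N e" "x \<in> U" "\<not> N e \<subseteq> U" "e \<in> S"
  shows "linked N U S \<longleftrightarrow> linked N (U - {x}) (touching N (S - {e}) (U - {x}))"
proof -
  have i: "N e \<inter> U = {x}" using exit_edge_inter[of N e x U] assms by blast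
  show ?thesis
  proof
    assume l: "linked N U S"
    have "linked N (U - {x}) (S - {e})"
      unfolding linked_def
    proof (intro allI impI)
      fix A assume A: "A \<subseteq> U - {x}" "A \<noteq> {}"
      then obtain f where f: "f \<in> S" "N f \<inter> A \<noteq> {}" "\<not> N f \<subseteq> A"
        using linkedD[OF l, of A] by blast
      then have "f \<noteq> e" using i A by blast
      then show "\<exists>e\<in>S - {e}. N e \<inter> A \<noteq> {} \<and> \<not> N e \<subseteq> A" using f by blast
    qed
    then show "linked N (U - {x}) (touching N (S - {e}) (U - {x}))" by (simp add: linked_touching)
  next
    assume "linked N (U - {x}) (touching N (S - {e}) (U - {x}))"
    then have l: "linked N (U - {x}) (S - {e})" by (simp add: linked_touching)
    show "linked N U S"
      unfolding linked_def
    proof (intro allI impI)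
      fix A assume A: "A \<subseteq> U" "A \<noteq> {}"
      show "\<exists>e\<in>S. N e \<inter> A \<noteq> {} \<and> \<not> N e \<subseteq> A"
      proof (cases "x \<in> A")
        case True
        then show ?thesis using assms A by blast
      next
        case False
        then show ?thesis using linkedD[OF l, of A] A by blast
      qed
    qed
  qed
qed

text \<open>Each vertex costs an edge: an exit edge is spent to absorb its inner endpoint into the
  sink, and the rest is still linked.\<close>

lemma linked_card_le:
  assumes "finite U" "finite S" "\<forall>e\<in>S. card (N e) = 2" "linked N U S"
  shows "card U \<le> card S"
  using assms
proof (induction "card U" arbitrary: U S)
  case 0 then show ?case by simp
next
  case (Suc n)
  then have "U \<noteq> {}" by auto
  then obtain e x where e: "e \<in> S" "x \<in> N e" "x \<in> U" "\<not> N e \<subseteq> U"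
    using linked_exit[OF Suc.prems(4)] by metis
  let ?S = "touching N (S - {e}) (U - {x})"
  have "linked N (U - {x}) ?S"
    using linked_contract[of N e x U S] e Suc.prems by auto
  then have "card (U - {x}) \<le> card ?S"
    using Suc.hyps(1)[of "U - {x}" ?S] Suc.hyps(2) Suc.prems e by (auto simp: touching_def)
  also have "\<dots> \<le> card (S - {e})"
    using Suc.prems by (intro card_mono) (auto simp: touching_def)
  finally have "Suc (card (U - {x})) \<le> Suc (card (S - {e}))" by simp
  then show ?case using e Suc.prems
    by (metis card.remove)
qed

text \<open>Contracting an exit edge preserves minimality and lowers both cardinalities by one. This
  turns acyclicity, in the form that no edge can be spared, into an edge count.\<close>

lemma minimal_linked_card:
  assumes "finite U" "finite S" "\<forall>e\<in>S. card (N e) = 2" "linked N U S"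
    and "\<And>e. e \<in> S \<Longrightarrow> \<not> linked N U (S - {e})"
  shows "card S = card U"
  using assms
proof (induction "card U" arbitrary: U S)
  case 0
  then have "U = {}" by auto
  then have "S = {}" using 0 by (auto simp: linked_def)
  then show ?case using \<open>U = {}\<close> by simp
next
  case (Suc n)
  then have "U \<noteq> {}" by auto
  then obtain e x where e: "e \<in> S" "x \<in> N e" "x \<in> U" "\<not> N e \<subseteq> U"
    using linked_exit[OF Suc.prems(4)] by metis
  have c: "card (N e) = 2" using Suc.prems e by auto
  have con: "e \<in> S' \<Longrightarrow> linked N U S' \<longleftrightarrow> linked N (U - {x}) (S' - {e})" for S'
    using linked_contract[of N e x U S'] c e by (simp add: linked_touching)
  have "card (S - {e}) = card (U - {x})"
  proof (rule Suc.hyps(1))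
    show "n = card (U - {x})" using Suc.hyps(2) e Suc.prems by auto
    show "linked N (U - {x}) (S - {e})" using con e Suc.prems by auto
    fix f assume f: "f \<in> S - {e}"
    then have "\<not> linked N U (S - {f})" using Suc.prems(5) by auto
    then have "\<not> linked N (U - {x}) (S - {f} - {e})" using con[of "S - {f}"] e f by auto
    moreover have "S - {f} - {e} = S - {e} - {f}" by auto
    ultimately show "\<not> linked N (U - {x}) (S - {e} - {f})" by simp
  qed (use Suc.prems in auto)
  then show ?case using e Suc.prems by (metis card.remove)
qed

lemma trees_minimal:
  assumes "S \<in> trees N U E" "sink_graph N U E" "e \<in> S"
  shows "\<not> linked N U (S - {e})"
proof
  assume l: "linked N U (S - {e})"
  have f: "finite S" "finite U" "\<forall>e\<in>S. card (N e) = 2"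
    using assms finite_subset by (auto simp: trees_def sink_graph_def)
  have "card U \<le> card (S - {e})" using linked_card_le[OF f(2) _ _ l] f by auto
  then show False using assms f by (auto simp: trees_def card_gt_0_iff dest: card_Diff1_less)
qed

text \<open>The contraction half of the recursion for trees: \<open>e\<close> is forced into the
  tree and its inner endpoint \<open>x\<close> joins the sink.\<close>

lemma trees_exit_mem:
  assumes "sink_graph N U E" "e \<in> E" "x \<in> N e" "x \<in> U" "\<not> N e \<subseteq> U"
  shows "bij_betw (insert e) (trees N (U - {x}) (touching N (E - {e}) (U - {x}))) {T \<in> trees N U E. e \<in> T}"
proof (rule bij_betw_byWitness[where f' = "\<lambda>T. T - {e}"])
  let ?E = "touching N (E - {e}) (U - {x})"
  have fin: "finite U" "finite E" "\<forall>e\<in>E. card (N e) = 2"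
    using assms by (auto simp: sink_graph_def)
  have c: "card (N e) = 2" using fin assms by auto
  have cU: "card U = Suc (card (U - {x}))" using fin assms by (metis card.remove)
  show "\<forall>a\<in>trees N (U - {x}) ?E. insert e a - {e} = a"
    by (auto simp: trees_def touching_def)
  show "\<forall>a'\<in>{T \<in> trees N U E. e \<in> T}. insert e (a' - {e}) = a'" by auto
  show "insert e ` trees N (U - {x}) ?E \<subseteq> {T \<in> trees N U E. e \<in> T}"
  proof (clarify, rule conjI)
    fix S assume S: "S \<in> trees N (U - {x}) ?E"
    then have sub: "S \<subseteq> ?E" and l: "linked N (U - {x}) S" and cS: "card S = card (U - {x})"
      by (auto simp: trees_def)
    have "e \<notin> S" using sub by (auto simp: touching_def)
    have "finite S" using sub fin finite_subset touching_subset by (metis finite_Diff)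
    have "linked N U (insert e S)"
      using linked_contract[of N e x U "insert e S"] c assms l \<open>e \<notin> S\<close>
      by (simp add: linked_touching)
    moreover have "insert e S \<subseteq> E"
      using sub assms(2) touching_subset[of N "E - {e}" "U - {x}"] by blast
    ultimately show "insert e S \<in> trees N U E"
      using \<open>e \<notin> S\<close> \<open>finite S\<close> cS cU by (simp add: trees_def)
  qed auto
  show "(\<lambda>T. T - {e}) ` {T \<in> trees N U E. e \<in> T} \<subseteq> trees N (U - {x}) ?E"
  proof clarify
    fix T assume T: "T \<in> trees N U E" "e \<in> T"
    then have sub: "T \<subseteq> E" and l: "linked N U T" and cT: "card T = card U" by (auto simp: trees_def)
    have fT: "finite T" using sub fin finite_subset by auto
    let ?T = "touching N (T - {e}) (U - {x})"
    have l': "linked N (U - {x}) ?T" using linked_contract[of N e x U T] c assms T l by simp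
    have "card (U - {x}) \<le> card ?T"
      by (rule linked_card_le[OF _ _ _ l']) (use fin fT sub in \<open>auto simp: touching_def\<close>)
    moreover have "Suc (card (T - {e})) = card T" using T fT by (metis card.remove)
    ultimately have "card (T - {e}) \<le> card ?T" using cT cU by simp
    \<comment> \<open>No other edge of \<open>T\<close> becomes a loop at the sink, since the
      surviving edges would then be too few to link \<open>U - {x}\<close>.\<close>
    then have "?T = T - {e}" using fT by (intro card_seteq) (auto simp: touching_def)
    moreover have "?T \<subseteq> ?E" using sub by (auto simp: touching_def)
    ultimately show "T - {e} \<in> trees N (U - {x}) ?E"
      using l' cT cU \<open>Suc (card (T - {e})) = card T\<close> by (auto simp: trees_def)
  qed
qed

lemma trees_exit_not_mem: "{T \<in> trees N U E. e \<notin> T} = trees N U (E - {e})"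
  by (auto simp: trees_def)

section \<open>Deletion and contraction for recurrent configurations\<close>

lemma vdeg_touching: "x \<in> U \<Longrightarrow> vdeg N (touching N E U) x = vdeg N E x"
  unfolding vdeg_def touching_def by (rule arg_cong[where f = card]) auto

lemma ideg_touching: "x \<in> A \<Longrightarrow> A \<subseteq> U \<Longrightarrow> ideg N (touching N E U) A x = ideg N E A x"
  unfolding ideg_def touching_def by (rule arg_cong[where f = card]) auto

lemma ideg_remove_exit: "\<not> N e \<subseteq> U \<Longrightarrow> A \<subseteq> U \<Longrightarrow> ideg N (E - {e}) A x = ideg N E A x"
  unfolding ideg_def by (rule arg_cong[where f = card]) auto

lemma ample_cong_strong:
  assumes "\<And>A x. A \<subseteq> U \<Longrightarrow> x \<in> A \<Longrightarrow> ideg N E A x \<le> \<eta> x \<longleftrightarrow> ideg N E' A x \<le> \<eta>' x"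
  shows "ample N U E \<eta> = ample N U E' \<eta>'"
  unfolding ample_def using assms by (intro all_cong imp_cong bex_cong refl) auto

lemma ample_touching: "ample N U (touching N E U) \<eta> = ample N U E \<eta>"
  by (rule ample_cong_strong) (simp add: ideg_touching)

lemma ample_cong: "(\<And>x. x \<in> U \<Longrightarrow> \<eta> x = \<eta>' x) \<Longrightarrow> ample N U E \<eta> = ample N U E \<eta>'"
  by (rule ample_cong_strong) auto

lemma recs_touching: "recs N U (touching N E U) = recs N U E"
proof -
  have "(\<Pi>\<^sub>E x\<in>U. {0..<vdeg N (touching N E U) x}) = (\<Pi>\<^sub>E x\<in>U. {0..<vdeg N E x})"
    by (intro PiE_cong) (simp add: vdeg_touching)
  then show ?thesis unfolding recs_def ample_touching by simp
qed

lemma vdeg_remove: "finite E \<Longrightarrow> vdeg N (E - {e}) x = (if e \<in> E \<and> x \<in> N e then vdeg N E x - 1 else vdeg N E x)"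
proof -
  assume "finite E"
  have "{f \<in> E - {e}. x \<in> N f} = {f \<in> E. x \<in> N f} - {e}" by auto
  then show ?thesis using \<open>finite E\<close> by (auto simp: vdeg_def card_Diff_singleton)
qed

text \<open>The deletion half: losing \<open>e\<close> lowers the capacity at \<open>x\<close> by
  one, while an exit edge never counts in \<open>ideg N E A\<close> for
  \<open>A \<subseteq> U\<close>, so ampleness is unchanged.\<close>

lemma recs_exit_not_max:
  assumes "sink_graph N U E" "e \<in> E" "x \<in> N e" "x \<in> U" "\<not> N e \<subseteq> U"
  shows "{\<eta> \<in> recs N U E. \<eta> x < vdeg N E x - 1} = recs N U (E - {e})"
proof -
  have fin: "finite E" and i: "N e \<inter> U = {x}"
    using assms exit_edge_inter[of N e x U] by (auto simp: sink_graph_def)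
  have d: "vdeg N (E - {e}) y = (if y = x then vdeg N E x - 1 else vdeg N E y)" if "y \<in> U" for y
    using that i assms by (auto simp: vdeg_remove[OF fin])
  have a: "ample N U (E - {e}) \<eta> = ample N U E \<eta>" for \<eta>
    by (rule ample_cong_strong) (simp add: ideg_remove_exit[of N e U, OF assms(5)])
  have "\<eta> \<in> (\<Pi>\<^sub>E y\<in>U. {0..<vdeg N (E - {e}) y}) \<longleftrightarrow> \<eta> \<in> (\<Pi>\<^sub>E y\<in>U. {0..<vdeg N E y}) \<and> \<eta> x < vdeg N E x - 1" for \<eta>
    using d \<open>x \<in> U\<close> unfolding PiE_iff by (auto split: if_splits)
  then show ?thesis unfolding recs_def a by auto
qed

lemma vdeg_pos: "finite E \<Longrightarrow> e \<in> E \<Longrightarrow> x \<in> N e \<Longrightarrow> 0 < vdeg N E x"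
  by (auto simp: vdeg_def card_gt_0_iff)

lemma ideg_less_vdeg:
  assumes "finite E" "e \<in> E" "x \<in> N e" "\<not> N e \<subseteq> A"
  shows "ideg N E A x < vdeg N E x"
  unfolding ideg_def vdeg_def using assms by (intro psubset_card_mono) auto

text \<open>The contraction half: at maximal height \<open>x\<close> is a witness for every
  \<open>A\<close> containing it, because \<open>e\<close> leaves \<open>A\<close>. What remains is
  ampleness on the sets avoiding \<open>x\<close>, where the edges to \<open>x\<close> act as edges
  to the sink.\<close>

lemma recs_exit_max:
  assumes "sink_graph N U E" "e \<in> E" "x \<in> N e" "x \<in> U" "\<not> N e \<subseteq> U"
  shows "bij_betw (\<lambda>\<eta>. \<eta>(x := vdeg N E x - 1)) (recs N (U - {x}) (touching N (E - {e}) (U - {x})))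
           {\<eta> \<in> recs N U E. \<eta> x = vdeg N E x - 1}"
proof (rule bij_betw_byWitness[where f' = "\<lambda>\<eta>. restrict \<eta> (U - {x})"])
  have fin: "finite E" and i: "N e \<inter> U = {x}"
    using assms exit_edge_inter[of N e x U] by (auto simp: sink_graph_def)
  have d: "vdeg N (E - {e}) y = vdeg N E y" if "y \<in> U - {x}" for y
    using that i by (auto simp: vdeg_remove[OF fin])
  have pos: "0 < vdeg N E x" using vdeg_pos fin assms by metis
  have r: "recs N (U - {x}) (touching N (E - {e}) (U - {x})) = recs N (U - {x}) (E - {e})"
    by (rule recs_touching)
  have a: "ample N (U - {x}) (E - {e}) \<eta> \<longleftrightarrow> ample N U E \<eta>" if "\<eta> x = vdeg N E x - 1" for \<eta>
  proof -
    have "ample N (U - {x}) (E - {e}) \<eta> \<longleftrightarrow> ample N (U - {x}) E \<eta>"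
    proof (rule ample_cong_strong)
      fix A y assume "A \<subseteq> U - {x}"
      then have "A \<subseteq> U" by blast
      then show "ideg N (E - {e}) A y \<le> \<eta> y \<longleftrightarrow> ideg N E A y \<le> \<eta> y"
        using ideg_remove_exit[of N e U A E y, OF assms(5)] by simp
    qed
    also have "\<dots> \<longleftrightarrow> ample N U E \<eta>"
    proof
      assume am: "ample N (U - {x}) E \<eta>"
      show "ample N U E \<eta>"
        unfolding ample_def
      proof (intro allI impI)
        fix A assume A: "A \<subseteq> U" "A \<noteq> {}"
        show "\<exists>y\<in>A. ideg N E A y \<le> \<eta> y"
        proof (cases "x \<in> A")
          case True
          have "ideg N E A x < vdeg N E x"
            using ideg_less_vdeg[of E e x N A] fin assms A by blast
          then show ?thesis using True that by (intro bexI[of _ x]) auto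
        next
          case False
          then have "A \<subseteq> U - {x}" using A by blast
          then show ?thesis using am A unfolding ample_def by blast
        qed
      qed
    next
      assume "ample N U E \<eta>" then show "ample N (U - {x}) E \<eta>" unfolding ample_def by blast
    qed
    finally show ?thesis .
  qed
  show "\<forall>\<eta>\<in>recs N (U - {x}) (touching N (E - {e}) (U - {x})).
       restrict (\<eta>(x := vdeg N E x - 1)) (U - {x}) = \<eta>"
    by (auto simp: recs_def PiE_iff extensional_def restrict_def fun_eq_iff)
  show "\<forall>\<eta>\<in>{\<eta> \<in> recs N U E. \<eta> x = vdeg N E x - 1}. (restrict \<eta> (U - {x}))(x := vdeg N E x - 1) = \<eta>"
    by (auto simp: recs_def PiE_iff extensional_def restrict_def fun_eq_iff)
  show "(\<lambda>\<eta>. \<eta>(x := vdeg N E x - 1)) ` recs N (U - {x}) (touching N (E - {e}) (U - {x}))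
    \<subseteq> {\<eta> \<in> recs N U E. \<eta> x = vdeg N E x - 1}"
  proof clarify
    fix \<eta> assume "\<eta> \<in> recs N (U - {x}) (touching N (E - {e}) (U - {x}))"
    then have \<eta>: "\<eta> \<in> (\<Pi>\<^sub>E y\<in>U - {x}. {0..<vdeg N (E - {e}) y})" "ample N (U - {x}) (E - {e}) \<eta>"
      unfolding r by (auto simp: recs_def)
    let ?\<eta> = "\<eta>(x := vdeg N E x - 1)"
    have "?\<eta> \<in> (\<Pi>\<^sub>E y\<in>U. {0..<vdeg N E y})"
      using \<eta>(1) d pos \<open>x \<in> U\<close> by (auto simp: PiE_iff extensional_def)
    moreover have "ample N (U - {x}) (E - {e}) ?\<eta>"
      using \<eta>(2) ample_cong[of "U - {x}" \<eta> ?\<eta>] by auto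
    ultimately show "?\<eta> \<in> recs N U E \<and> ?\<eta> x = vdeg N E x - 1"
      using a[of ?\<eta>] by (auto simp: recs_def)
  qed
  show "(\<lambda>\<eta>. restrict \<eta> (U - {x})) ` {\<eta> \<in> recs N U E. \<eta> x = vdeg N E x - 1}
    \<subseteq> recs N (U - {x}) (touching N (E - {e}) (U - {x}))"
  proof clarify
    fix \<eta> assume "\<eta> \<in> recs N U E" and m: "\<eta> x = vdeg N E x - 1"
    then have \<eta>: "\<eta> \<in> (\<Pi>\<^sub>E y\<in>U. {0..<vdeg N E y})" "ample N U E \<eta>"
      by (auto simp: recs_def)
    let ?\<eta> = "restrict \<eta> (U - {x})"
    have "?\<eta> \<in> (\<Pi>\<^sub>E y\<in>U - {x}. {0..<vdeg N (E - {e}) y})"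
      using \<eta>(1) d by (auto simp: PiE_iff)
    moreover have "ample N (U - {x}) (E - {e}) ?\<eta>"
      using \<eta>(2) a[of \<eta>, OF m] ample_cong[of "U - {x}" \<eta> ?\<eta>] by auto
    ultimately show "?\<eta> \<in> recs N (U - {x}) (touching N (E - {e}) (U - {x}))"
      unfolding r by (auto simp: recs_def)
  qed
qed

lemma finite_trees: "finite E \<Longrightarrow> finite (trees N U E)"
  by (rule finite_subset[of _ "Pow E"]) (auto simp: trees_def)

lemma finite_recs: "finite U \<Longrightarrow> finite (recs N U E)"
  by (rule finite_subset[of _ "\<Pi>\<^sub>E x\<in>U. {0..<vdeg N E x}"]) (auto simp: recs_def intro: finite_PiE)

lemma sink_graph_subset: "sink_graph N U E \<Longrightarrow> E' \<subseteq> E \<Longrightarrow> sink_graph N U E'"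
  using finite_subset by (auto simp: sink_graph_def)

lemma sink_graph_touching:
  "finite U \<Longrightarrow> finite E \<Longrightarrow> \<forall>e\<in>E. card (N e) = 2 \<Longrightarrow> sink_graph N U (touching N E U)"
  by (auto simp: sink_graph_def touching_def)

text \<open>Trees avoiding or using \<open>e\<close> match configurations below or at the maximum at
  \<open>x\<close>. If \<open>U\<close> is nonempty and no edge leaves it, both sides are empty:
  nothing links \<open>U\<close> to the sink, and \<open>A = U\<close> itself is forbidden.\<close>

theorem card_recs_eq_card_trees:
  assumes "sink_graph N U E"
  shows "card (recs N U E) = card (trees N U E)"
  using assms
proof (induction "card U + card E" arbitrary: U E rule: less_induct)
  case less
  have fin: "finite U" "finite E" using less.prems by (auto simp: sink_graph_def)
  show ?case
  proof (cases "U = {}")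
    case True
    then have "E = {}" using less.prems by (auto simp: sink_graph_def)
    then show ?thesis using True by (auto simp: recs_def trees_def ample_def linked_def conj_commute cong: conj_cong)
  next
    case False
    show ?thesis
    proof (cases "\<exists>e\<in>E. \<not> N e \<subseteq> U")
      case False
      have "linked N U S \<Longrightarrow> \<not> S \<subseteq> E" for S
        using False linked_exit[OF _ \<open>U \<noteq> {}\<close>] by (metis subsetD)
      then have "trees N U E = {}" by (auto simp: trees_def)
      moreover have "recs N U E = {}"
      proof -
        have "\<not> ample N U E \<eta>" if "\<eta> \<in> (\<Pi>\<^sub>E x\<in>U. {0..<vdeg N E x})" for \<eta>
        proof
          assume "ample N U E \<eta>"
          then obtain x where x: "x \<in> U" "ideg N E U x \<le> \<eta> x"
            using \<open>U \<noteq> {}\<close> unfolding ample_def by blast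
          moreover have "ideg N E U x = vdeg N E x"
            unfolding ideg_def vdeg_def using False by (intro arg_cong[where f = card]) auto
          ultimately show False using that by (auto simp: PiE_iff)
        qed
        then show ?thesis by (auto simp: recs_def)
      qed
      ultimately show ?thesis by simp
    next
      case True
      then obtain e where e: "e \<in> E" "\<not> N e \<subseteq> U" by auto
      then obtain x where x: "x \<in> N e" "x \<in> U" using less.prems by (auto simp: sink_graph_def)
      let ?E = "touching N (E - {e}) (U - {x})"
      have sub: "card ?E \<le> card (E - {e})" "card (E - {e}) < card E" "card (U - {x}) < card U"
        using fin e(1) x touching_subset[of N "E - {e}" "U - {x}"]
        by (simp_all only: card_Diff1_less card_mono finite_Diff)
      have 1: "card (recs N U (E - {e})) = card (trees N U (E - {e}))"
        using sub less.prems by (intro less.hyps) (auto intro: sink_graph_subset)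
      have 2: "card (recs N (U - {x}) ?E) = card (trees N (U - {x}) ?E)"
        using sub less.prems by (intro less.hyps sink_graph_touching) (auto simp: sink_graph_def)
      have "recs N U E = {\<eta> \<in> recs N U E. \<eta> x < vdeg N E x - 1} \<union> {\<eta> \<in> recs N U E. \<eta> x = vdeg N E x - 1}"
        using x by (fastforce simp: recs_def PiE_iff)
      then have "card (recs N U E) =
        card {\<eta> \<in> recs N U E. \<eta> x < vdeg N E x - 1} + card {\<eta> \<in> recs N U E. \<eta> x = vdeg N E x - 1}"
        using finite_recs[OF fin(1), of N E]
        by (subst card_Un_disjoint[symmetric]) auto
      also have "\<dots> = card (recs N U (E - {e})) + card (recs N (U - {x}) ?E)"
        using recs_exit_not_max[OF less.prems e(1) x e(2)]
          bij_betw_same_card[OF recs_exit_max[OF less.prems e(1) x e(2)]] by simp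
      also have "\<dots> = card {T \<in> trees N U E. e \<notin> T} + card {T \<in> trees N U E. e \<in> T}"
        using 1 2 trees_exit_not_mem[of N U E e]
          bij_betw_same_card[OF trees_exit_mem[OF less.prems e(1) x e(2)]] by simp
      also have "\<dots> = card (trees N U E)"
        using finite_trees[OF fin(2), of N U]
        by (subst card_Un_disjoint[symmetric]) (auto intro!: arg_cong[where f = card])
      finally show ?thesis .
    qed
  qed
qed

section \<open>Cutting out the pocket around a finite set\<close>

text \<open>The edges of the graph on \<open>W\<close> in which only \<open>Q\<close> is joined to
  the sink: those from \<open>W - Q\<close> to the outside are dropped. In a tree where
  \<open>W\<close> is the set of descendants of \<open>Q\<close> none of these occurs, and in a
  sandpile with left-over set \<open>W\<close> their removal brings the degrees on
  \<open>W - Q\<close> down to the bound that the heights obey.\<close>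

definition exits_at :: "('e \<Rightarrow> 'v set) \<Rightarrow> 'e set \<Rightarrow> 'v set \<Rightarrow> 'v set \<Rightarrow> 'e set" where
  "exits_at N E Q W = {e \<in> touching N E W. N e \<subseteq> W \<or> N e \<inter> Q \<noteq> {}}"

text \<open>The vertices that remain when the burning starts at the sink and \<open>Q\<close> is not allowed to burn.\<close>

definition leftover :: "('e \<Rightarrow> 'v set) \<Rightarrow> 'v set \<Rightarrow> 'e set \<Rightarrow> 'v set \<Rightarrow> ('v \<Rightarrow> nat) \<Rightarrow> 'v set" where
  "leftover N V E Q \<eta> = \<Union>{X. Q \<subseteq> X \<and> X \<subseteq> V \<and> (\<forall>x\<in>X - Q. \<eta> x < ideg N E X x)}"

section \<open>The left-over set and its factorisation\<close>

lemma ampleD: "ample N U E \<eta> \<Longrightarrow> A \<subseteq> U \<Longrightarrow> A \<noteq> {} \<Longrightarrow> \<exists>x\<in>A. ideg N E A x \<le> \<eta> x"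
  by (auto simp: ample_def)

lemma recs_ample: "\<eta> \<in> recs N U E \<Longrightarrow> ample N U E \<eta>"
  by (simp add: recs_def)

lemma ideg_mono: "finite E \<Longrightarrow> A \<subseteq> B \<Longrightarrow> ideg N E A x \<le> ideg N E B x"
  unfolding ideg_def by (intro card_mono) auto

text \<open>Since \<open>ideg\<close> grows with the set, the condition under the union is inherited
  by unions; the left-over set is the largest set satisfying it. This characterises the result of
  the burning without an order of burning.\<close>

lemma leftover_properties:
  assumes "finite E" "Q \<subseteq> V"
  shows "Q \<subseteq> leftover N V E Q \<eta>" "leftover N V E Q \<eta> \<subseteq> V"
    and "\<And>x. x \<in> leftover N V E Q \<eta> - Q \<Longrightarrow> \<eta> x < ideg N E (leftover N V E Q \<eta>) x"
    and "\<And>X. Q \<subseteq> X \<Longrightarrow> X \<subseteq> V \<Longrightarrow> (\<forall>x\<in>X - Q. \<eta> x < ideg N E X x) \<Longrightarrow> X \<subseteq> leftover N V E Q \<eta>"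
proof -
  let ?L = "leftover N V E Q \<eta>"
  show max: "\<And>X. Q \<subseteq> X \<Longrightarrow> X \<subseteq> V \<Longrightarrow> (\<forall>x\<in>X - Q. \<eta> x < ideg N E X x) \<Longrightarrow> X \<subseteq> ?L"
    unfolding leftover_def by (rule Union_upper) simp
  show "Q \<subseteq> ?L" using max[of Q] assms by simp
  show "?L \<subseteq> V" unfolding leftover_def by (rule Union_least) simp
  fix x assume "x \<in> ?L - Q"
  then obtain X where X: "x \<in> X" "x \<notin> Q" "Q \<subseteq> X" "X \<subseteq> V" "\<forall>x\<in>X - Q. \<eta> x < ideg N E X x"
    unfolding leftover_def by auto
  have "\<eta> x < ideg N E X x" using X by simp
  also have "\<dots> \<le> ideg N E ?L x" using assms(1) max[OF X(3-5)] by (rule ideg_mono)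
  finally show "\<eta> x < ideg N E ?L x" .
qed

text \<open>The event splits into a condition on the heights in \<open>W - Q\<close> and one on the
  heights in \<open>V - W\<close>, which is the source of the product structure.\<close>

lemma leftover_eq_iff:
  assumes "finite E" "Q \<subseteq> V"
  shows "leftover N V E Q \<eta> = W \<longleftrightarrow> Q \<subseteq> W \<and> W \<subseteq> V \<and> (\<forall>x\<in>W - Q. \<eta> x < ideg N E W x) \<and>
    (\<forall>A\<subseteq>V - W. A \<noteq> {} \<longrightarrow> (\<exists>x\<in>A. ideg N E (W \<union> A) x \<le> \<eta> x))" (is "_ \<longleftrightarrow> ?R")
proof
  assume L: "leftover N V E Q \<eta> = W"
  note p = leftover_properties[OF assms, where N = N and \<eta> = \<eta>, unfolded L]
  have "\<exists>x\<in>A. ideg N E (W \<union> A) x \<le> \<eta> x" if A: "A \<subseteq> V - W" "A \<noteq> {}" for A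
  proof (rule ccontr)
    assume c: "\<not> (\<exists>x\<in>A. ideg N E (W \<union> A) x \<le> \<eta> x)"
    have "\<eta> x < ideg N E (W \<union> A) x" if "x \<in> (W \<union> A) - Q" for x
    proof (cases "x \<in> A")
      case True then show ?thesis using c by (meson not_le)
    next
      case False
      then have "\<eta> x < ideg N E W x" using that p(3) by blast
      also have "\<dots> \<le> ideg N E (W \<union> A) x" using assms(1) by (intro ideg_mono) auto
      finally show ?thesis .
    qed
    then have "W \<union> A \<subseteq> W" using p(1,2) A by (intro p(4)) auto
    then show False using A by blast
  qed
  then show ?R using p by blast
next
  assume R: ?R
  note p = leftover_properties[OF assms, where N = N and \<eta> = \<eta>]
  let ?L = "leftover N V E Q \<eta>"
  have "W \<subseteq> ?L" using R by (intro p(4)) auto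
  moreover have "?L \<subseteq> W"
  proof (rule ccontr)
    assume "\<not> ?L \<subseteq> W"
    then have "?L - W \<subseteq> V - W" "?L - W \<noteq> {}" using p(2) by auto
    then obtain x where x: "x \<in> ?L - W" "ideg N E (W \<union> (?L - W)) x \<le> \<eta> x" using R by meson
    have "W \<union> (?L - W) = ?L" using \<open>W \<subseteq> ?L\<close> by auto
    then have "ideg N E ?L x \<le> \<eta> x" using x(2) by simp
    moreover have "\<eta> x < ideg N E ?L x" using x(1) R by (intro p(3)) auto
    ultimately show False by simp
  qed
  ultimately show "?L = W" by auto
qed

text \<open>The count of \<open>linked_card_le\<close> with \<open>A\<close> as one additional
  vertex: the cuts considered either contain \<open>A\<close> or avoid it. If the exit edge starts
  in \<open>A\<close>, absorbing \<open>A\<close> costs that edge and leaves the ordinary count on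
  \<open>W\<close>; otherwise a vertex of \<open>W\<close> is absorbed and the induction
  continues.\<close>

lemma linked_card_less:
  assumes "finite W" "finite S" "\<forall>e\<in>S. card (N e) = 2" "A \<noteq> {}" "A \<inter> W = {}"
    and "\<And>X. X \<noteq> {} \<Longrightarrow> X \<subseteq> A \<union> W \<Longrightarrow> A \<subseteq> X \<or> X \<inter> A = {} \<Longrightarrow> \<exists>e\<in>S. N e \<inter> X \<noteq> {} \<and> \<not> N e \<subseteq> X"
  shows "card W < card S"
  using assms
proof (induction "card W" arbitrary: W S rule: less_induct)
  case less
  obtain e where e: "e \<in> S" "N e \<inter> (A \<union> W) \<noteq> {}" "\<not> N e \<subseteq> A \<union> W"
    using less.prems(6)[of "A \<union> W"] less.prems(4) by auto
  then obtain x where x: "x \<in> N e" "x \<in> A \<union> W" by auto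
  have i: "N e \<inter> (A \<union> W) = {x}" using exit_edge_inter[of N e x "A \<union> W"] x e less.prems(3) by auto
  have cS: "card S = Suc (card (S - {e}))" using less.prems(2) e(1) by (metis card.remove)
  have step: "\<exists>f\<in>S - {e}. N f \<inter> X \<noteq> {} \<and> \<not> N f \<subseteq> X"
    if X: "X \<noteq> {}" "X \<subseteq> A \<union> W" "A \<subseteq> X \<or> X \<inter> A = {}" "x \<notin> X" for X
  proof -
    obtain f where f: "f \<in> S" "N f \<inter> X \<noteq> {}" "\<not> N f \<subseteq> X" using less.prems(6)[OF X(1-3)] by blast
    have "N e \<inter> X \<subseteq> {x}" using X(2) by (subst i[symmetric]) (rule Int_mono[OF order_refl])
    then have "N e \<inter> X = {}" using X(4) by auto
    then have "f \<noteq> e" using f(2) by auto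
    then show ?thesis using f by auto
  qed
  show ?case
  proof (cases "x \<in> A")
    case True
    then have xW: "x \<notin> W" using less.prems(5) by blast
    have "linked N W (S - {e})"
      unfolding linked_def
    proof (intro allI impI)
      fix X assume "X \<subseteq> W" "X \<noteq> {}"
      then show "\<exists>e\<in>S - {e}. N e \<inter> X \<noteq> {} \<and> \<not> N e \<subseteq> X"
        using less.prems(5) xW by (intro step) auto
    qed
    then have "card W \<le> card (S - {e})" using less.prems by (intro linked_card_le) auto
    then show ?thesis using cS by simp
  next
    case False
    then have xW: "x \<in> W" using x by auto
    have cW: "card W = Suc (card (W - {x}))" using less.prems(1) xW by (metis card.remove)
    have "card (W - {x}) < card (S - {e})"
    proof (rule less.hyps)
      fix X assume "X \<noteq> {}" "X \<subseteq> A \<union> (W - {x})" "A \<subseteq> X \<or> X \<inter> A = {}"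
      then show "\<exists>e\<in>S - {e}. N e \<inter> X \<noteq> {} \<and> \<not> N e \<subseteq> X"
        using False by (intro step) auto
    qed (use less.prems cW in auto)
    then show ?thesis using cS cW by simp
  qed
qed

text \<open>If \<open>A\<close> had no exit among the edges away from \<open>W\<close>, then contracting \<open>A\<close> to a point would make the
  \<open>card W\<close> edges at \<open>W\<close> connect \<open>card W + 1\<close> vertices to the sink.\<close>

lemma linked_away:
  assumes "finite W" "finite T" "\<forall>e\<in>T. card (N e) = 2" "W \<subseteq> V"
    and "linked N V T" "card (touching N T W) = card W"
  shows "linked N (V - W) (T - touching N T W)"
proof (rule ccontr)
  assume "\<not> ?thesis"
  then obtain A where A: "A \<subseteq> V - W" "A \<noteq> {}"
    and no: "\<And>e. e \<in> T - touching N T W \<Longrightarrow> N e \<inter> A = {} \<or> N e \<subseteq> A"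
    unfolding linked_def by meson
  have "card W < card (touching N T W)"
  proof (rule linked_card_less[of W "touching N T W" N A])
    fix X assume X: "X \<noteq> {}" "X \<subseteq> A \<union> W" "A \<subseteq> X \<or> X \<inter> A = {}"
    then obtain e where e: "e \<in> T" "N e \<inter> X \<noteq> {}" "\<not> N e \<subseteq> X"
      using linkedD[OF assms(5), of X] assms(4) A by blast
    have "e \<in> touching N T W"
    proof (rule ccontr)
      assume n: "e \<notin> touching N T W"
      then have *: "N e \<inter> A = {} \<or> N e \<subseteq> A" "N e \<inter> W = {}" using no[of e] e(1) by (auto simp: touching_def)
      have ne: "N e \<inter> X \<inter> A \<noteq> {}" using e(2) X(2) *(2) by auto
      then have "A \<subseteq> X" using X(3) by auto
      then show False using e(3) ne *(1) by auto
    qed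
    then show "\<exists>e\<in>touching N T W. N e \<inter> X \<noteq> {} \<and> \<not> N e \<subseteq> X" using e by blast
  qed (use assms A in \<open>auto simp: touching_def\<close>)
  then show False using assms(6) by simp
qed

text \<open>For a set \<open>A\<close> not inside \<open>W\<close> the cut around
  \<open>A - W\<close> is used: its edge avoids \<open>W\<close> and therefore leaves
  \<open>A\<close> as well.\<close>

lemma linked_Un:
  assumes "linked N (V - W) T" "linked N W S" "\<And>e. e \<in> T \<Longrightarrow> N e \<inter> W = {}"
  shows "linked N V (T \<union> S)"
  unfolding linked_def
proof (intro allI impI)
  fix A assume A: "A \<subseteq> V" "A \<noteq> {}"
  show "\<exists>e\<in>T \<union> S. N e \<inter> A \<noteq> {} \<and> \<not> N e \<subseteq> A"
  proof (cases "A \<subseteq> W")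
    case True
    then show ?thesis using linkedD[OF assms(2) True A(2)] by blast
  next
    case False
    then obtain e where e: "e \<in> T" "N e \<inter> (A - W) \<noteq> {}" "\<not> N e \<subseteq> A - W"
      using linkedD[OF assms(1), of "A - W"] A by auto
    then have "N e \<inter> A \<noteq> {}" "\<not> N e \<subseteq> A" using assms(3)[of e] by blast+
    then show ?thesis using e(1) by blast
  qed
qed

text \<open>A tree whose edges at \<open>W\<close> form a tree on \<open>W\<close> has exactly
  \<open>card (V - W)\<close> edges left, and by \<open>linked_away\<close> these connect
  \<open>V - W\<close> to the sink without passing through \<open>W\<close>. Hence the outer factor
  refers to the graph with \<open>W\<close> deleted.\<close>

theorem card_trees_split:
  assumes "sink_graph N V E" "W \<subseteq> V" "E' \<subseteq> touching N E W"
  shows "card {T \<in> trees N V E. T \<inter> touching N E W \<in> trees N W E'}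
    = card (trees N (V - W) (E - touching N E W)) * card (trees N W E')"
proof -
  let ?E = "touching N E W"
  have fin: "finite V" "finite W" "finite E" "\<forall>e\<in>E. card (N e) = 2"
    using assms finite_subset by (auto simp: sink_graph_def)
  have cV: "card V = card (V - W) + card W"
    using fin assms(2) by (metis card_Diff_subset card_mono le_add_diff_inverse2)
  have "bij_betw (\<lambda>(T, S). T \<union> S) (trees N (V - W) (E - ?E) \<times> trees N W E')
     {T \<in> trees N V E. T \<inter> ?E \<in> trees N W E'}"
  proof (rule bij_betw_byWitness[where f' = "\<lambda>T. (T - ?E, T \<inter> ?E)"])
    show "\<forall>a\<in>trees N (V - W) (E - ?E) \<times> trees N W E'.
       ((case a of (T, S) \<Rightarrow> T \<union> S) - ?E, (case a of (T, S) \<Rightarrow> T \<union> S) \<inter> ?E) = a"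
      using assms(3) unfolding trees_def by auto
    show "\<forall>a'\<in>{T \<in> trees N V E. T \<inter> ?E \<in> trees N W E'}. (case (a' - ?E, a' \<inter> ?E) of (T, S) \<Rightarrow> T \<union> S) = a'"
      by auto
    show "(\<lambda>(T, S). T \<union> S) ` (trees N (V - W) (E - ?E) \<times> trees N W E')
      \<subseteq> {T \<in> trees N V E. T \<inter> ?E \<in> trees N W E'}"
    proof clarify
      fix T S assume T: "T \<in> trees N (V - W) (E - ?E)" and S: "S \<in> trees N W E'"
      then have sub: "T \<subseteq> E - ?E" "S \<subseteq> E'" "S \<subseteq> ?E" "?E \<subseteq> E"
        and lin: "linked N (V - W) T" "linked N W S"
        and crd: "card T = card (V - W)" "card S = card W"
        using assms(3) by (auto simp: trees_def touching_def)
      have "(T \<union> S) \<inter> ?E = S" using sub by blast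
      moreover have "linked N V (T \<union> S)"
        using linked_Un[OF lin] sub(1) by (auto simp: touching_def)
      moreover have "card (T \<union> S) = card V"
      proof -
        have "finite ?E" using fin(3) by (simp add: touching_def)
        then have "finite T" "finite S" "T \<inter> S = {}"
          using sub fin(3) finite_subset[of T "E - ?E"] finite_subset[of S ?E] by auto
        then show ?thesis using card_Un_disjoint crd cV by metis
      qed
      ultimately show "T \<union> S \<in> trees N V E \<and> (T \<union> S) \<inter> ?E \<in> trees N W E'"
        using S sub unfolding trees_def by auto
    qed
    show "(\<lambda>T. (T - ?E, T \<inter> ?E)) ` {T \<in> trees N V E. T \<inter> ?E \<in> trees N W E'}
      \<subseteq> trees N (V - W) (E - ?E) \<times> trees N W E'"
    proof (rule image_subsetI)
      fix T assume "T \<in> {T \<in> trees N V E. T \<inter> ?E \<in> trees N W E'}"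
      then have T: "T \<in> trees N V E" and S: "T \<inter> ?E \<in> trees N W E'" by auto
      then have sub: "T \<subseteq> E" and lin: "linked N V T" and crd: "card T = card V" "card (T \<inter> ?E) = card W"
        by (auto simp: trees_def)
      have fT: "finite T" using sub fin finite_subset by auto
      have e: "touching N T W = T \<inter> ?E" using sub by (auto simp: touching_def)
      have "linked N (V - W) (T - touching N T W)"
        using fin fT sub assms(2) lin crd e by (intro linked_away) auto
      moreover have "T - touching N T W = T - ?E" using e by auto
      moreover have "card (T - ?E) = card (V - W)"
      proof -
        have "card T = card (T - ?E) + card (T \<inter> ?E)"
          using fT by (metis card_Diff_subset_Int card_mono finite_Int inf_le1 le_add_diff_inverse2)
        then show ?thesis using crd cV by simp
      qed
      ultimately show "(T - ?E, T \<inter> ?E) \<in> trees N (V - W) (E - ?E) \<times> trees N W E'"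
        using sub S by (auto simp: trees_def)
    qed
  qed
  from bij_betw_same_card[OF this] show ?thesis by (simp add: card_cartesian_product)
qed

text \<open>Outside, a vertex of \<open>V - W\<close> holds at least one particle per edge to
  \<open>W\<close>; taking these away leaves a configuration of the graph with \<open>W\<close>
  deleted. Inside, the left-over condition bounds the heights on \<open>W - Q\<close> by the induced
  degree, which is the degree in \<open>exits_at\<close>, while \<open>Q\<close> keeps its full
  degree.\<close>

theorem card_recs_split:
  assumes "sink_graph N V E" "Q \<subseteq> W" "W \<subseteq> V"
  shows "card {\<eta> \<in> recs N V E. leftover N V E Q \<eta> = W \<and> restrict \<eta> Q \<in> \<Xi>}
    = card (recs N (V - W) (E - touching N E W)) * card {\<eta> \<in> recs N W (exits_at N E Q W). restrict \<eta> Q \<in> \<Xi>}"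
proof -
  let ?E = "E - touching N E W" and ?F = "exits_at N E Q W"
  have fin: "finite V" "finite E" "\<forall>e\<in>E. card (N e) = 2"
    using assms by (auto simp: sink_graph_def)
  \<comment> \<open>For \<open>x\<close> outside \<open>W\<close> this is the number of edges from
    \<open>x\<close> to \<open>W\<close>, the shift between the two outer configurations.\<close>
  define w where "w x = card {e \<in> E. x \<in> N e \<and> N e \<inter> W \<noteq> {}}" for x
  have d1: "vdeg N E x = vdeg N ?E x + w x" for x
  proof -
    have "{e \<in> E. x \<in> N e} = {e \<in> ?E. x \<in> N e} \<union> {e \<in> E. x \<in> N e \<and> N e \<inter> W \<noteq> {}}"
      by (auto simp: touching_def)
    then show ?thesis unfolding vdeg_def w_def using fin
      by (subst card_Un_disjoint[symmetric]) (auto simp: touching_def)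
  qed
  have i1: "ideg N E (W \<union> A) x = ideg N ?E A x + w x" if "x \<in> A" "A \<subseteq> V - W" for A x
  proof -
    have "N e \<subseteq> W \<union> A" if "e \<in> E" "x \<in> N e" "y \<in> N e" "y \<in> W" for e y
    proof -
      have "x \<noteq> y" using that \<open>x \<in> A\<close> \<open>A \<subseteq> V - W\<close> by auto
      then have "N e = {x, y}" using fin(3) that by (metis card_2_iff insertE insert_commute singletonD)
      then show ?thesis using that \<open>x \<in> A\<close> by auto
    qed
    then have "{e \<in> E. x \<in> N e \<and> N e \<subseteq> W \<union> A}
      = {e \<in> ?E. x \<in> N e \<and> N e \<subseteq> A} \<union> {e \<in> E. x \<in> N e \<and> N e \<inter> W \<noteq> {}}"
      by (auto simp: touching_def)
    then show ?thesis unfolding ideg_def w_def using fin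
      by (subst card_Un_disjoint[symmetric]) (auto simp: touching_def)
  qed
  have d2: "vdeg N ?F x = (if x \<in> Q then vdeg N E x else ideg N E W x)" if "x \<in> W" for x
  proof -
    have "{e \<in> ?F. x \<in> N e} = (if x \<in> Q then {e \<in> E. x \<in> N e} else {e \<in> E. x \<in> N e \<and> N e \<subseteq> W})"
    proof (cases "x \<in> Q")
      case True
      then show ?thesis using that by (auto simp: exits_at_def touching_def)
    next
      case False
      have "N e \<subseteq> W" if "e \<in> E" "x \<in> N e" "y \<in> N e" "y \<in> Q" for e y
      proof -
        have "x \<noteq> y" using that False by auto
        then have "N e = {x, y}" using fin(3) that by (metis card_2_iff insertE insert_commute singletonD)
        then show ?thesis using that \<open>x \<in> W\<close> assms(2) by auto
      qed
      then show ?thesis using that False by (auto simp: exits_at_def touching_def)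
    qed
    then show ?thesis by (simp add: vdeg_def ideg_def)
  qed
  have i2: "ideg N ?F A x = ideg N E A x" if "x \<in> A" "A \<subseteq> W" for A x
    unfolding ideg_def exits_at_def touching_def using that by (intro arg_cong[where f = card]) auto
  have le: "ideg N E W x \<le> vdeg N E x" for x
    unfolding ideg_def vdeg_def using fin by (intro card_mono) auto
  define glue where "glue = (\<lambda>(\<eta>\<^sub>1, \<eta>\<^sub>2) x. if x \<in> W then \<eta>\<^sub>2 x else if x \<in> V then \<eta>\<^sub>1 x + w x else undefined)"
  let ?A = "recs N (V - W) ?E" and ?B = "{\<eta> \<in> recs N W ?F. restrict \<eta> Q \<in> \<Xi>}"
  let ?C = "{\<eta> \<in> recs N V E. leftover N V E Q \<eta> = W \<and> restrict \<eta> Q \<in> \<Xi>}"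
  have QV: "Q \<subseteq> V" using assms by auto
  note lo = leftover_eq_iff[OF fin(2) QV, of N]
  have "bij_betw glue (?A \<times> ?B) ?C"
  proof (rule bij_betw_byWitness[where f' = "\<lambda>\<eta>. (\<lambda>x\<in>V - W. \<eta> x - w x, restrict \<eta> W)"])
    show "\<forall>a\<in>?A \<times> ?B. (\<lambda>x\<in>V - W. glue a x - w x, restrict (glue a) W) = a"
    proof (clarify, rule conjI)
      fix \<eta>\<^sub>1 \<eta>\<^sub>2 assume "\<eta>\<^sub>1 \<in> ?A" "\<eta>\<^sub>2 \<in> recs N W ?F"
      then have e: "\<eta>\<^sub>1 \<in> extensional (V - W)" "\<eta>\<^sub>2 \<in> extensional W" by (auto simp: recs_def PiE_def)
      show "(\<lambda>x\<in>V - W. glue (\<eta>\<^sub>1, \<eta>\<^sub>2) x - w x) = \<eta>\<^sub>1"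
        using e(1) by (intro extensionalityI[of _ "V - W"]) (auto simp: glue_def)
      show "restrict (glue (\<eta>\<^sub>1, \<eta>\<^sub>2)) W = \<eta>\<^sub>2"
        using e(2) by (intro extensionalityI[of _ "W"]) (auto simp: glue_def)
    qed
    \<comment> \<open>The burning condition for the single vertex \<open>x\<close> already demands
      \<open>w x\<close> particles, so the truncated subtraction loses nothing.\<close>
    have wle: "w x \<le> \<eta> x" if "\<eta> \<in> ?C" "x \<in> V - W" for \<eta> x
    proof -
      have "leftover N V E Q \<eta> = W" using that(1) by simp
      then have "\<forall>A\<subseteq>V - W. A \<noteq> {} \<longrightarrow> (\<exists>x\<in>A. ideg N E (W \<union> A) x \<le> \<eta> x)" unfolding lo by simp
      from this[rule_format, of "{x}"] have "\<exists>y\<in>{x}. ideg N E (W \<union> {x}) y \<le> \<eta> y" using that(2) by auto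
      then have "ideg N E (W \<union> {x}) x \<le> \<eta> x" by simp
      then show ?thesis using i1[of x "{x}"] that by simp
    qed
    show "\<forall>\<eta>\<in>?C. glue (\<lambda>x\<in>V - W. \<eta> x - w x, restrict \<eta> W) = \<eta>"
    proof
      fix \<eta> assume \<eta>: "\<eta> \<in> ?C"
      then have "\<eta> \<in> extensional V" by (auto simp: recs_def PiE_def)
      then show "glue (\<lambda>x\<in>V - W. \<eta> x - w x, restrict \<eta> W) = \<eta>"
        using wle[OF \<eta>] assms(3) by (intro extensionalityI[of _ V]) (auto simp: glue_def extensional_def)
    qed
    show "glue ` (?A \<times> ?B) \<subseteq> ?C"
    proof clarify
      fix \<eta>\<^sub>1 \<eta>\<^sub>2 assume a: "\<eta>\<^sub>1 \<in> ?A" and b: "\<eta>\<^sub>2 \<in> recs N W ?F" and x: "restrict \<eta>\<^sub>2 Q \<in> \<Xi>"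
      let ?\<eta> = "glue (\<eta>\<^sub>1, \<eta>\<^sub>2)"
      have gW: "?\<eta> x = \<eta>\<^sub>2 x" if "x \<in> W" for x using that by (simp add: glue_def)
      have gV: "?\<eta> x = \<eta>\<^sub>1 x + w x" if "x \<in> V - W" for x using that by (simp add: glue_def)
      have st1: "\<eta>\<^sub>1 x < vdeg N ?E x" if "x \<in> V - W" for x using a that by (auto simp: recs_def PiE_iff)
      have st2: "\<eta>\<^sub>2 x < vdeg N ?F x" if "x \<in> W" for x using b that by (auto simp: recs_def PiE_iff)
      have "?\<eta> x < vdeg N E x" if "x \<in> V" for x
      proof (cases "x \<in> W")
        case True then show ?thesis using gW[OF True] st2[OF True] d2[OF True] le[of x] by (auto split: if_splits)
      next
        case False then show ?thesis using gV[of x] st1[of x] that d1[of x] by auto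
      qed
      moreover have "?\<eta> \<in> extensional V" using assms(3) by (auto simp: extensional_def glue_def)
      ultimately have 1: "?\<eta> \<in> (\<Pi>\<^sub>E x\<in>V. {0..<vdeg N E x})" by (auto simp: PiE_iff)
      have max: "\<exists>x\<in>A. ideg N E (W \<union> A) x \<le> ?\<eta> x" if A: "A \<subseteq> V - W" "A \<noteq> {}" for A
      proof -
        obtain x where x: "x \<in> A" "ideg N ?E A x \<le> \<eta>\<^sub>1 x" using ampleD[OF recs_ample[OF a] A] by auto
        then have "x \<in> V - W" using A by blast
        then show ?thesis using x i1[OF x(1) A(1)] gV[of x] by (intro bexI[of _ x]) auto
      qed
      have "\<exists>x\<in>A. ideg N E A x \<le> ?\<eta> x" if A: "A \<subseteq> V" "A \<noteq> {}" for A
      proof (cases "A \<subseteq> W")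
        case True
        then obtain x where x: "x \<in> A" "ideg N ?F A x \<le> \<eta>\<^sub>2 x" using ampleD[OF recs_ample[OF b] True A(2)] by auto
        then show ?thesis using i2[OF x(1) True] gW[of x] True by (intro bexI[of _ x]) auto
      next
        case False
        \<comment> \<open>A set reaching outside \<open>W\<close> is served by its outer part, whose
          witness tolerates all of \<open>W\<close> as neighbours.\<close>
        then obtain x where x: "x \<in> A - W" "ideg N E (W \<union> (A - W)) x \<le> ?\<eta> x"
          using max[of "A - W"] A by auto
        have "ideg N E A x \<le> ideg N E (W \<union> (A - W)) x" using fin(2) by (intro ideg_mono) auto
        then show ?thesis using x by (intro bexI[of _ x]) auto
      qed
      then have 2: "ample N V E ?\<eta>" by (simp add: ample_def)
      have 3: "leftover N V E Q ?\<eta> = W"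
        unfolding lo
      proof (intro conjI ballI allI impI)
        fix x assume "x \<in> W - Q"
        then show "?\<eta> x < ideg N E W x" using gW[of x] st2[of x] d2[of x] by auto
      qed (use assms max in auto)
      have "restrict ?\<eta> Q = restrict \<eta>\<^sub>2 Q" using gW assms(2) by (intro restrict_ext) auto
      then show "?\<eta> \<in> recs N V E \<and> leftover N V E Q ?\<eta> = W \<and> restrict ?\<eta> Q \<in> \<Xi>"
        using 1 2 3 x by (simp add: recs_def)
    qed
    show "(\<lambda>\<eta>. (\<lambda>x\<in>V - W. \<eta> x - w x, restrict \<eta> W)) ` ?C \<subseteq> ?A \<times> ?B"
    proof (rule image_subsetI)
      fix \<eta> assume \<eta>: "\<eta> \<in> ?C"
      then have st: "\<And>x. x \<in> V \<Longrightarrow> \<eta> x < vdeg N E x" and am: "ample N V E \<eta>" and L: "leftover N V E Q \<eta> = W"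
        and q: "restrict \<eta> Q \<in> \<Xi>" by (auto simp: recs_def PiE_iff)
      note L = L[unfolded lo]
      let ?\<eta>\<^sub>1 = "\<lambda>x\<in>V - W. \<eta> x - w x" and ?\<eta>\<^sub>2 = "restrict \<eta> W"
      have "\<exists>x\<in>A. ideg N ?E A x \<le> ?\<eta>\<^sub>1 x" if A: "A \<subseteq> V - W" "A \<noteq> {}" for A
      proof -
        from L have "\<forall>A\<subseteq>V - W. A \<noteq> {} \<longrightarrow> (\<exists>x\<in>A. ideg N E (W \<union> A) x \<le> \<eta> x)" by simp
        from this[rule_format, OF A] obtain x where x: "x \<in> A" "ideg N E (W \<union> A) x \<le> \<eta> x" by auto
        then have "x \<in> V - W" using A by blast
        then show ?thesis using x i1[OF x(1) A(1)] by (intro bexI[of _ x]) auto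
      qed
      moreover have "?\<eta>\<^sub>1 x < vdeg N ?E x" if "x \<in> V - W" for x
        using wle[OF \<eta> that] st[of x] d1[of x] that by auto
      ultimately have 1: "?\<eta>\<^sub>1 \<in> ?A" by (auto simp: recs_def ample_def PiE_iff)
      have "\<exists>x\<in>A. ideg N ?F A x \<le> ?\<eta>\<^sub>2 x" if A: "A \<subseteq> W" "A \<noteq> {}" for A
      proof -
        obtain x where x: "x \<in> A" "ideg N E A x \<le> \<eta> x" using ampleD[OF am, of A] A assms(3) by auto
        then show ?thesis using i2[OF x(1) A(1)] A by (intro bexI[of _ x]) auto
      qed
      moreover have "?\<eta>\<^sub>2 x < vdeg N ?F x" if "x \<in> W" for x
        using d2[OF that] L st[of x] that assms(3) by auto
      ultimately have "?\<eta>\<^sub>2 \<in> recs N W ?F" by (auto simp: recs_def ample_def PiE_iff)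
      moreover have "restrict ?\<eta>\<^sub>2 Q \<in> \<Xi>"
        using q assms(2) by (simp add: restrict_restrict Int_absorb1)
      ultimately show "(?\<eta>\<^sub>1, ?\<eta>\<^sub>2) \<in> ?A \<times> ?B" using 1 by auto
    qed
  qed
  from bij_betw_same_card[OF this] show ?thesis by (simp add: card_cartesian_product)
qed

section \<open>The Markov chain\<close>

definition mult :: "('e \<Rightarrow> 'v set) \<Rightarrow> 'e set \<Rightarrow> 'v \<Rightarrow> 'v \<Rightarrow> nat" where
  "mult N E x y = card {e \<in> E. N e = {x, y}}"

text \<open>This and the next definitions restate the chain in the encoding without a sink vertex;
  the chain of a wired graph is identified with them later.\<close>

definition topple_at :: "('e \<Rightarrow> 'v set) \<Rightarrow> 'v set \<Rightarrow> 'e set \<Rightarrow> 'v \<Rightarrow> ('v \<Rightarrow> nat) \<Rightarrow> 'v \<Rightarrow> nat" where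
  "topple_at N U E x \<eta> = (\<lambda>y\<in>U. if y = x then \<eta> x - vdeg N E x else \<eta> y + mult N E x y)"

definition topples :: "('e \<Rightarrow> 'v set) \<Rightarrow> 'v set \<Rightarrow> 'e set \<Rightarrow> (('v \<Rightarrow> nat) \<times> ('v \<Rightarrow> nat)) set" where
  "topples N U E = {(\<eta>, topple_at N U E x \<eta>) | \<eta> x. x \<in> U \<and> vdeg N E x \<le> \<eta> x}"

definition stables :: "('e \<Rightarrow> 'v set) \<Rightarrow> 'v set \<Rightarrow> 'e set \<Rightarrow> ('v \<Rightarrow> nat) set" where
  "stables N U E = (\<Pi>\<^sub>E x\<in>U. {0..<vdeg N E x})"

definition stab :: "('e \<Rightarrow> 'v set) \<Rightarrow> 'v set \<Rightarrow> 'e set \<Rightarrow> ('v \<Rightarrow> nat) \<Rightarrow> 'v \<Rightarrow> nat" where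
  "stab N U E \<eta> = (THE \<xi>. (\<eta>, \<xi>) \<in> (topples N U E)\<^sup>* \<and> \<xi> \<in> stables N U E)"

definition add_grain :: "('e \<Rightarrow> 'v set) \<Rightarrow> 'v set \<Rightarrow> 'e set \<Rightarrow> 'v \<Rightarrow> ('v \<Rightarrow> nat) \<Rightarrow> 'v \<Rightarrow> nat" where
  "add_grain N U E x \<eta> = stab N U E (\<eta>(x := \<eta> x + 1))"

definition grain_kernel :: "('e \<Rightarrow> 'v set) \<Rightarrow> 'v set \<Rightarrow> 'e set \<Rightarrow> ('v \<Rightarrow> nat) \<Rightarrow> ('v \<Rightarrow> nat) pmf" where
  "grain_kernel N U E \<eta> = map_pmf (\<lambda>x. add_grain N U E x \<eta>) (pmf_of_set U)"

section \<open>Termination and confluence of topplings\<close>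

lemma mult_commute: "mult N E x y = mult N E y x"
  by (simp add: mult_def insert_commute)

lemma ideg_eq_sum:
  assumes "finite A" "finite E" "\<forall>e\<in>E. card (N e) = 2" "x \<in> A"
  shows "ideg N E A x = (\<Sum>y\<in>A - {x}. mult N E x y)"
proof -
  have "{e \<in> E. x \<in> N e \<and> N e \<subseteq> A} = (\<Union>y\<in>A - {x}. {e \<in> E. N e = {x, y}})"
  proof (rule set_eqI)
    fix e
    show "e \<in> {e \<in> E. x \<in> N e \<and> N e \<subseteq> A} \<longleftrightarrow> e \<in> (\<Union>y\<in>A - {x}. {e \<in> E. N e = {x, y}})"
    proof
      assume e: "e \<in> {e \<in> E. x \<in> N e \<and> N e \<subseteq> A}"
      then obtain a b where ab: "N e = {a, b}" "a \<noteq> b" using assms(3) by (auto simp: card_2_iff)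
      then have "\<exists>y. y \<in> A - {x} \<and> N e = {x, y}"
        using e by (cases "x = a") (auto simp: insert_commute)
      then show "e \<in> (\<Union>y\<in>A - {x}. {e \<in> E. N e = {x, y}})" using e by auto
    qed (use assms(4) in auto)
  qed
  moreover have "card (\<Union>y\<in>A - {x}. {e \<in> E. N e = {x, y}}) = (\<Sum>y\<in>A - {x}. card {e \<in> E. N e = {x, y}})"
    using assms by (intro card_UN_disjoint) (auto simp: doubleton_eq_iff)
  ultimately show ?thesis by (simp add: ideg_def mult_def)
qed

lemma ideg_le_vdeg: "finite E \<Longrightarrow> ideg N E A x \<le> vdeg N E x"
  unfolding ideg_def vdeg_def by (intro card_mono) auto

text \<open>An integer weight that is strictly superharmonic with value 0 at the sink, so that every
  toppling lowers the total weight. The induction absorbs a neighbour \<open>x\<close> of the sink,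
  gives it weight \<open>C\<close> and raises the weights of all other vertices by
  \<open>C\<close>.\<close>

lemma superharmonic_weight:
  assumes "finite U" "finite E" "\<forall>e\<in>E. card (N e) = 2" "linked N U E"
  shows "\<exists>h :: 'v \<Rightarrow> nat. \<forall>x\<in>U. (\<Sum>y\<in>U - {x}. mult N E x y * h y) < vdeg N E x * h x"
  using assms(1,4)
proof (induction "card U" arbitrary: U)
  case 0
  then show ?case by simp
next
  case (Suc n)
  then have "U \<noteq> {}" by auto
  then obtain e x where e: "e \<in> E" "x \<in> N e" "x \<in> U" "\<not> N e \<subseteq> U"
    using linked_exit[OF Suc.prems(2)] by metis
  have "linked N (U - {x}) E" using linked_subset[OF Suc.prems(2)] by auto
  moreover have "n = card (U - {x})" using Suc.hyps(2) Suc.prems(1) e(3) by simp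
  ultimately obtain h where h:
    "\<And>y. y \<in> U - {x} \<Longrightarrow> (\<Sum>w\<in>U - {x} - {y}. mult N E y w * h w) < vdeg N E y * h y"
    using Suc.hyps(1)[of "U - {x}"] Suc.prems(1) by auto
  \<comment> \<open>At \<open>x\<close> the old weights contribute less than \<open>C\<close>, and
    the edge to the sink gains at least \<open>C\<close>. At the other vertices the constant
    \<open>C\<close> is harmless and the old strict inequality survives.\<close>
  define C where "C = Suc (\<Sum>y\<in>U - {x}. mult N E x y * h y)"
  define g where "g y = (if y = x then C else C + h y)" for y
  have "(\<Sum>w\<in>U - {y}. mult N E y w * g w) < vdeg N E y * g y" if y: "y \<in> U" for y
  proof -
    have s: "(\<Sum>w\<in>U - {y}. mult N E y w * g w)
        = C * (\<Sum>w\<in>U - {y}. mult N E y w) + (\<Sum>w\<in>U - {y} - {x}. mult N E y w * h w)"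
    proof -
      have "(\<Sum>w\<in>U - {y}. mult N E y w * g w)
        = (\<Sum>w\<in>U - {y}. C * mult N E y w + (if w \<in> U - {y} - {x} then mult N E y w * h w else 0))"
        by (intro sum.cong) (auto simp: g_def algebra_simps)
      also have "\<dots> = C * (\<Sum>w\<in>U - {y}. mult N E y w)
          + (\<Sum>w\<in>U - {y}. if w \<in> U - {y} - {x} then mult N E y w * h w else 0)"
        by (simp add: sum.distrib sum_distrib_left)
      also have "(\<Sum>w\<in>U - {y}. if w \<in> U - {y} - {x} then mult N E y w * h w else 0)
          = (\<Sum>w\<in>(U - {y}) \<inter> (U - {y} - {x}). mult N E y w * h w)"
        using Suc.prems(1) by (intro sum.inter_restrict[symmetric]) auto
      also have "(U - {y}) \<inter> (U - {y} - {x}) = U - {y} - {x}" by auto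
      finally show ?thesis .
    qed
    have d: "(\<Sum>w\<in>U - {y}. mult N E y w) = ideg N E U y"
      using ideg_eq_sum[OF Suc.prems(1) assms(2,3) y] by simp
    show ?thesis
    proof (cases "y = x")
      case True
      have "Suc (ideg N E U x) \<le> vdeg N E x" using ideg_less_vdeg[of E e x N U] assms(2) e by auto
      then have "C * Suc (ideg N E U x) \<le> C * vdeg N E x" by (rule mult_le_mono2)
      then show ?thesis using s d True by (simp add: g_def C_def algebra_simps)
    next
      case False
      have "C * ideg N E U y \<le> C * vdeg N E y" using ideg_le_vdeg[OF assms(2)] by (rule mult_le_mono2)
      moreover have "(\<Sum>w\<in>U - {y} - {x}. mult N E y w * h w) < vdeg N E y * h y"
        using h[of y] y False by (simp add: Diff_insert2[symmetric] insert_commute)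
      ultimately have "C * ideg N E U y + (\<Sum>w\<in>U - {y} - {x}. mult N E y w * h w)
          < C * vdeg N E y + vdeg N E y * h y" by (rule add_le_less_mono)
      then show ?thesis using s d False by (simp add: g_def algebra_simps)
    qed
  qed
  then show ?case by blast
qed

lemma topples_irreducible: "\<xi> \<in> stables N U E \<Longrightarrow> (\<xi>, \<xi>') \<notin> topples N U E"
  by (fastforce simp: stables_def topples_def PiE_iff)

lemma topple_at_commute:
  assumes "x \<noteq> y" "vdeg N E x \<le> \<eta> x" "vdeg N E y \<le> \<eta> y" "x \<in> U" "y \<in> U"
  shows "topple_at N U E y (topple_at N U E x \<eta>) = topple_at N U E x (topple_at N U E y \<eta>)"
  using assms by (auto simp: topple_at_def fun_eq_iff)

text \<open>Toppling one vertex can only add particles at another, so both stay unstable and can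
  topple in either order.\<close>

lemma topples_diamond:
  assumes "(\<eta>, \<xi>) \<in> topples N U E" "(\<eta>, \<xi>') \<in> topples N U E"
  shows "\<xi> = \<xi>' \<or> (\<exists>\<zeta>. (\<xi>, \<zeta>) \<in> topples N U E \<and> (\<xi>', \<zeta>) \<in> topples N U E)"
proof -
  obtain x where x: "x \<in> U" "vdeg N E x \<le> \<eta> x" "\<xi> = topple_at N U E x \<eta>"
    using assms(1) by (auto simp: topples_def)
  obtain y where y: "y \<in> U" "vdeg N E y \<le> \<eta> y" "\<xi>' = topple_at N U E y \<eta>"
    using assms(2) by (auto simp: topples_def)
  show ?thesis
  proof (cases "x = y")
    case False
    have "vdeg N E y \<le> \<xi> y" "vdeg N E x \<le> \<xi>' x" using x y False by (auto simp: topple_at_def)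
    then have "(\<xi>, topple_at N U E y \<xi>) \<in> topples N U E" "(\<xi>', topple_at N U E x \<xi>') \<in> topples N U E"
      using x(1) y(1) by (auto simp: topples_def)
    moreover have "topple_at N U E y \<xi> = topple_at N U E x \<xi>'"
      using topple_at_commute[OF False] x y by simp
    ultimately show ?thesis by metis
  qed (use x y in simp)
qed

text \<open>The diamond needs at most one step on each side, so a single toppling can be carried
  along a whole sequence and remains at most one step.\<close>

lemma topples_strip:
  assumes "(\<eta>, \<xi>) \<in> (topples N U E)\<^sup>*" "(\<eta>, \<xi>') \<in> topples N U E"
  shows "\<exists>\<zeta>. (\<xi>, \<zeta>) \<in> (topples N U E)\<^sup>= \<and> (\<xi>', \<zeta>) \<in> (topples N U E)\<^sup>*"
  using assms(1)
proof induction
  case base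
  then show ?case using assms(2) by auto
next
  case (step a b)
  then obtain \<zeta> where z: "(a, \<zeta>) \<in> (topples N U E)\<^sup>=" "(\<xi>', \<zeta>) \<in> (topples N U E)\<^sup>*" by auto
  show ?case
  proof (cases "a = \<zeta>")
    case True
    then have "(\<xi>', b) \<in> (topples N U E)\<^sup>*" using z(2) step.hyps(2) by (metis rtrancl.rtrancl_into_rtrancl)
    then show ?thesis by auto
  next
    case False
    then have "(a, \<zeta>) \<in> topples N U E" using z by auto
    from topples_diamond[OF step.hyps(2) this] show ?thesis
      using z(2) by (auto intro: rtrancl.rtrancl_into_rtrancl)
  qed
qed

text \<open>By the strip lemma, the first step of the one sequence leads to a configuration from
  which the other stable result is still reachable.\<close>

lemma topples_stable_unique:
  assumes "(\<eta>, \<xi>) \<in> (topples N U E)\<^sup>*" "(\<eta>, \<xi>') \<in> (topples N U E)\<^sup>*"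
    and "\<xi> \<in> stables N U E" "\<xi>' \<in> stables N U E"
  shows "\<xi> = \<xi>'"
  using assms(1,2)
proof (induction rule: converse_rtrancl_induct)
  case base
  then show ?case using topples_irreducible[OF assms(3)] by (metis converse_rtranclE)
next
  case (step a b)
  obtain \<zeta> where z: "(\<xi>', \<zeta>) \<in> (topples N U E)\<^sup>=" "(b, \<zeta>) \<in> (topples N U E)\<^sup>*"
    using topples_strip[OF step.prems step.hyps(1)] by auto
  then have "\<zeta> = \<xi>'" using topples_irreducible[OF assms(4)] by auto
  then show ?case using step.IH z by simp
qed

text \<open>The total weight under a superharmonic \<open>h\<close> is a natural number that drops
  at each toppling.\<close>

lemma topples_stabilize:
  assumes "finite U" "finite E" "\<forall>e\<in>E. card (N e) = 2" "linked N U E" "\<eta> \<in> extensional U"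
  shows "\<exists>\<xi>\<in>stables N U E. (\<eta>, \<xi>) \<in> (topples N U E)\<^sup>*"
proof -
  obtain h :: "'a \<Rightarrow> nat" where h: "\<And>x. x \<in> U \<Longrightarrow> (\<Sum>y\<in>U - {x}. mult N E x y * h y) < vdeg N E x * h x"
    using superharmonic_weight[OF assms(1-4)] by auto
  show ?thesis using assms(5)
  proof (induction "\<Sum>x\<in>U. h x * \<eta> x" arbitrary: \<eta> rule: less_induct)
    case less
    show ?case
    proof (cases "\<eta> \<in> stables N U E")
      case False
      then obtain x where x: "x \<in> U" "vdeg N E x \<le> \<eta> x"
        using less.prems by (fastforce simp: stables_def PiE_iff not_less)
      let ?\<eta> = "topple_at N U E x \<eta>"
      have "(\<Sum>y\<in>U. h y * ?\<eta> y) = h x * (\<eta> x - vdeg N E x) + (\<Sum>y\<in>U - {x}. h y * (\<eta> y + mult N E x y))"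
        using x assms(1) by (subst sum.remove[of _ x]) (auto simp: topple_at_def intro!: sum.cong)
      also have "\<dots> = h x * (\<eta> x - vdeg N E x) + (\<Sum>y\<in>U - {x}. h y * \<eta> y) + (\<Sum>y\<in>U - {x}. mult N E x y * h y)"
        by (simp add: algebra_simps sum.distrib)
      also have "\<dots> < h x * (\<eta> x - vdeg N E x) + (\<Sum>y\<in>U - {x}. h y * \<eta> y) + vdeg N E x * h x"
        using h[OF x(1)] by simp
      also have "\<dots> = h x * \<eta> x + (\<Sum>y\<in>U - {x}. h y * \<eta> y)"
      proof -
        have "h x * (\<eta> x - vdeg N E x) + vdeg N E x * h x = h x * (\<eta> x - vdeg N E x + vdeg N E x)"
          by (simp add: algebra_simps)
        then show ?thesis using x(2) by simp
      qed
      also have "\<dots> = (\<Sum>y\<in>U. h y * \<eta> y)" using x assms(1) by (simp add: sum.remove[of U x])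
      finally have "\<exists>\<xi>\<in>stables N U E. (?\<eta>, \<xi>) \<in> (topples N U E)\<^sup>*"
        by (intro less.hyps) (auto simp: topple_at_def)
      moreover have "(\<eta>, ?\<eta>) \<in> topples N U E" using x by (auto simp: topples_def)
      ultimately show ?thesis by (meson converse_rtrancl_into_rtrancl)
    qed auto
  qed
qed

lemma stab_eqI:
  assumes "(\<eta>, \<xi>) \<in> (topples N U E)\<^sup>*" "\<xi> \<in> stables N U E"
  shows "stab N U E \<eta> = \<xi>"
  unfolding stab_def
proof (rule the_equality)
  show "(\<eta>, \<xi>) \<in> (topples N U E)\<^sup>* \<and> \<xi> \<in> stables N U E" using assms by simp
  fix \<zeta> assume "(\<eta>, \<zeta>) \<in> (topples N U E)\<^sup>* \<and> \<zeta> \<in> stables N U E"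
  then show "\<zeta> = \<xi>" using topples_stable_unique[of \<eta> \<zeta> N U E \<xi>] assms by simp
qed

lemma stab_stable: "\<eta> \<in> stables N U E \<Longrightarrow> stab N U E \<eta> = \<eta>"
  by (rule stab_eqI) auto

lemma stab_properties:
  assumes "finite U" "finite E" "\<forall>e\<in>E. card (N e) = 2" "linked N U E" "\<eta> \<in> extensional U"
  shows "(\<eta>, stab N U E \<eta>) \<in> (topples N U E)\<^sup>*" "stab N U E \<eta> \<in> stables N U E"
  using topples_stabilize[OF assms] stab_eqI[of \<eta> _ N U E] by auto

text \<open>Here \<open>z\<close> counts the topplings at each vertex, so two configurations
  connected by topplings differ by an element of the Laplacian lattice. Integers are used because
  differences of two such counts are needed.\<close>

lemma topples_odometer:
  assumes "(\<eta>, \<xi>) \<in> (topples N U E)\<^sup>*" "finite U"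
  shows "\<exists>z :: 'v \<Rightarrow> int. \<forall>y\<in>U. int (\<xi> y) = int (\<eta> y) - z y * int (vdeg N E y) + (\<Sum>x\<in>U - {y}. z x * int (mult N E x y))"
  using assms(1)
proof induction
  case base
  show ?case by (rule exI[of _ "\<lambda>_. 0"]) simp
next
  case (step a b)
  then obtain z where z: "\<And>y. y \<in> U \<Longrightarrow> int (a y) = int (\<eta> y) - z y * int (vdeg N E y) + (\<Sum>x\<in>U - {y}. z x * int (mult N E x y))"
    by auto
  obtain x where x: "x \<in> U" "vdeg N E x \<le> a x" "b = topple_at N U E x a"
    using step.hyps(2) by (auto simp: topples_def)
  let ?z = "\<lambda>w. z w + (if w = x then 1 else 0)"
  have "int (b y) = int (\<eta> y) - ?z y * int (vdeg N E y) + (\<Sum>w\<in>U - {y}. ?z w * int (mult N E w y))" if "y \<in> U" for y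
  proof -
    have "(\<Sum>w\<in>U - {y}. ?z w * int (mult N E w y))
      = (\<Sum>w\<in>U - {y}. z w * int (mult N E w y) + (if w = x then int (mult N E x y) else 0))"
      by (intro sum.cong) (auto simp: algebra_simps)
    also have "\<dots> = (\<Sum>w\<in>U - {y}. z w * int (mult N E w y)) + (if x \<in> U - {y} then int (mult N E x y) else 0)"
      using assms(2) by (simp add: sum.distrib sum.delta)
    finally show ?thesis using z[OF that] x that by (auto simp: topple_at_def algebra_simps of_nat_diff)
  qed
  then show ?case by (intro exI[of _ ?z]) blast
qed

text \<open>If \<open>z\<close> had a positive maximum, the set where it is attained would violate ampleness of \<open>\<eta>'\<close>.\<close>

lemma lattice_equivalent_le:
  assumes "finite U" "finite E" "\<forall>e\<in>E. card (N e) = 2"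
    and "\<And>y. y \<in> U \<Longrightarrow> \<eta> y < vdeg N E y" "ample N U E \<eta>'"
    and z: "\<And>y. y \<in> U \<Longrightarrow> int (\<eta>' y) = int (\<eta> y) - z y * int (vdeg N E y) + (\<Sum>x\<in>U - {y}. z x * int (mult N E x y))"
    and "y \<in> U"
  shows "z y \<le> 0"
proof (rule ccontr)
  assume "\<not> z y \<le> 0"
  define k where "k = Max (z ` U)"
  have kz: "z w \<le> k" if "w \<in> U" for w unfolding k_def using assms(1) that by (intro Max_ge) auto
  have k: "k > 0" using kz[OF assms(7)] \<open>\<not> z y \<le> 0\<close> by simp
  have "k \<in> z ` U" unfolding k_def using assms(1,7) by (intro Max_in) auto
  then have "{w \<in> U. z w = k} \<noteq> {}" by auto
  then obtain x where x: "x \<in> U" "z x = k" "ideg N E {w \<in> U. z w = k} x \<le> \<eta>' x"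
    using assms(5) unfolding ample_def by (smt (verit) mem_Collect_eq subsetI)
  let ?A = "{w \<in> U. z w = k}"
  have sU: "ideg N E U x = (\<Sum>w\<in>U - {x}. mult N E x w)" using ideg_eq_sum[of U E N x] assms x by simp
  have sA: "ideg N E ?A x = (\<Sum>w\<in>?A - {x}. mult N E x w)" using ideg_eq_sum[of ?A E N x] assms x by simp
  have "(\<Sum>w\<in>U - {x}. z w * int (mult N E w x))
    \<le> (\<Sum>w\<in>U - {x}. (k - 1) * int (mult N E x w) + (if w \<in> ?A - {x} then int (mult N E x w) else 0))"
  proof (rule sum_mono)
    fix w assume w: "w \<in> U - {x}"
    \<comment> \<open>As \<open>z\<close> is integer-valued, it drops by at least one off the set
      where the maximum is attained.\<close>
    have "z w \<le> (k - 1) + (if w \<in> ?A - {x} then 1 else 0)" using kz[of w] w by auto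
    then have "z w * int (mult N E x w) \<le> ((k - 1) + (if w \<in> ?A - {x} then 1 else 0)) * int (mult N E x w)"
      by (rule mult_right_mono) simp
    then show "z w * int (mult N E w x) \<le> (k - 1) * int (mult N E x w) + (if w \<in> ?A - {x} then int (mult N E x w) else 0)"
      by (simp add: mult_commute[of N E w x] algebra_simps split: if_splits)
  qed
  also have "\<dots> = (k - 1) * int (ideg N E U x) + int (ideg N E ?A x)"
  proof -
    have "(\<Sum>w\<in>U - {x}. if w \<in> ?A - {x} then int (mult N E x w) else 0) = (\<Sum>w\<in>(U - {x}) \<inter> (?A - {x}). int (mult N E x w))"
      using assms(1) by (intro sum.inter_restrict[symmetric]) auto
    also have "(U - {x}) \<inter> (?A - {x}) = ?A - {x}" by auto
    finally show ?thesis by (simp add: sum.distrib sum_distrib_left sU sA)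
  qed
  \<comment> \<open>Positivity of \<open>k\<close> enters here: an edge from \<open>x\<close> to the
    sink carries the value 0, which is at most \<open>k - 1\<close>.\<close>
  also have "(k - 1) * int (ideg N E U x) \<le> (k - 1) * int (vdeg N E x)"
    using k ideg_le_vdeg[OF assms(2), of N U x] by (intro mult_left_mono) auto
  finally have "int (\<eta>' x) \<le> int (\<eta> x) - k * int (vdeg N E x) + (k - 1) * int (vdeg N E x) + int (ideg N E ?A x)"
    using z[OF x(1)] x(2) by simp
  then have "int (\<eta>' x) \<le> int (\<eta> x) - int (vdeg N E x) + int (ideg N E ?A x)" by (simp add: algebra_simps)
  then show False using assms(4)[OF x(1)] x(3) by simp
qed

text \<open>The maximum argument applies to \<open>z\<close> and to \<open>- z\<close>, so
  \<open>z\<close> vanishes: each class of the Laplacian lattice contains at most one recurrent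
  configuration.\<close>

lemma recs_lattice_unique:
  assumes "sink_graph N U E" "\<eta> \<in> recs N U E" "\<eta>' \<in> recs N U E"
    and z: "\<And>y. y \<in> U \<Longrightarrow> int (\<eta>' y) = int (\<eta> y) - z y * int (vdeg N E y) + (\<Sum>x\<in>U - {y}. z x * int (mult N E x y))"
  shows "\<eta> = \<eta>'"
proof -
  have fin: "finite U" "finite E" "\<forall>e\<in>E. card (N e) = 2" using assms(1) by (auto simp: sink_graph_def)
  have st: "\<And>y. y \<in> U \<Longrightarrow> \<eta> y < vdeg N E y" "\<And>y. y \<in> U \<Longrightarrow> \<eta>' y < vdeg N E y"
    and am: "ample N U E \<eta>" "ample N U E \<eta>'" and ext: "\<eta> \<in> extensional U" "\<eta>' \<in> extensional U"
    using assms(2,3) by (auto simp: recs_def PiE_iff)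
  have z': "int (\<eta> y) = int (\<eta>' y) - (- z y) * int (vdeg N E y) + (\<Sum>x\<in>U - {y}. (- z x) * int (mult N E x y))"
    if "y \<in> U" for y using z[OF that] by (simp add: sum_negf)
  have "z y = 0" if "y \<in> U" for y
    using lattice_equivalent_le[OF fin st(1) am(2) z that]
      lattice_equivalent_le[OF fin st(2) am(1) z' that] by simp
  then have "\<eta> y = \<eta>' y" if "y \<in> U" for y using z[OF that] that by simp
  then show ?thesis using ext by (intro extensionalityI[of _ U]) auto
qed

text \<open>If \<open>x \<in> A\<close>, a witness \<open>y\<close> for \<open>A - {x}\<close>
  serves: returning \<open>x\<close> to the set raises the demand at \<open>y\<close> by
  \<open>mult N E x y\<close>, exactly what \<open>y\<close> receives.\<close>

lemma ample_topple_at: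
  assumes "finite U" "finite E" "\<forall>e\<in>E. card (N e) = 2" "ample N U E \<eta>" "x \<in> U"
  shows "ample N U E (topple_at N U E x \<eta>)"
  unfolding ample_def
proof (intro allI impI)
  fix A assume A: "A \<subseteq> U" "A \<noteq> {}"
  have fA: "finite A" using A assms(1) finite_subset by auto
  show "\<exists>y\<in>A. ideg N E A y \<le> topple_at N U E x \<eta> y"
  proof (cases "x \<in> A")
    case False
    obtain y where y: "y \<in> A" "ideg N E A y \<le> \<eta> y" using assms(4) A unfolding ample_def by auto
    then have "\<eta> y \<le> topple_at N U E x \<eta> y" using False A by (auto simp: topple_at_def)
    then show ?thesis using y by (intro bexI[of _ y]) auto
  next
    case True
    show ?thesis
    proof (cases "A - {x} = {}")
      case True
      then have "A = {x}" using A by auto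
      then have "ideg N E A x = 0" using ideg_eq_sum[OF fA assms(2,3) \<open>x \<in> A\<close>] by simp
      then show ?thesis using \<open>x \<in> A\<close> by (intro bexI[of _ x]) auto
    next
      case False
      moreover have "A - {x} \<subseteq> U" using A by auto
      ultimately obtain y where y: "y \<in> A - {x}" "ideg N E (A - {x}) y \<le> \<eta> y"
        using assms(4) unfolding ample_def by meson
      have "ideg N E A y = (\<Sum>w\<in>A - {y}. mult N E y w)" using y fA assms by (intro ideg_eq_sum) auto
      also have "\<dots> = mult N E y x + (\<Sum>w\<in>A - {y} - {x}. mult N E y w)"
        using True y fA by (subst sum.remove[of _ x]) auto
      also have "A - {y} - {x} = A - {x} - {y}" by auto
      also have "(\<Sum>w\<in>A - {x} - {y}. mult N E y w) = ideg N E (A - {x}) y"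
        using y fA assms by (intro ideg_eq_sum[symmetric]) auto
      finally have "ideg N E A y \<le> topple_at N U E x \<eta> y"
        using y A mult_commute[of N E x y] by (auto simp: topple_at_def)
      then show ?thesis using y by (intro bexI[of _ y]) auto
    qed
  qed
qed

lemma ample_mono: "ample N U E \<eta> \<Longrightarrow> (\<And>x. x \<in> U \<Longrightarrow> \<eta> x \<le> \<eta>' x) \<Longrightarrow> ample N U E \<eta>'"
  unfolding ample_def by (meson order_trans subsetD)

lemma ample_topples:
  assumes "(\<eta>, \<xi>) \<in> (topples N U E)\<^sup>*" "finite U" "finite E" "\<forall>e\<in>E. card (N e) = 2" "ample N U E \<eta>"
  shows "ample N U E \<xi>"
  using assms(1)
proof induction
  case base then show ?case using assms by simp
next
  case (step a b)
  then show ?case using ample_topple_at[OF assms(2-4), of a] by (auto simp: topples_def)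
qed

lemma recs_subset_stables: "recs N U E \<subseteq> stables N U E"
  by (auto simp: recs_def stables_def)

locale linked_sink_graph =
  fixes N :: "'e \<Rightarrow> 'v set" and U :: "'v set" and E :: "'e set"
  assumes sink_graph: "sink_graph N U E" and linked: "linked N U E" and nonempty: "U \<noteq> {}"
begin

lemma finiteness: "finite U" "finite E" "\<forall>e\<in>E. card (N e) = 2"
  using sink_graph by (auto simp: sink_graph_def)

abbreviation "a \<equiv> add_grain N U E"
abbreviation "R \<equiv> recs N U E"

section \<open>Adding a particle permutes the recurrent configurations\<close>

lemma incremented_extensional: "\<eta> \<in> stables N U E \<Longrightarrow> x \<in> U \<Longrightarrow> \<eta>(x := \<eta> x + 1) \<in> extensional U"
  by (auto simp: stables_def PiE_iff extensional_def)

lemma add_grain_stable: "\<eta> \<in> stables N U E \<Longrightarrow> x \<in> U \<Longrightarrow> a x \<eta> \<in> stables N U E"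
  unfolding add_grain_def by (rule stab_properties[OF finiteness linked incremented_extensional])

lemma add_grain_rec:
  assumes "\<eta> \<in> R" "x \<in> U" shows "a x \<eta> \<in> R"
proof -
  have s: "\<eta> \<in> stables N U E" using assms recs_subset_stables by auto
  note p = stab_properties[OF finiteness linked incremented_extensional[OF s assms(2)]]
  have "ample N U E \<eta>" using assms by (simp add: recs_def)
  then have "ample N U E (\<eta>(x := \<eta> x + 1))" by (rule ample_mono) simp
  then have "ample N U E (a x \<eta>)"
    unfolding add_grain_def using ample_topples[OF p(1) finiteness] by simp
  then show ?thesis using add_grain_stable[OF s assms(2)] by (simp add: recs_def stables_def)
qed

text \<open>If the results agree, the added particle cancels and the starting points differ by the
  difference of two toppling counts, hence lie in the same class of the lattice.\<close>

lemma add_grain_inj: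
  assumes "x \<in> U" shows "inj_on (a x) R"
proof (rule inj_onI)
  fix \<eta> \<eta>' assume h: "\<eta> \<in> R" "\<eta>' \<in> R" and e: "a x \<eta> = a x \<eta>'"
  then have s: "\<eta> \<in> stables N U E" "\<eta>' \<in> stables N U E" using recs_subset_stables by auto
  let ?p = "\<eta>(x := \<eta> x + 1)" and ?p' = "\<eta>'(x := \<eta>' x + 1)"
  have r: "(?p, a x \<eta>) \<in> (topples N U E)\<^sup>*" "(?p', a x \<eta>) \<in> (topples N U E)\<^sup>*"
    using stab_properties(1)[OF finiteness linked incremented_extensional[OF s(1) assms]]
      stab_properties(1)[OF finiteness linked incremented_extensional[OF s(2) assms]] e
    by (simp_all add: add_grain_def)
  obtain z where z: "\<And>y. y \<in> U \<Longrightarrow> int (a x \<eta> y) = int (?p y) - z y * int (vdeg N E y) + (\<Sum>x\<in>U - {y}. z x * int (mult N E x y))"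
    using topples_odometer[OF r(1) finiteness(1)] by auto
  obtain z' where z': "\<And>y. y \<in> U \<Longrightarrow> int (a x \<eta> y) = int (?p' y) - z' y * int (vdeg N E y) + (\<Sum>x\<in>U - {y}. z' x * int (mult N E x y))"
    using topples_odometer[OF r(2) finiteness(1)] by auto
  have "int (\<eta>' y) = int (\<eta> y) - (z y - z' y) * int (vdeg N E y) + (\<Sum>x\<in>U - {y}. (z x - z' x) * int (mult N E x y))"
    if "y \<in> U" for y
  proof -
    have "int (\<eta>' y) - int (\<eta> y) = int (?p' y) - int (?p y)" by simp
    then show ?thesis using z[OF that] z'[OF that] by (simp add: algebra_simps sum_subtractf)
  qed
  then show "\<eta> = \<eta>'" by (rule recs_lattice_unique[OF sink_graph h])
qed

lemma add_grain_bij: "x \<in> U \<Longrightarrow> bij_betw (a x) R R"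
  unfolding bij_betw_def
  using add_grain_rec by (intro conjI add_grain_inj endo_inj_surj finite_recs finiteness) auto

definition "full = (\<lambda>x\<in>U. vdeg N E x - 1)"

lemma vdeg_positive: "x \<in> U \<Longrightarrow> 0 < vdeg N E x"
proof -
  assume "x \<in> U"
  then obtain e where "e \<in> E" "N e \<inter> {x} \<noteq> {}" using linkedD[OF linked, of "{x}"] by auto
  then show ?thesis using finiteness(2) by (intro vdeg_pos[of E e]) auto
qed

lemma full_rec: "full \<in> R"
proof -
  have "\<exists>x\<in>A. ideg N E A x \<le> full x" if A: "A \<subseteq> U" "A \<noteq> {}" for A
  proof -
    obtain e x where e: "e \<in> E" "x \<in> N e" "x \<in> A" "\<not> N e \<subseteq> A"
      using linkedD[OF linked A] by auto
    then have "ideg N E A x < vdeg N E x" using finiteness(2) by (intro ideg_less_vdeg[of E e]) auto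
    then show ?thesis using e A by (intro bexI[of _ x]) (auto simp: full_def)
  qed
  then show ?thesis using vdeg_positive by (auto simp: recs_def full_def ample_def PiE_iff)
qed

text \<open>From any configuration the maximal one is reached by raising vertices below their
  maximum, where additions cause no toppling. Hence two closed nonempty sets always meet.\<close>

lemma full_mem_closed:
  assumes S: "S \<subseteq> stables N U E" "\<And>\<eta> x. \<eta> \<in> S \<Longrightarrow> x \<in> U \<Longrightarrow> a x \<eta> \<in> S" and "S \<noteq> {}"
  shows "full \<in> S"
proof -
  have "\<eta> \<in> S \<Longrightarrow> full \<in> S" for \<eta>
  proof (induction "\<Sum>x\<in>U. vdeg N E x - 1 - \<eta> x" arbitrary: \<eta> rule: less_induct)
    case less
    then have st: "\<eta> \<in> stables N U E" using S by auto
    show ?case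
    proof (cases "\<exists>x\<in>U. \<eta> x < vdeg N E x - 1")
      case True
      then obtain x where x: "x \<in> U" "\<eta> x < vdeg N E x - 1" by auto
      let ?\<eta> = "\<eta>(x := \<eta> x + 1)"
      have "?\<eta> \<in> stables N U E" using st x by (auto simp: stables_def PiE_iff extensional_def)
      then have "a x \<eta> = ?\<eta>" by (simp add: add_grain_def stab_stable)
      then have "?\<eta> \<in> S" using S(2)[OF less.prems x(1)] by simp
      moreover have "(\<Sum>y\<in>U. vdeg N E y - 1 - ?\<eta> y) < (\<Sum>y\<in>U. vdeg N E y - 1 - \<eta> y)"
        using x finiteness(1) by (intro sum_strict_mono_ex1) auto
      ultimately show ?thesis using less.hyps by blast
    next
      case False
      have "\<eta> = full"
      proof (rule extensionalityI[of _ U])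
        fix x assume "x \<in> U"
        then have "\<eta> x < vdeg N E x" "\<not> \<eta> x < vdeg N E x - 1" using st False by (auto simp: stables_def PiE_iff)
        then show "\<eta> x = full x" using \<open>x \<in> U\<close> by (simp add: full_def)
      qed (use st in \<open>auto simp: stables_def PiE_iff full_def\<close>)
      then show ?thesis using less.prems by simp
    qed
  qed
  then show ?thesis using \<open>S \<noteq> {}\<close> by auto
qed

section \<open>The stationary distribution is unique and uniform\<close>

lemma bind_grain_kernel:
  "bind_pmf p (grain_kernel N U E) = bind_pmf (pmf_of_set U) (\<lambda>x. map_pmf (a x) p)"
  unfolding grain_kernel_def map_pmf_def by (rule bind_commute_pmf)

lemma uniform_stationary: "bind_pmf (pmf_of_set R) (grain_kernel N U E) = pmf_of_set R"
proof -
  have "map_pmf (a x) (pmf_of_set R) = pmf_of_set R" if "x \<in> set_pmf (pmf_of_set U)" for x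
    using that nonempty finiteness(1) full_rec finite_recs[OF finiteness(1), of N E]
    by (intro map_pmf_of_set_bij_betw add_grain_bij) auto
  then have "bind_pmf (pmf_of_set U) (\<lambda>x. map_pmf (a x) (pmf_of_set R)) = bind_pmf (pmf_of_set U) (\<lambda>_. pmf_of_set R)"
    by (intro bind_pmf_cong) auto
  then show ?thesis unfolding bind_grain_kernel by simp
qed

lemma prob_bind_pmf: "measure_pmf.prob (bind_pmf M f) A = (\<integral>x. measure_pmf.prob (f x) A \<partial>measure_pmf M)"
proof -
  have "measure_pmf.prob q A = pmf (map_pmf (\<lambda>y. y \<in> A) q) True" for q
    by (simp add: pmf_map vimage_def)
  then show ?thesis by (simp add: map_bind_pmf pmf_bind)
qed

text \<open>The stationarity equation on an event, multiplied by \<open>card U\<close>. In this form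
  termwise inequalities between the two sums become equalities.\<close>

lemma measure_stationary:
  assumes "bind_pmf p (grain_kernel N U E) = p"
  shows "(\<Sum>x\<in>U. measure_pmf.prob p {\<eta>. a x \<eta> \<in> A}) = (\<Sum>x\<in>U. measure_pmf.prob p A)"
proof -
  have "measure_pmf.prob p A = measure_pmf.prob (bind_pmf (pmf_of_set U) (\<lambda>x. map_pmf (a x) p)) A"
    using assms unfolding bind_grain_kernel by simp
  also have "\<dots> = (\<integral>x. measure_pmf.prob (map_pmf (a x) p) A \<partial>measure_pmf (pmf_of_set U))"
    by (rule prob_bind_pmf)
  also have "\<dots> = (\<Sum>x\<in>U. measure_pmf.prob (map_pmf (a x) p) A) / card U"
    using nonempty finiteness(1) by (simp add: integral_pmf_of_set)
  finally show ?thesis using nonempty finiteness(1)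
    by (simp add: measure_map_pmf vimage_def field_simps)
qed

lemma stationary_unique:
  assumes "set_pmf p \<subseteq> stables N U E" and st: "bind_pmf p (grain_kernel N U E) = p"
  shows "p = pmf_of_set R"
proof -
  have finR: "finite R" using finite_recs finiteness by auto
  have closed: "a x \<eta> \<in> set_pmf p" if "\<eta> \<in> set_pmf p" "x \<in> U" for x \<eta>
  proof -
    have "a x \<eta> \<in> set_pmf (grain_kernel N U E \<eta>)"
      using that finiteness(1) nonempty by (auto simp: grain_kernel_def)
    then have "a x \<eta> \<in> set_pmf (bind_pmf p (grain_kernel N U E))" using that by auto
    then show ?thesis using st by simp
  qed
  have supp: "set_pmf p \<subseteq> R"
  proof (rule ccontr)
    assume "\<not> set_pmf p \<subseteq> R"
    \<comment> \<open>\<open>R\<close> is closed, so no mass leaves it; by stationarity these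
      inequalities are equalities, so no mass enters it. Hence the part of the support outside
      \<open>R\<close> is itself closed and, if nonempty, would contain \<open>full\<close>.\<close>
    have le: "measure_pmf.prob p R \<le> measure_pmf.prob p {\<eta>. a x \<eta> \<in> R}" if "x \<in> U" for x
      using add_grain_rec that by (intro measure_pmf.finite_measure_mono) auto
    have "full \<in> set_pmf p - R"
    proof (rule full_mem_closed)
      fix \<eta> x assume \<eta>: "\<eta> \<in> set_pmf p - R" and x: "x \<in> U"
      have eq: "measure_pmf.prob p R = measure_pmf.prob p {\<eta>. a x \<eta> \<in> R}"
        by (rule sum_mono_inv[OF measure_stationary[OF st, symmetric] le x finiteness(1)])
      have "a x \<eta> \<notin> R"
      proof
        assume "a x \<eta> \<in> R"
        then have "measure_pmf.prob p (R \<union> {\<eta>}) \<le> measure_pmf.prob p {\<eta>. a x \<eta> \<in> R}"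
          using add_grain_rec x by (intro measure_pmf.finite_measure_mono) auto
        moreover have "measure_pmf.prob p (R \<union> {\<eta>}) = measure_pmf.prob p R + pmf p \<eta>"
          using \<eta> by (subst measure_pmf.finite_measure_Union) (auto simp: measure_pmf_single)
        moreover have "pmf p \<eta> > 0" using \<eta> by (simp add: pmf_positive)
        ultimately show False using eq by simp
      qed
      then show "a x \<eta> \<in> set_pmf p - R" using closed \<eta> x by auto
    qed (use assms(1) \<open>\<not> set_pmf p \<subseteq> R\<close> in auto)
    then show False using full_rec by auto
  qed
  define M where "M = Max (pmf p ` R)"
  have leM: "pmf p \<eta> \<le> M" if "\<eta> \<in> R" for \<eta>
    unfolding M_def using finR that by (intro Max_ge) auto
  define X where "X = {\<eta> \<in> R. pmf p \<eta> = M}"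
  have "M \<in> pmf p ` R" unfolding M_def using finR full_rec by (intro Max_in) auto
  then have X: "X \<noteq> {}" "finite X" "X \<subseteq> R" using finR by (auto simp: X_def)
  \<comment> \<open>A maximum principle: each \<open>a y\<close> permutes \<open>R\<close>, so a
    maximiser receives from each \<open>y\<close> the mass of one point, at most \<open>M\<close>.
    These masses average to \<open>M\<close>, so each of them equals \<open>M\<close>.\<close>
  have backward: "\<eta> \<in> X" if \<eta>: "\<eta> \<in> R" "a x \<eta> \<in> X" and x: "x \<in> U" for \<eta> x
  proof -
    let ?\<xi> = "a x \<eta>"
    have pre: "measure_pmf.prob p {\<zeta>. a y \<zeta> \<in> {?\<xi>}} = pmf p \<zeta>" if "y \<in> U" "\<zeta> \<in> R" "a y \<zeta> = ?\<xi>" for y \<zeta>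
    proof -
      have "{\<zeta>. a y \<zeta> \<in> {?\<xi>}} \<inter> set_pmf p = {\<zeta>} \<inter> set_pmf p"
        using supp that inj_onD[OF add_grain_inj[OF that(1)]] by auto
      then have "measure_pmf.prob p {\<zeta>. a y \<zeta> \<in> {?\<xi>}} = measure_pmf.prob p {\<zeta>}"
        by (metis measure_Int_set_pmf)
      then show ?thesis by (simp add: measure_pmf_single)
    qed
    have le: "measure_pmf.prob p {\<zeta>. a y \<zeta> \<in> {?\<xi>}} \<le> measure_pmf.prob p {?\<xi>}" if y: "y \<in> U" for y
    proof -
      have "?\<xi> \<in> a y ` R" using add_grain_bij[OF y] \<eta>(2) X(3) by (auto simp: bij_betw_def)
      then obtain \<zeta> where "\<zeta> \<in> R" "a y \<zeta> = ?\<xi>" by auto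
      then show ?thesis using pre[OF y] leM[of \<zeta>] \<eta>(2) by (simp add: measure_pmf_single X_def)
    qed
    have "measure_pmf.prob p {\<zeta>. a x \<zeta> \<in> {?\<xi>}} = measure_pmf.prob p {?\<xi>}"
      by (rule sum_mono_inv[OF measure_stationary[OF st] le x finiteness(1)])
    then show ?thesis using pre[OF x \<eta>(1) refl] \<eta> by (simp add: measure_pmf_single X_def)
  qed
  \<comment> \<open>The preimage of \<open>X\<close> in \<open>R\<close> lies in \<open>X\<close>
    and has the same finite cardinality, so it is all of \<open>X\<close>.\<close>
  have forward: "a x \<eta> \<in> X" if "\<eta> \<in> X" "x \<in> U" for \<eta> x
  proof -
    have "{\<eta> \<in> R. a x \<eta> \<in> X} = X"
    proof (rule card_seteq)
      have "bij_betw (a x) {\<eta> \<in> R. a x \<eta> \<in> X} X"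
        using add_grain_bij[OF that(2)] X(3) by (auto simp: bij_betw_def inj_on_def)
      then show "card X \<le> card {\<eta> \<in> R. a x \<eta> \<in> X}" using bij_betw_same_card by fastforce
    qed (use backward that X in auto)
    then show ?thesis using that by auto
  qed
  have st': "R \<subseteq> stables N U E" by (rule recs_subset_stables)
  have "full \<in> X" using forward X st' by (intro full_mem_closed) (blast, blast, simp)
  \<comment> \<open>By \<open>backward\<close> the set \<open>R - X\<close> is closed too, but
    \<open>full\<close> already lies in \<open>X\<close>.\<close>
  have "R \<subseteq> X"
  proof (rule ccontr)
    assume "\<not> R \<subseteq> X"
    then have "full \<in> R - X" using backward add_grain_rec st'
      by (intro full_mem_closed) (blast, blast, simp)
    then show False using \<open>full \<in> X\<close> by simp
  qed
  then have const: "pmf p \<eta> = M" if "\<eta> \<in> R" for \<eta> using that by (auto simp: X_def)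
  have "(\<Sum>\<eta>\<in>R. pmf p \<eta>) = 1" using finR supp by (rule sum_pmf_eq_1)
  then have "card R * M = 1" using const by simp
  moreover have "card R \<noteq> 0" using full_rec finR by auto
  ultimately have "M = 1 / card R" by (simp add: field_simps)
  show ?thesis
  proof (rule pmf_eqI)
    fix \<eta>
    show "pmf p \<eta> = pmf (pmf_of_set R) \<eta>"
    proof (cases "\<eta> \<in> R")
      case True
      have "pmf (pmf_of_set R) \<eta> = 1 / card R"
        using True finR by (subst pmf_of_set) auto
      then show ?thesis using const[OF True] \<open>M = 1 / card R\<close> by simp
    next
      case False
      then have "\<eta> \<notin> set_pmf p" using supp by auto
      then have "pmf p \<eta> = 0" by (simp add: set_pmf_iff)
      moreover have "pmf (pmf_of_set R) \<eta> = 0"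
        using False finR full_rec by (subst pmf_of_set) auto
      ultimately show ?thesis by simp
    qed
  qed
qed

end

section \<open>Wired graphs\<close>

lemma rtrancl_crossing:
  assumes "(x, y) \<in> r\<^sup>*" "x \<in> A" "y \<notin> A"
  shows "\<exists>u v. (u, v) \<in> r \<and> u \<in> A \<and> v \<notin> A"
  using assms by (induction rule: rtrancl_induct) blast+

lemma rtrancl_simple_path:
  assumes "(a, b) \<in> r\<^sup>*"
  shows "\<exists>vs. vs \<noteq> [] \<and> hd vs = a \<and> last vs = b \<and> distinct vs \<and>
    (\<forall>i. Suc i < length vs \<longrightarrow> (vs ! i, vs ! Suc i) \<in> r)"
  using assms
proof (induction rule: rtrancl_induct)
  case base
  show ?case by (rule exI[of _ "[a]"]) simp
next
  case (step y z)
  then obtain vs where vs: "vs \<noteq> []" "hd vs = a" "last vs = y" "distinct vs"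
    "\<And>i. Suc i < length vs \<Longrightarrow> (vs ! i, vs ! Suc i) \<in> r" by auto
  show ?case
  proof (cases "z \<in> set vs")
    case True
    then obtain xs ys where s: "vs = xs @ z # ys" by (meson split_list)
    have "(( xs @ [z]) ! i, (xs @ [z]) ! Suc i) \<in> r" if "Suc i < length (xs @ [z])" for i
    proof -
      have "(xs @ [z]) ! i = vs ! i" "(xs @ [z]) ! Suc i = vs ! Suc i"
        using that by (auto simp: s nth_append nth_Cons split: nat.split)
      then show ?thesis using vs(5)[of i] that s by simp
    qed
    moreover have "hd (xs @ [z]) = a" using vs(2) s by (cases xs) auto
    moreover have "distinct (xs @ [z])" using vs(4) s by simp
    ultimately show ?thesis by (intro exI[of _ "xs @ [z]"]) auto
  next
    case False
    have "((vs @ [z]) ! i, (vs @ [z]) ! Suc i) \<in> r" if "Suc i < length (vs @ [z])" for i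
    proof (cases "Suc i < length vs")
      case True then show ?thesis using vs(5) by (simp add: nth_append)
    next
      case False
      then have "i = length vs - 1" using that by simp
      then show ?thesis using vs(1,3) step.hyps(2) by (simp add: nth_append last_conv_nth)
    qed
    then show ?thesis using vs False by (intro exI[of _ "vs @ [z]"]) auto
  qed
qed

text \<open>A dictionary from the option-typed graph \<open>wired G W\<close> to the encoding by
  \<open>N\<close>, \<open>W\<close> and \<open>E\<close>; \<open>f\<close> is the quotient map
  sending everything outside \<open>W\<close> to the sink.\<close>

locale wired_graph =
  fixes G :: "('v, 'e) mgraph" and W :: "'v set"
  assumes wf: "wf_mgraph G" and fin: "finite W" and sub: "W \<subseteq> verts G"
begin

abbreviation "N \<equiv> ends G"
abbreviation "E \<equiv> touching (ends G) (edges G) W"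
abbreviation "H \<equiv> wired G W"
abbreviation "f \<equiv> (\<lambda>x. if x \<in> W then Some x else None)"

lemma card_ends: "e \<in> edges G \<Longrightarrow> card (N e) = 2"
  using wf by (auto simp: wf_mgraph_def)

lemma edges_wired: "edges H = E"
  by (simp add: wired_def touching_def)

lemma ends_wired: "ends H e = f ` N e"
  by (simp add: wired_def)

lemma ends_pair:
  assumes "e \<in> E" "x \<in> W" "x \<in> N e"
  obtains y where "N e = {x, y}" "x \<noteq> y" "ends H e = {Some x, f y}"
proof -
  have "e \<in> edges G" using assms(1) by (simp add: touching_def)
  from card_ends[OF this] obtain a b where "N e = {a, b}" "a \<noteq> b" by (auto simp: card_2_iff)
  then obtain y where y: "N e = {x, y}" "x \<noteq> y" using assms(3) by (cases "x = a") (auto simp: insert_commute)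
  then show ?thesis using that[OF y] assms(2) by (simp add: ends_wired)
qed

lemma nonsink_wired: "nonsink H = W"
  by (auto simp: nonsink_def wired_def)

lemma some_mem_ends_wired: "Some x \<in> ends H e \<longleftrightarrow> x \<in> W \<and> x \<in> N e"
  by (auto simp: ends_wired split: if_splits)

lemma deg_wired: "x \<in> W \<Longrightarrow> deg H (Some x) = vdeg N E x"
  by (simp add: deg_def incident_def vdeg_def some_mem_ends_wired edges_wired)

lemma edges_between_wired:
  assumes "x \<in> W" "y \<in> W" "x \<noteq> y"
  shows "edges_between H (Some x) (Some y) = {e \<in> E. N e = {x, y}}"
proof -
  have "ends H e = {Some x, Some y} \<longleftrightarrow> N e = {x, y}" if e: "e \<in> E" for e
  proof
    assume a: "ends H e = {Some x, Some y}"
    then have "x \<in> N e" "y \<in> N e" using some_mem_ends_wired by (metis insertI1, metis insertI1 insert_commute)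
    moreover obtain z where "N e = {x, z}" using ends_pair[OF e assms(1) \<open>x \<in> N e\<close>] by metis
    ultimately show "N e = {x, y}" using assms(3) by auto
  qed (use assms in \<open>auto simp: ends_wired\<close>)
  then show ?thesis by (auto simp: edges_between_def edges_wired)
qed

lemma stable_sandpiles_wired: "stable_sandpiles H = stables N W E"
  unfolding stable_sandpiles_def stables_def nonsink_wired by (intro PiE_cong) (simp add: deg_wired)

lemma topple_wired: "x \<in> W \<Longrightarrow> topple H x \<eta> = topple_at N W E x \<eta>"
  unfolding topple_def topple_at_def nonsink_wired
  by (intro restrict_ext) (auto simp: deg_wired edges_between_wired mult_def)

lemma toppling_wired: "toppling H = topples N W E"
  unfolding toppling_def topples_def nonsink_wired using topple_wired deg_wired
  by (intro Collect_cong) metis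

lemma stabilization_wired: "stabilization H \<eta> = stab N W E \<eta>"
  by (simp add: stabilization_def stab_def toppling_wired stable_sandpiles_wired)

lemma sandpile_kernel_wired: "sandpile_kernel H = grain_kernel N W E"
  by (simp add: fun_eq_iff sandpile_kernel_def grain_kernel_def add_grain_def stabilization_wired nonsink_wired)

lemma sink_graph_wired: "finite E \<Longrightarrow> sink_graph N W E"
  using fin card_ends by (auto simp: sink_graph_def touching_def)

lemma sandpile_measure_wired:
  assumes "finite E" "linked N W E" "W \<noteq> {}"
  shows "sandpile_measure H = pmf_of_set (recs N W E)"
proof -
  interpret linked_sink_graph N W E
    using assms sink_graph_wired by unfold_locales auto
  have fR: "finite (recs N W E)" "recs N W E \<noteq> {}" using finite_recs[OF fin] full_rec by auto
  show ?thesis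
    unfolding sandpile_measure_def stationary_sandpile_def sandpile_kernel_wired stable_sandpiles_wired
  proof (rule the_equality)
    show "set_pmf (pmf_of_set (recs N W E)) \<subseteq> stables N W E \<and>
      bind_pmf (pmf_of_set (recs N W E)) (grain_kernel N W E) = pmf_of_set (recs N W E)"
      using uniform_stationary recs_subset_stables fR by (simp add: set_pmf_of_set)
  qed (use stationary_unique in blast)
qed

section \<open>Connectedness, cycles and spanning trees of the wired graph\<close>

lemma adj_wired_sub: "adj (H\<lparr>edges := T\<rparr>) = {(a, b). \<exists>e\<in>T. ends H e = {a, b}}"
  by (auto simp: adj_def edges_between_def)

lemma adj_wired_sym: "sym (adj (H\<lparr>edges := T\<rparr>))"
  unfolding adj_wired_sub by (auto simp: sym_def insert_commute)

lemma exit_of_path: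
  assumes "T \<subseteq> E" "(a, b) \<in> (adj (H\<lparr>edges := T\<rparr>))\<^sup>*" "a \<in> Some ` A" "b \<notin> Some ` A" "A \<subseteq> W"
  shows "\<exists>e\<in>T. N e \<inter> A \<noteq> {} \<and> \<not> N e \<subseteq> A"
proof -
  obtain u v e where e: "e \<in> T" "ends H e = {u, v}" "u \<in> Some ` A" "v \<notin> Some ` A"
    using rtrancl_crossing[OF assms(2-4)] by (auto simp: adj_wired_sub)
  then obtain x where x: "u = Some x" "x \<in> A" by auto
  have "Some x \<in> ends H e" using e x by simp
  then have xe: "x \<in> N e" by (simp add: some_mem_ends_wired)
  have "v \<in> ends H e" using e(2) by simp
  then have "v \<in> f ` N e" by (simp only: ends_wired)
  then obtain y where y: "y \<in> N e" "v = f y" by blast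
  have "y \<notin> A" using y e(4) assms(5) by auto
  then show ?thesis using e(1) x xe y(1) by blast
qed

lemma verts_wired: "verts H = insert None (Some ` W)"
  by (simp add: wired_def)

text \<open>The vertices not connected to the sink would form a set that no edge of \<open>T\<close>
  leaves.\<close>

lemma linked_reach:
  assumes "T \<subseteq> E" "linked N W T" "a \<in> verts H"
  shows "(None, a) \<in> (adj (H\<lparr>edges := T\<rparr>))\<^sup>*"
proof (rule ccontr)
  let ?R = "adj (H\<lparr>edges := T\<rparr>)"
  define A where "A = {x \<in> W. (None, Some x) \<notin> ?R\<^sup>*}"
  assume "(None, a) \<notin> ?R\<^sup>*"
  then have "A \<noteq> {}" using assms(3) by (auto simp: A_def verts_wired)
  then obtain e u where e: "e \<in> T" "u \<in> N e" "u \<in> A" "\<not> N e \<subseteq> A"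
    using linkedD[OF assms(2), of A] by (auto simp: A_def)
  then have "e \<in> E" "u \<in> W" using assms(1) by (auto simp: A_def)
  then obtain v where v: "N e = {u, v}" "ends H e = {Some u, f v}"
    using ends_pair e(2) by metis
  have "v \<notin> A" using e(3,4) v(1) by simp
  then have "(None, f v) \<in> ?R\<^sup>*" by (simp add: A_def)
  moreover have "(f v, Some u) \<in> ?R"
    unfolding adj_wired_sub using v(2) e(1) doubleton_eq_iff by blast
  ultimately have "(None, Some u) \<in> ?R\<^sup>*" by (rule rtrancl_into_rtrancl)
  then show False using e(3) by (simp add: A_def)
qed

lemma connected_wired_sub:
  assumes "T \<subseteq> E"
  shows "connected_mgraph (H\<lparr>edges := T\<rparr>) \<longleftrightarrow> linked N W T"
proof
  assume c: "connected_mgraph (H\<lparr>edges := T\<rparr>)"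
  show "linked N W T"
    unfolding linked_def
  proof (intro allI impI)
    fix A assume A: "A \<subseteq> W" "A \<noteq> {}"
    then obtain x where "x \<in> A" by auto
    moreover have "(Some x, None) \<in> (adj (H\<lparr>edges := T\<rparr>))\<^sup>*"
      using c \<open>x \<in> A\<close> A by (auto simp: connected_mgraph_def verts_wired)
    ultimately show "\<exists>e\<in>T. N e \<inter> A \<noteq> {} \<and> \<not> N e \<subseteq> A"
      using A by (intro exit_of_path[OF assms]) auto
  qed
next
  assume l: "linked N W T"
  have "(a, b) \<in> (adj (H\<lparr>edges := T\<rparr>))\<^sup>*" if "a \<in> verts H" "b \<in> verts H" for a b
    using linked_reach[OF assms l that(1)] linked_reach[OF assms l that(2)]
      sym_rtrancl[OF adj_wired_sym] by (meson rtrancl_trans symD)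
  then show "connected_mgraph (H\<lparr>edges := T\<rparr>)" by (auto simp: connected_mgraph_def verts_wired)
qed

text \<open>The rest of the cycle still joins the two ends of the removed edge, so it replaces that
  edge in every cut.\<close>

lemma cycle_removable:
  assumes "T \<subseteq> E" "linked N W T" "is_cycle (H\<lparr>edges := T\<rparr>) vs es"
  shows "\<exists>e\<in>T. linked N W (T - {e})"
proof -
  let ?n = "length vs"
  have n: "vs \<noteq> []" "length es = ?n" "distinct es"
    and c: "\<And>i. i < ?n \<Longrightarrow> es ! i \<in> T \<and> ends H (es ! i) = {vs ! i, vs ! (Suc i mod ?n)}"
    using assms(3) by (auto simp: is_cycle_def edges_between_def)
  define e where "e = es ! 0"
  let ?R = "adj (H\<lparr>edges := T - {e}\<rparr>)"
  have step: "(vs ! i, vs ! (Suc i mod ?n)) \<in> ?R" if "0 < i" "i < ?n" for i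
  proof -
    have "es ! i \<noteq> e" using that n by (simp add: e_def nth_eq_iff_index_eq)
    then show ?thesis using c[OF that(2)] by (auto simp: adj_wired_sub)
  qed
  \<comment> \<open>The walk starts at the successor of \<open>vs ! 0\<close> and follows the cycle
    without its edge 0; for \<open>i = ?n - 1\<close> the index wraps round to
    \<open>vs ! 0\<close>.\<close>
  have path: "(vs ! (Suc 0 mod ?n), vs ! (Suc i mod ?n)) \<in> ?R\<^sup>*" if "i < ?n" for i
    using that
  proof (induction i)
    case (Suc i)
    then have "(vs ! (Suc 0 mod ?n), vs ! (Suc i)) \<in> ?R\<^sup>*" by simp
    then show ?case using step[of "Suc i"] Suc.prems by (meson rtrancl.rtrancl_into_rtrancl zero_less_Suc)
  qed simp
  have eT: "e \<in> T" "ends H e = {vs ! 0, vs ! (Suc 0 mod ?n)}" using c[of 0] n(1) by (auto simp: e_def)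
  have p: "(vs ! (Suc 0 mod ?n), vs ! 0) \<in> ?R\<^sup>*" using path[of "?n - 1"] n(1) by simp
  then have p': "(vs ! 0, vs ! (Suc 0 mod ?n)) \<in> ?R\<^sup>*" using sym_rtrancl[OF adj_wired_sym] by (meson symD)
  have "linked N W (T - {e})"
    unfolding linked_def
  proof (intro allI impI)
    fix A assume A: "A \<subseteq> W" "A \<noteq> {}"
    from linkedD[OF assms(2) A] obtain g where g: "g \<in> T" "N g \<inter> A \<noteq> {}" "\<not> N g \<subseteq> A" by auto
    show "\<exists>e\<in>T - {e}. N e \<inter> A \<noteq> {} \<and> \<not> N e \<subseteq> A"
    proof (cases "g = e")
      case True
      obtain u where u: "u \<in> N e" "u \<in> A" using g True by auto
      have "e \<in> E" "u \<in> W" using eT(1) assms(1) u(2) A(1) by auto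
      then obtain v where v: "N e = {u, v}" "ends H e = {Some u, f v}"
        using ends_pair u(1) by metis
      have "v \<notin> A" using g(3) True u(2) v(1) by simp
      then have "f v \<notin> Some ` A" by auto
      have "{Some u, f v} = {vs ! 0, vs ! (Suc 0 mod ?n)}" using v(2) eT(2) by simp
      then have "(Some u, f v) \<in> ?R\<^sup>*" using p p' by (metis doubleton_eq_iff)
      then show ?thesis using u A \<open>f v \<notin> Some ` A\<close> assms(1) by (intro exit_of_path) auto
    qed (use g in auto)
  qed
  then show ?thesis using eT by auto
qed

text \<open>The ends of \<open>e\<close> stay connected without it; a simple path between them is
  closed up by \<open>e\<close> as the last edge.\<close>

lemma removable_cycle:
  assumes "T \<subseteq> E" "e \<in> T" "linked N W (T - {e})"
  shows "\<exists>vs es. is_cycle (H\<lparr>edges := T\<rparr>) vs es"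
proof -
  let ?R = "adj (H\<lparr>edges := T - {e}\<rparr>)"
  have "e \<in> E" using assms by auto
  then obtain x where x: "x \<in> W" "x \<in> N e" by (auto simp: touching_def)
  obtain y where "ends H e = {Some x, f y}" using ends_pair[OF \<open>e \<in> E\<close> x] by metis
  moreover have "Some x \<in> verts H" "f y \<in> verts H" using x by (simp_all add: verts_wired)
  ultimately obtain a b where ab: "ends H e = {a, b}" "a \<in> verts H" "b \<in> verts H" by metis
  have "T - {e} \<subseteq> E" using assms by auto
  then have "(a, b) \<in> ?R\<^sup>*"
    using linked_reach[of "T - {e}"] assms(3) ab sym_rtrancl[OF adj_wired_sym] by (meson rtrancl_trans symD)
  then obtain vs where vs: "vs \<noteq> []" "hd vs = a" "last vs = b" "distinct vs"
    "\<And>i. Suc i < length vs \<Longrightarrow> (vs ! i, vs ! Suc i) \<in> ?R" using rtrancl_simple_path by metis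
  let ?n = "length vs"
  have "\<forall>i. \<exists>g. Suc i < ?n \<longrightarrow> g \<in> T - {e} \<and> ends H g = {vs ! i, vs ! Suc i}"
    using vs(5) by (auto simp: adj_wired_sub)
  then obtain g where g: "\<And>i. Suc i < ?n \<Longrightarrow> g i \<in> T - {e} \<and> ends H (g i) = {vs ! i, vs ! Suc i}"
    by metis
  define es where "es = map g [0..<?n - 1] @ [e]"
  have len: "length es = ?n" using vs(1) by (simp add: es_def)
  have "inj_on g {0..<?n - 1}"
  proof (rule inj_onI)
    fix i j assume ij: "i \<in> {0..<?n - 1}" "j \<in> {0..<?n - 1}" "g i = g j"
    then have "{vs ! i, vs ! Suc i} = {vs ! j, vs ! Suc j}" using g[of i] g[of j] by auto
    then have "(i = j \<and> Suc i = Suc j) \<or> (i = Suc j \<and> Suc i = j)"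
      using ij vs(4) by (auto simp: doubleton_eq_iff nth_eq_iff_index_eq)
    then show "i = j" by auto
  qed
  moreover have "e \<notin> g ` {0..<?n - 1}"
  proof
    assume "e \<in> g ` {0..<?n - 1}"
    then obtain i where i: "i < ?n - 1" "e = g i" by auto
    then have "Suc i < ?n" by linarith
    from g[OF this] show False using i by simp
  qed
  ultimately have "distinct es" by (simp add: es_def distinct_map)
  moreover have "es ! i \<in> edges_between (H\<lparr>edges := T\<rparr>) (vs ! i) (vs ! (Suc i mod ?n))" if "i < ?n" for i
  proof (cases "Suc i < ?n")
    case True
    then have "i < ?n - 1" by linarith
    then show ?thesis using g[OF True] True by (simp add: es_def nth_append edges_between_def)
  next
    case False
    then have i: "i = ?n - 1" using that by simp
    then have "vs ! i = b" "vs ! (Suc i mod ?n) = a" "es ! i = e"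
      using vs by (simp_all add: last_conv_nth hd_conv_nth es_def nth_append)
    moreover have "ends H e = {b, a}" using ab(1) doubleton_eq_iff by blast
    ultimately show ?thesis using assms(2) by (simp add: edges_between_def)
  qed
  ultimately show ?thesis using vs(1,4) len unfolding is_cycle_def by blast
qed

text \<open>In a connected edge set a cycle exists exactly when some edge can be spared, so trees
  are the minimal linked sets, and these are the linked sets with \<open>card W\<close>
  edges.\<close>

theorem spanning_trees_wired:
  assumes "finite E"
  shows "spanning_trees H = trees N W E"
proof (rule set_eqI)
  fix T
  show "T \<in> spanning_trees H \<longleftrightarrow> T \<in> trees N W E"
  proof (cases "T \<subseteq> E")
    case True
    have "T \<in> spanning_trees H \<longleftrightarrow> linked N W T \<and> (\<forall>e\<in>T. \<not> linked N W (T - {e}))"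
      using True connected_wired_sub[OF True] cycle_removable[OF True] removable_cycle[OF True]
      by (auto simp: spanning_trees_def is_tree_def edges_wired)
    also have "\<dots> \<longleftrightarrow> T \<in> trees N W E"
    proof
      assume a: "linked N W T \<and> (\<forall>e\<in>T. \<not> linked N W (T - {e}))"
      have "\<forall>e\<in>T. card (N e) = 2" using True card_ends by (auto simp: touching_def)
      then have "card T = card W"
        using minimal_linked_card[OF fin, of T N] a True assms finite_subset by metis
      then show "T \<in> trees N W E" using True a by (simp add: trees_def)
    next
      assume "T \<in> trees N W E"
      then show "linked N W T \<and> (\<forall>e\<in>T. \<not> linked N W (T - {e}))"
        using trees_minimal[OF _ sink_graph_wired[OF assms]] by (auto simp: trees_def)
    qed
    finally show ?thesis .
  qed (auto simp: spanning_trees_def trees_def edges_wired)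
qed

end

section \<open>Finite pockets in one-ended forests\<close>

definition link :: "('e \<Rightarrow> 'v set) \<Rightarrow> 'e set \<Rightarrow> ('v \<times> 'v) set" where
  "link N S = {(x, y). \<exists>e\<in>S. N e = {x, y}}"

text \<open>A cycle is recorded by an edge whose ends stay connected without it. For a finite
  \<open>F\<close> this makes the presence of a cycle visible to events depending on finitely many
  edges.\<close>

definition circuit :: "('e \<Rightarrow> 'v set) \<Rightarrow> 'e set \<Rightarrow> bool" where
  "circuit N F \<longleftrightarrow> (\<exists>e\<in>F. \<exists>x y. N e = {x, y} \<and> (x, y) \<in> (link N (F - {e}))\<^sup>*)"

section \<open>Connection within an edge set and circuits\<close>

lemma linkI: "e \<in> S \<Longrightarrow> N e = {x, y} \<Longrightarrow> (x, y) \<in> link N S"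
  by (auto simp: link_def)

lemma link_sym: "sym (link N S)"
  by (auto simp: link_def sym_def insert_commute)

lemma link_rtrancl_sym: "(x, y) \<in> (link N S)\<^sup>* \<Longrightarrow> (y, x) \<in> (link N S)\<^sup>*"
  using sym_rtrancl[OF link_sym] by (meson symD)

lemma link_mono: "S \<subseteq> T \<Longrightarrow> link N S \<subseteq> link N T"
  by (auto simp: link_def)

lemma link_exit:
  assumes "(x, y) \<in> (link N S)\<^sup>*" "x \<in> A" "y \<notin> A"
  shows "\<exists>e\<in>S. N e \<inter> A \<noteq> {} \<and> \<not> N e \<subseteq> A"
  using rtrancl_crossing[OF assms] by (auto simp: link_def)

lemma link_rtrancl_finite:
  assumes "(x, y) \<in> (link N S)\<^sup>*"
  shows "\<exists>F\<subseteq>S. finite F \<and> (x, y) \<in> (link N F)\<^sup>*"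
  using assms
proof induction
  case base
  show ?case by (rule exI[of _ "{}"]) simp
next
  case (step y z)
  then obtain F e where F: "F \<subseteq> S" "finite F" "(x, y) \<in> (link N F)\<^sup>*" "e \<in> S" "N e = {y, z}"
    by (auto simp: link_def)
  have "(x, y) \<in> (link N (insert e F))\<^sup>*"
    using F(3) rtrancl_mono[OF link_mono[of F "insert e F" N]] by auto
  moreover have "(y, z) \<in> link N (insert e F)" using F(5) by (intro linkI[of e]) auto
  ultimately show ?case using F by (intro exI[of _ "insert e F"]) auto
qed

lemma trees_no_circuit:
  assumes "sink_graph N V E" "T \<in> trees N V E" "F \<subseteq> T"
  shows "\<not> circuit N F"
proof
  assume "circuit N F"
  then obtain e x y where e: "e \<in> F" "N e = {x, y}" "(x, y) \<in> (link N (F - {e}))\<^sup>*"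
    by (auto simp: circuit_def)
  have p: "(x, y) \<in> (link N (T - {e}))\<^sup>*"
    using e(3) rtrancl_mono[OF link_mono[of "F - {e}" "T - {e}" N]] assms(3) by auto
  have l: "linked N V T" using assms(2) by (simp add: trees_def)
  have "linked N V (T - {e})"
    unfolding linked_def
  proof (intro allI impI)
    fix A assume A: "A \<subseteq> V" "A \<noteq> {}"
    from linkedD[OF l A] obtain g where g: "g \<in> T" "N g \<inter> A \<noteq> {}" "\<not> N g \<subseteq> A" by auto
    show "\<exists>e\<in>T - {e}. N e \<inter> A \<noteq> {} \<and> \<not> N e \<subseteq> A"
    proof (cases "g = e")
      case True
      then have "x \<in> A \<and> y \<notin> A \<or> y \<in> A \<and> x \<notin> A" using g e(2) by auto
      then show ?thesis using link_exit[OF p, of A] link_exit[OF link_rtrancl_sym[OF p], of A] by auto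
    qed (use g in auto)
  qed
  then show False using trees_minimal[OF assms(2,1)] e(1) assms(3) by auto
qed

text \<open>Koenig's lemma for a simple path: the path is extended while infinitely many points
  remain reachable from its end without the vertices already used.\<close>

lemma konig:
  assumes fin: "\<And>x. finite (r `` {x})" and inf: "infinite (r\<^sup>* `` {x})"
  shows "\<exists>s :: nat \<Rightarrow> 'a. inj s \<and> s 0 = x \<and> (\<forall>i. (s i, s (Suc i)) \<in> r)"
proof -
  define R where "R A = {(u, v) \<in> r. u \<notin> A \<and> v \<notin> A}" for A
  \<comment> \<open>A pair holds the used vertices and the current end of the path.\<close>
  define good where "good p \<longleftrightarrow> finite (fst p) \<and> snd p \<notin> fst p \<and> infinite ((R (fst p))\<^sup>* `` {snd p})" for p :: "'a set \<times> 'a"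
  have extend: "\<exists>y. (x, y) \<in> r \<and> good (insert x A, y)" if g: "good (A, x)" for A x
  proof (rule ccontr)
    assume c: "\<not> ?thesis"
    let ?Y = "r `` {x} - insert x A"
    \<comment> \<open>Whatever is reachable from \<open>x\<close> is \<open>x\<close> itself or
      reachable, without returning to \<open>x\<close>, from one of its finitely many fresh
      neighbours; one of these must therefore reach infinitely many points.\<close>
    have "(R A)\<^sup>* `` {x} \<subseteq> insert x (\<Union>y\<in>?Y. (R (insert x A))\<^sup>* `` {y})"
    proof
      fix z assume "z \<in> (R A)\<^sup>* `` {x}"
      then have "(x, z) \<in> (R A)\<^sup>*" by simp
      then show "z \<in> insert x (\<Union>y\<in>?Y. (R (insert x A))\<^sup>* `` {y})"
      proof induction
        case (step y z)
        then have yz: "(y, z) \<in> r" "y \<notin> A" "z \<notin> A" by (auto simp: R_def)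
        show ?case
        proof (cases "z = x \<or> y = x")
          case True
          then show ?thesis using yz by auto
        next
          case False
          then obtain w where w: "w \<in> ?Y" "(w, y) \<in> (R (insert x A))\<^sup>*" using step.IH by auto
          have "(y, z) \<in> R (insert x A)" using yz False by (auto simp: R_def)
          then have "(w, z) \<in> (R (insert x A))\<^sup>*" using w(2) by (meson rtrancl.rtrancl_into_rtrancl)
          then show ?thesis using w(1) by auto
        qed
      qed simp
    qed
    moreover have "finite ((R (insert x A))\<^sup>* `` {y})" if "y \<in> ?Y" for y
      using c that g by (auto simp: good_def)
    then have "finite (insert x (\<Union>y\<in>?Y. (R (insert x A))\<^sup>* `` {y}))" using fin by auto
    ultimately show False using g finite_subset by (auto simp: good_def)
  qed
  have "good ({}, x)" using inf by (simp add: good_def R_def)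
  then have "\<exists>p. p 0 = ({}, x) \<and> (\<forall>n. good (p n) \<and> (fst (p (Suc n)) = insert (snd (p n)) (fst (p n)) \<and> (snd (p n), snd (p (Suc n))) \<in> r))"
  proof -
    have "\<exists>q. good q \<and> (fst q = insert (snd p) (fst p) \<and> (snd p, snd q) \<in> r)" if "good p" for p
    proof -
      have "\<exists>y. (snd p, y) \<in> r \<and> good (insert (snd p) (fst p), y)"
        using extend[of "fst p" "snd p"] that by simp
      then obtain y where "(snd p, y) \<in> r" "good (insert (snd p) (fst p), y)" by blast
      then show ?thesis by (intro exI[of _ "(insert (snd p) (fst p), y)"]) simp
    qed
    then obtain nx where nx: "\<And>p. good p \<Longrightarrow> good (nx p) \<and> fst (nx p) = insert (snd p) (fst p) \<and> (snd p, snd (nx p)) \<in> r"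
      by metis
    define p where "p n = (nx ^^ n) ({}, x)" for n
    have "good (p n)" for n by (induction n) (use \<open>good ({}, x)\<close> nx in \<open>auto simp: p_def\<close>)
    then show ?thesis using nx by (intro exI[of _ p]) (auto simp: p_def)
  qed
  then obtain p where p: "p 0 = ({}, x)" "\<And>n. good (p n)"
    "\<And>n. fst (p (Suc n)) = insert (snd (p n)) (fst (p n))" "\<And>n. (snd (p n), snd (p (Suc n))) \<in> r" by auto
  define s where "s n = snd (p n)" for n
  have "s m \<in> fst (p n)" if "m < n" for m n
    using that by (induction n) (auto simp: p(3) s_def less_Suc_eq)
  moreover have "s n \<notin> fst (p n)" for n using p(2)[of n] by (simp add: good_def s_def)
  ultimately have "s m \<noteq> s n" if "m < n" for m n using that by metis
  then have "inj s" by (metis injI linorder_neqE_nat)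
  moreover have "s 0 = x" using p(1) by (simp add: s_def)
  ultimately show ?thesis using p(4) by (auto simp: s_def)
qed

locale infinite_graph =
  fixes G :: "('v, 'e) mgraph"
  assumes wf: "wf_mgraph G" and lf: "locally_finite_mgraph G" and conn: "connected_mgraph G"
    and inf: "infinite (verts G)"
begin

abbreviation "N \<equiv> ends G"
abbreviation "EG \<equiv> edges G"

section \<open>Local finiteness, countability and pockets of the infinite graph\<close>

lemma card_ends: "e \<in> EG \<Longrightarrow> card (N e) = 2"
  using wf by (auto simp: wf_mgraph_def)

lemma ends_sub: "e \<in> EG \<Longrightarrow> N e \<subseteq> verts G"
  using wf by (auto simp: wf_mgraph_def)

lemma ends_pair:
  assumes "e \<in> EG" obtains x y where "N e = {x, y}" "x \<noteq> y"
  using card_ends[OF assms] by (auto simp: card_2_iff)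

lemma finite_incident: "finite (incident G x)"
proof (cases "x \<in> verts G")
  case False
  then have "incident G x = {}" using ends_sub by (auto simp: incident_def)
  then show ?thesis by simp
qed (use lf in \<open>auto simp: locally_finite_mgraph_def\<close>)

lemma touching_eq: "touching N EG W = (\<Union>x\<in>W. incident G x)"
  by (auto simp: touching_def incident_def)

lemma finite_touching: "finite W \<Longrightarrow> finite (touching N EG W)"
  unfolding touching_eq using finite_incident by auto

lemma finite_neighbours: "S \<subseteq> EG \<Longrightarrow> finite (link N S `` {x})"
proof (rule finite_subset)
  assume "S \<subseteq> EG"
  then show "link N S `` {x} \<subseteq> (\<Union>e\<in>incident G x. N e)" by (auto simp: link_def incident_def)
  have "finite (N e)" if "e \<in> incident G x" for e
    using card_ends[of e] that by (auto simp: incident_def intro: card_ge_0_finite)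
  then show "finite (\<Union>e\<in>incident G x. N e)" using finite_incident by auto
qed

lemma link_verts:
  assumes "S \<subseteq> EG" "(x, y) \<in> (link N S)\<^sup>*" "x \<in> verts G"
  shows "y \<in> verts G"
  using assms(2)
proof induction
  case (step y z)
  then obtain e where "e \<in> S" "N e = {y, z}" by (auto simp: link_def)
  then show ?case using ends_sub[of e] assms(1) by auto
qed (rule assms(3))

lemma adj_eq: "adj G = link N EG"
  by (auto simp: adj_def edges_between_def link_def)

lemma connected: "x \<in> verts G \<Longrightarrow> y \<in> verts G \<Longrightarrow> (x, y) \<in> (link N EG)\<^sup>*"
  using conn by (simp add: connected_mgraph_def adj_eq)

lemma linked_edges: "finite W \<Longrightarrow> W \<subseteq> verts G \<Longrightarrow> linked N W (touching N EG W)"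
  unfolding linked_touching
proof (unfold linked_def, intro allI impI)
  fix A assume a: "finite W" "W \<subseteq> verts G" "A \<subseteq> W" "A \<noteq> {}"
  then obtain x where x: "x \<in> A" by auto
  have "finite A" using a finite_subset by auto
  then obtain y where y: "y \<in> verts G" "y \<notin> A" using inf by (metis finite_subset subsetI)
  show "\<exists>e\<in>EG. N e \<inter> A \<noteq> {} \<and> \<not> N e \<subseteq> A"
    using link_exit[OF connected[of x y] x y(2)] x y a by auto
qed

lemma countable_verts: "countable (verts G)"
proof -
  obtain x where x: "x \<in> verts G" using inf by fastforce
  have "finite ((link N EG ^^ n) `` {x})" for n
  proof (induction n)
    case (Suc n)
    have "(link N EG ^^ Suc n) `` {x} = (\<Union>y\<in>(link N EG ^^ n) `` {x}. link N EG `` {y})" by auto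
    then show ?case using Suc finite_neighbours by simp
  qed simp
  then have "countable (\<Union>n. (link N EG ^^ n) `` {x})" by (intro countable_UN) (auto intro: countable_finite)
  moreover have "verts G \<subseteq> (\<Union>n. (link N EG ^^ n) `` {x})"
    using connected[OF x] by (auto simp: rtrancl_power)
  ultimately show ?thesis by (rule countable_subset[rotated])
qed

lemma countable_edges: "countable EG"
proof (rule countable_subset)
  show "EG \<subseteq> (\<Union>x\<in>verts G. incident G x)"
  proof
    fix e assume "e \<in> EG"
    then obtain x y where "N e = {x, y}" using ends_pair by metis
    then show "e \<in> (\<Union>x\<in>verts G. incident G x)" using \<open>e \<in> EG\<close> ends_sub[of e] by (auto simp: incident_def)
  qed
qed (use countable_verts finite_incident in \<open>auto intro: countable_finite\<close>)

text \<open>The witness consists of \<open>Q\<close> and the vertices that \<open>Q\<close> separates from infinity in the open subgraph.\<close>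

lemma finite_pocket:
  assumes P: "P \<subseteq> EG" and Q: "finite Q" "Q \<subseteq> verts G"
    and infin: "\<And>x. x \<in> verts G \<Longrightarrow> infinite ((link N P)\<^sup>* `` {x})"
    and one: "\<And>e x y. e \<in> P \<Longrightarrow> N e = {x, y} \<Longrightarrow>
      finite ((link N (P - {e}))\<^sup>* `` {x}) \<or> finite ((link N (P - {e}))\<^sup>* `` {y})"
  shows "\<exists>W. finite W \<and> Q \<subseteq> W \<and> W \<subseteq> verts G \<and>
    P \<inter> touching N EG W \<in> trees N W (exits_at N EG Q W)"
proof -
  define R where "R = {(u, v) \<in> link N P. u \<notin> Q \<and> v \<notin> Q}"
  define W where "W = Q \<union> {x \<in> verts G - Q. finite (R\<^sup>* `` {x})}"
  have "sym R" using link_sym[of N P] by (auto simp: R_def sym_def)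
  then have Rsym: "(u, v) \<in> R\<^sup>* \<Longrightarrow> (v, u) \<in> R\<^sup>*" for u v using sym_rtrancl by (metis symD)
  have Req: "R\<^sup>* `` {u} = R\<^sup>* `` {v}" if "(u, v) \<in> R\<^sup>*" for u v
    using that Rsym[OF that] by (auto intro: rtrancl_trans)
  have Rlink: "R\<^sup>* \<subseteq> (link N P)\<^sup>*" by (rule rtrancl_mono) (auto simp: R_def)
  have RQ: "v \<notin> Q" if "(u, v) \<in> R\<^sup>*" "u \<notin> Q" for u v
    using that by (induction rule: rtrancl_induct) (auto simp: R_def)
  \<comment> \<open>Clusters of \<open>link N P\<close> are infinite, so a finite class of
    \<open>R\<close> can only be finite because \<open>Q\<close> cuts it off. It then contains a
    neighbour of \<open>Q\<close>, and there are finitely many of those.\<close>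
  have "W - Q \<subseteq> (\<Union>q\<in>Q. \<Union>u\<in>{u \<in> link N P `` {q}. finite (R\<^sup>* `` {u})}. R\<^sup>* `` {u})"
  proof
    fix x assume x: "x \<in> W - Q"
    then have fx: "finite (R\<^sup>* `` {x})" and xv: "x \<in> verts G" "x \<notin> Q" by (auto simp: W_def)
    have "\<not> (link N P)\<^sup>* `` {x} \<subseteq> R\<^sup>* `` {x}" using infin[OF xv(1)] fx finite_subset by auto
    then obtain y where "(x, y) \<in> (link N P)\<^sup>*" "y \<notin> R\<^sup>* `` {x}" by auto
    then obtain u v where uv: "(u, v) \<in> link N P" "u \<in> R\<^sup>* `` {x}" "v \<notin> R\<^sup>* `` {x}"
      using rtrancl_crossing[of x y "link N P" "R\<^sup>* `` {x}"] by auto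
    have "v \<in> Q"
    proof (rule ccontr)
      assume "v \<notin> Q"
      then have "(u, v) \<in> R" using uv RQ[of x u] xv(2) by (auto simp: R_def)
      then show False using uv by (auto intro: rtrancl.rtrancl_into_rtrancl)
    qed
    moreover have "(v, u) \<in> link N P" using uv(1) link_sym by (metis symD)
    moreover have "finite (R\<^sup>* `` {u})" "x \<in> R\<^sup>* `` {u}" using Req[of x u] uv(2) fx Rsym[of x u] by auto
    ultimately show "x \<in> (\<Union>q\<in>Q. \<Union>u\<in>{u \<in> link N P `` {q}. finite (R\<^sup>* `` {u})}. R\<^sup>* `` {u})" by blast
  qed
  moreover have "finite (\<Union>q\<in>Q. \<Union>u\<in>{u \<in> link N P `` {q}. finite (R\<^sup>* `` {u})}. R\<^sup>* `` {u})"
  proof (intro finite_UN_I)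
    show "finite {u \<in> link N P `` {q}. finite (R\<^sup>* `` {u})}" for q
      using finite_neighbours[OF P, of q] by (rule rev_finite_subset) auto
  qed (use Q(1) in auto)
  ultimately have "finite (W - Q)" by (rule finite_subset)
  then have fW: "finite W" using Q(1) by simp
  have WV: "W \<subseteq> verts G" and QW: "Q \<subseteq> W" using Q by (auto simp: W_def)
  let ?S = "P \<inter> touching N EG W"
  \<comment> \<open>An open edge avoiding \<open>Q\<close> joins two vertices of the same
    \<open>R\<close>-class, so it lies inside \<open>W\<close> as soon as it touches
    \<open>W\<close>.\<close>
  have exits: "N e \<subseteq> W \<or> N e \<inter> Q \<noteq> {}" if e: "e \<in> ?S" for e
  proof (rule disjCI)
    assume nQ: "\<not> N e \<inter> Q \<noteq> {}"
    have "e \<in> EG" using e P by auto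
    then obtain a b where ab: "N e = {a, b}" using ends_pair by metis
    have "(a, b) \<in> R" using ab e nQ by (auto simp: R_def intro!: linkI)
    then have "(a, b) \<in> R\<^sup>*" by auto
    then have "R\<^sup>* `` {a} = R\<^sup>* `` {b}" by (rule Req)
    moreover have "a \<in> W \<or> b \<in> W" using e ab by (auto simp: touching_def)
    moreover have "a \<in> verts G" "b \<in> verts G" using ends_sub[OF \<open>e \<in> EG\<close>] ab by auto
    ultimately show "N e \<subseteq> W" using ab nQ by (auto simp: W_def)
  qed
  have lin: "linked N W ?S"
    unfolding linked_def
  proof (intro allI impI)
    fix A assume A: "A \<subseteq> W" "A \<noteq> {}"
    then obtain x where x: "x \<in> A" by auto
    have "finite A" using A fW finite_subset by auto
    moreover have "infinite ((link N P)\<^sup>* `` {x})" using infin x A WV by auto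
    ultimately have "\<not> (link N P)\<^sup>* `` {x} \<subseteq> A" using finite_subset by auto
    then obtain y where "(x, y) \<in> (link N P)\<^sup>*" "y \<notin> A" by auto
    from link_exit[OF this(1) x this(2)] obtain e where e: "e \<in> P" "N e \<inter> A \<noteq> {}" "\<not> N e \<subseteq> A" by auto
    then have "e \<in> ?S" using A P by (auto simp: touching_def)
    then show "\<exists>e\<in>?S. N e \<inter> A \<noteq> {} \<and> \<not> N e \<subseteq> A" using e by auto
  qed
  \<comment> \<open>If \<open>e\<close> could be spared, both of its ends would keep infinite
    clusters, against \<open>one\<close>: outside \<open>W\<close> the infinite
    \<open>R\<close>-classes do not use \<open>e\<close>, and from a vertex of \<open>W\<close> the
    remaining edges lead out of \<open>W\<close>.\<close>
  have minimal: "\<not> linked N W (?S - {e})" if e: "e \<in> ?S" for e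
  proof
    assume l: "linked N W (?S - {e})"
    let ?L = "link N (P - {e})"
    have "e \<in> EG" using e P by auto
    have out: "infinite (?L\<^sup>* `` {v})" if v: "v \<in> verts G" "v \<notin> W" for v
    proof -
      have iv: "infinite (R\<^sup>* `` {v})" and vQ: "v \<notin> Q" using v by (auto simp: W_def)
      have "(v, u) \<in> ?L\<^sup>*" if "(v, u) \<in> R\<^sup>*" for u
        using that
      proof induction
        case (step a b)
        then have "(a, b) \<in> link N P" "b \<notin> Q" "a \<notin> Q" by (auto simp: R_def)
        then obtain g where g: "g \<in> P" "N g = {a, b}" by (auto simp: link_def)
        have "(v, b) \<in> R\<^sup>*" using step.hyps by (rule rtrancl.rtrancl_into_rtrancl)
        then have "a \<notin> W" "b \<notin> W" using iv Req[of v a] Req[of v b] step.hyps(1) \<open>a \<notin> Q\<close> \<open>b \<notin> Q\<close>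
          by (auto simp: W_def)
        then have "g \<noteq> e" using e g by (auto simp: touching_def)
        then have "(a, b) \<in> ?L" using g by (intro linkI[of g]) auto
        then show ?case using step.IH by (meson rtrancl.rtrancl_into_rtrancl)
      qed simp
      then have "R\<^sup>* `` {v} \<subseteq> ?L\<^sup>* `` {v}" by auto
      then show ?thesis using iv finite_subset by auto
    qed
    have side: "infinite (?L\<^sup>* `` {x})" if x: "x \<in> verts G" for x
    proof (cases "x \<in> W")
      case True
      show ?thesis
      proof
        assume "finite (?L\<^sup>* `` {x})"
        let ?A = "?L\<^sup>* `` {x} \<inter> W"
        have "?A \<subseteq> W" "?A \<noteq> {}" using True by auto
        from linkedD[OF l this] obtain g u where g: "g \<in> ?S" "g \<noteq> e" "u \<in> N g" "u \<in> ?A" "\<not> N g \<subseteq> ?A" by auto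
        have "g \<in> EG" using g(1) P by auto
        then obtain v where v: "N g = {u, v}" using g(3) ends_pair[OF \<open>g \<in> EG\<close>] by (metis empty_iff insertE insert_commute)
        then have "(u, v) \<in> ?L" using g by (intro linkI[of g]) auto
        moreover have "(x, u) \<in> ?L\<^sup>*" using g(4) by auto
        ultimately have xv: "(x, v) \<in> ?L\<^sup>*" by (rule rtrancl_into_rtrancl[rotated])
        then have "v \<notin> W" using g(4,5) v by auto
        moreover have "v \<in> verts G" using ends_sub[OF \<open>g \<in> EG\<close>] v by auto
        ultimately have "infinite (?L\<^sup>* `` {v})" using out by auto
        moreover have "?L\<^sup>* `` {v} \<subseteq> ?L\<^sup>* `` {x}" using xv by (auto intro: rtrancl_trans)
        ultimately show False using \<open>finite (?L\<^sup>* `` {x})\<close> finite_subset by auto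
      qed
    qed (use out x in auto)
    obtain x y where "N e = {x, y}" using ends_pair[OF \<open>e \<in> EG\<close>] by metis
    then show False using one[of e x y] side[of x] side[of y] e ends_sub[OF \<open>e \<in> EG\<close>] by auto
  qed
  have "?S \<subseteq> exits_at N EG Q W" using exits by (auto simp: exits_at_def)
  moreover have "card ?S = card W"
  proof (rule minimal_linked_card[OF fW _ _ lin minimal])
    show "finite ?S" using finite_touching[OF fW] by simp
    show "\<forall>e\<in>?S. card (N e) = 2" using P card_ends by auto
  qed
  ultimately have "?S \<in> trees N W (exits_at N EG Q W)" using lin by (simp add: trees_def)
  then show ?thesis using fW QW WV by blast
qed

lemma tree_ends_one:
  assumes "card (tree_ends H C) = 1"
  shows "rays H C \<noteq> {}" and "\<And>r r'. r \<in> rays H C \<Longrightarrow> r' \<in> rays H C \<Longrightarrow> finite (sym_diff (range r) (range r'))"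
proof -
  obtain X where X: "tree_ends H C = {X}" using assms by (auto simp: card_1_singleton_iff)
  have cls: "ray_equiv H C `` {r} = X" if "r \<in> rays H C" for r
    using X that quotientI[of r "rays H C" "ray_equiv H C"] by (auto simp: tree_ends_def)
  show "rays H C \<noteq> {}" using X by (auto simp: tree_ends_def quotient_def)
  fix r r' assume r: "r \<in> rays H C" "r' \<in> rays H C"
  have "r' \<in> ray_equiv H C `` {r'}" using r(2) by (simp add: ray_equiv_def)
  then have "r' \<in> ray_equiv H C `` {r}" using cls r by simp
  then show "finite (sym_diff (range r) (range r'))" by (simp add: ray_equiv_def)
qed

text \<open>If both sides of an open edge were infinite, each would contain a ray. The two rays are
  disjoint and lie in one tree, so their symmetric difference is infinite, against having one
  end.\<close>

lemma one_end_pocket: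
  assumes P: "P = {e \<in> EG. \<omega> e}" and Q: "finite Q" "Q \<subseteq> verts G"
    and one: "\<And>x. x \<in> verts G \<Longrightarrow> card (tree_ends (open_subgraph G \<omega>) (component (open_subgraph G \<omega>) x)) = 1"
    and acyc: "\<And>F. finite F \<Longrightarrow> F \<subseteq> P \<Longrightarrow> \<not> circuit N F"
  shows "\<exists>W. finite W \<and> Q \<subseteq> W \<and> W \<subseteq> verts G \<and>
    P \<inter> touching N EG W \<in> trees N W (exits_at N EG Q W)"
proof -
  let ?H = "open_subgraph G \<omega>"
  have adjH: "adj ?H = link N P" by (auto simp: adj_def edges_between_def link_def open_subgraph_def P)
  have compH: "component ?H x = {y \<in> verts G. (x, y) \<in> (link N P)\<^sup>*}" for x
    by (simp add: component_def adjH[symmetric]) (simp add: open_subgraph_def)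
  have OE: "P \<subseteq> EG" by (auto simp: P)
  show ?thesis
  proof (rule finite_pocket[OF OE Q])
    fix x assume "x \<in> verts G"
    from tree_ends_one(1)[OF one[OF this]] obtain r where "r \<in> rays ?H (component ?H x)" by auto
    then have "inj r" "range r \<subseteq> (link N P)\<^sup>* `` {x}" by (auto simp: rays_def compH)
    then show "infinite ((link N P)\<^sup>* `` {x})" using range_inj_infinite finite_subset by metis
  next
    fix e x y assume e: "e \<in> P" "N e = {x, y}"
    let ?L = "link N (P - {e})"
    have LO: "?L\<^sup>* \<subseteq> (link N P)\<^sup>*" by (intro rtrancl_mono link_mono) auto
    have xy: "x \<in> verts G" "y \<in> verts G" using ends_sub[of e] e OE by auto
    show "finite (?L\<^sup>* `` {x}) \<or> finite (?L\<^sup>* `` {y})"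
    proof (rule ccontr)
      assume c: "\<not> ?thesis"
      have fL: "finite (?L `` {z})" for z using OE by (intro finite_neighbours) auto
      obtain r where r: "inj r" "r 0 = x" "\<And>i. (r i, r (Suc i)) \<in> ?L" using konig[OF fL, of x] c by auto
      obtain r' where r': "inj r'" "r' 0 = y" "\<And>i. (r' i, r' (Suc i)) \<in> ?L" using konig[OF fL, of y] c by auto
      have xr: "(x, r i) \<in> ?L\<^sup>*" for i using r(2,3) by (induction i) (auto intro: rtrancl.rtrancl_into_rtrancl)
      have yr: "(y, r' i) \<in> ?L\<^sup>*" for i using r'(2,3) by (induction i) (auto intro: rtrancl.rtrancl_into_rtrancl)
      have "(x, y) \<in> link N P" using e by (rule linkI)
      then have xr': "(x, r' i) \<in> (link N P)\<^sup>*" for i using yr[of i] LO by (meson converse_rtrancl_into_rtrancl subsetD)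
      have xr'': "(x, r i) \<in> (link N P)\<^sup>*" for i using xr[of i] LO by auto
      have sub: "?L \<subseteq> link N P" by (rule link_mono) auto
      have "r \<in> rays ?H (component ?H x)"
        using r xr'' sub link_verts[OF OE _ xy(1)] by (auto simp: rays_def compH adjH)
      moreover have "r' \<in> rays ?H (component ?H x)"
        using r' xr' sub link_verts[OF OE _ xy(1)] by (auto simp: rays_def compH adjH)
      ultimately have fin: "finite (sym_diff (range r) (range r'))" by (rule tree_ends_one(2)[OF one[OF xy(1)]])
      \<comment> \<open>A common vertex would join the ends of \<open>e\<close> without
        \<open>e\<close>. Finitely many edges do so, hence \<open>e\<close> together with them is a
        finite circuit.\<close>
      have "range r \<inter> range r' = {}"
      proof (rule ccontr)
        assume "\<not> ?thesis"
        then obtain i j where "r i = r' j" by auto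
        then have "(x, y) \<in> ?L\<^sup>*" using xr[of i] link_rtrancl_sym[OF yr[of j]] by (simp add: rtrancl_trans)
        then obtain F where F: "F \<subseteq> P - {e}" "finite F" "(x, y) \<in> (link N F)\<^sup>*"
          using link_rtrancl_finite by metis
        have "insert e F - {e} = F" using F(1) by auto
        then have "circuit N (insert e F)" unfolding circuit_def using e(2) F(3) by auto
        then show False using acyc[of "insert e F"] F e(1) by auto
      qed
      then have "range r \<subseteq> sym_diff (range r) (range r')" by auto
      then have "finite (range r)" using fin finite_subset by auto
      then show False using r(1) range_inj_infinite by auto
    qed
  qed
qed

end

section \<open>Convergence of the sandpile measures\<close>

lemma touching_touching: "W \<subseteq> V \<Longrightarrow> touching N (touching N E V) W = touching N E W"
  by (auto simp: touching_def)

lemma exits_at_touching: "W \<subseteq> V \<Longrightarrow> exits_at N (touching N E V) Q W = exits_at N E Q W"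
  by (simp add: exits_at_def touching_touching)

text \<open>The constant may depend on the precision but not on the sequence; this gives the Cauchy
  property and at the same time one limit for all sequences.\<close>

lemma common_limit:
  fixes a :: "'i \<Rightarrow> nat \<Rightarrow> real"
  assumes "I \<noteq> {}"
    and close: "\<And>\<epsilon>. \<epsilon> > 0 \<Longrightarrow> \<exists>c. \<forall>i\<in>I. \<forall>\<^sub>F n in sequentially. \<bar>a i n - c\<bar> < \<epsilon>"
  shows "\<exists>L. \<forall>i\<in>I. a i \<longlonglongrightarrow> L"
proof -
  obtain j where j: "j \<in> I" using assms(1) by auto
  have "Cauchy (a j)"
  proof (rule metric_CauchyI)
    fix e :: real assume "e > 0"
    then obtain c where "\<forall>\<^sub>F n in sequentially. \<bar>a j n - c\<bar> < e / 2" using close[of "e / 2"] j by auto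
    then obtain M where M: "\<And>n. n \<ge> M \<Longrightarrow> \<bar>a j n - c\<bar> < e / 2" by (auto simp: eventually_sequentially)
    have "dist (a j m) (a j n) < e" if "m \<ge> M" "n \<ge> M" for m n
      using M[OF that(1)] M[OF that(2)] unfolding dist_real_def by linarith
    then show "\<exists>M. \<forall>m\<ge>M. \<forall>n\<ge>M. dist (a j m) (a j n) < e" by blast
  qed
  then obtain L where L: "a j \<longlonglongrightarrow> L" using real_Cauchy_convergent by (auto simp: convergent_def)
  have "a i \<longlonglongrightarrow> L" if i: "i \<in> I" for i
  proof (rule tendstoI)
    fix e :: real assume "e > 0"
    then obtain c where c: "\<forall>\<^sub>F n in sequentially. \<bar>a i n - c\<bar> < e / 3" "\<forall>\<^sub>F n in sequentially. \<bar>a j n - c\<bar> < e / 3"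
      using close[of "e / 3"] i j by auto
    have "\<forall>\<^sub>F n in sequentially. \<bar>a j n - L\<bar> < e / 3"
      using tendstoD[OF L, of "e / 3"] \<open>e > 0\<close> by (simp add: dist_real_def)
    then have "\<forall>\<^sub>F n in sequentially. \<bar>L - c\<bar> < 2 * e / 3"
      using c(2) by eventually_elim linarith
    then have Lc: "\<bar>L - c\<bar> < 2 * e / 3" by simp
    from c(1) show "\<forall>\<^sub>F n in sequentially. dist (a i n) L < e"
    proof eventually_elim
      case (elim n)
      then show ?case using Lc unfolding dist_real_def by linarith
    qed
  qed
  then show ?thesis by auto
qed

context infinite_graph
begin

section \<open>Pocket probabilities in finite volume\<close>

lemma wired_graph_axioms: "finite V \<Longrightarrow> V \<subseteq> verts G \<Longrightarrow> wired_graph G V"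
  using wf by unfold_locales

lemma sink_graph_touching_verts: "finite V \<Longrightarrow> sink_graph N V (touching N EG V)"
  using finite_touching[of V] card_ends by (auto simp: sink_graph_def touching_def)

lemma linked_sink_graph_touching:
  "finite V \<Longrightarrow> V \<subseteq> verts G \<Longrightarrow> V \<noteq> {} \<Longrightarrow> linked_sink_graph N V (touching N EG V)"
  using sink_graph_touching_verts linked_edges by unfold_locales auto

lemma sandpile_measure_eq:
  "finite V \<Longrightarrow> V \<subseteq> verts G \<Longrightarrow> V \<noteq> {} \<Longrightarrow> sandpile_measure (wired G V) = pmf_of_set (recs N V (touching N EG V))"
  using wired_graph.sandpile_measure_wired[OF wired_graph_axioms] finite_touching linked_edges by auto

lemma spanning_trees_eq:
  "finite V \<Longrightarrow> V \<subseteq> verts G \<Longrightarrow> spanning_trees (wired G V) = trees N V (touching N EG V)"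
  using wired_graph.spanning_trees_wired[OF wired_graph_axioms] finite_touching by auto

lemma finite_nonempty_recs:
  assumes "finite V" "V \<subseteq> verts G" "V \<noteq> {}"
  shows "finite (recs N V (touching N EG V))" "recs N V (touching N EG V) \<noteq> {}"
  using finite_recs[OF assms(1)] linked_sink_graph.full_rec[OF linked_sink_graph_touching[OF assms]] by auto

text \<open>A spanning tree exists because the maximal configuration is recurrent and the two counts
  agree.\<close>

lemma finite_nonempty_trees:
  assumes "finite V" "V \<subseteq> verts G" "V \<noteq> {}"
  shows "finite (trees N V (touching N EG V))" "trees N V (touching N EG V) \<noteq> {}"
proof -
  have "card (trees N V (touching N EG V)) = card (recs N V (touching N EG V))"
    using card_recs_eq_card_trees[OF sink_graph_touching_verts[OF assms(1)]] by simp
  also have "\<dots> > 0" using finite_nonempty_recs[OF assms] by (simp add: card_gt_0_iff)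
  finally show "finite (trees N V (touching N EG V))" "trees N V (touching N EG V) \<noteq> {}"
    by (auto simp: card_gt_0_iff)
qed

text \<open>The probability that \<open>W\<close> is the set of descendants of \<open>Q\<close>,
  written as an event on the finitely many edges at \<open>W\<close>.\<close>

definition tree_prob :: "'v set \<Rightarrow> 'v set \<Rightarrow> 'v set \<Rightarrow> real" where
  "tree_prob Q W V = measure_pmf.prob (pmf_of_set (spanning_trees (wired G V)))
     {T. T \<inter> touching N EG W \<in> trees N W (exits_at N EG Q W)}"

text \<open>The conditional law on \<open>Q\<close> given the pocket; it does not involve
  \<open>V\<close>. If no recurrent configuration exists on \<open>W\<close>, division by zero makes
  it 0.\<close>

definition local_prob :: "'v set \<Rightarrow> 'v set \<Rightarrow> ('v \<Rightarrow> nat) set \<Rightarrow> real" where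
  "local_prob Q W \<Xi> = card {\<eta> \<in> recs N W (exits_at N EG Q W). restrict \<eta> Q \<in> \<Xi>}
     / card (recs N W (exits_at N EG Q W))"

lemma sink_graph_exits: "finite W \<Longrightarrow> sink_graph N W (exits_at N EG Q W)"
  using sink_graph_touching_verts sink_graph_subset by (fastforce simp: exits_at_def)

text \<open>The outer factor \<open>k\<close> counts recurrent configurations and trees of the same
  graph, and the totals agree for the same reason, so only the inner ratio survives.\<close>

lemma sandpile_pocket_prob:
  assumes "finite V" "V \<subseteq> verts G" "V \<noteq> {}" "Q \<subseteq> W" "W \<subseteq> V"
  shows "measure_pmf.prob (sandpile_measure (wired G V))
      {\<eta>. leftover N V (touching N EG V) Q \<eta> = W \<and> restrict \<eta> Q \<in> \<Xi>} = local_prob Q W \<Xi> * tree_prob Q W V"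
proof -
  let ?E = "touching N EG V" and ?X = "exits_at N EG Q W"
  let ?E' = "?E - touching N ?E W"
  note sg = sink_graph_touching_verts[OF assms(1)]
  have fW: "finite W" using assms(5,1) by (rule finite_subset)
  have t: "touching N ?E W = touching N EG W" by (rule touching_touching[OF assms(5)])
  have x: "exits_at N ?E Q W = ?X" by (rule exits_at_touching[OF assms(5)])
  define k where "k = card (recs N (V - W) ?E')"
  have sg': "sink_graph N (V - W) ?E'"
    using sg by (auto simp: sink_graph_def touching_def)
  have k: "k = card (trees N (V - W) ?E')" unfolding k_def by (rule card_recs_eq_card_trees[OF sg'])
  have nR: "card (recs N V ?E) = card (trees N V ?E)" by (rule card_recs_eq_card_trees[OF sg])
  have nB: "card (recs N W ?X) = card (trees N W ?X)" by (rule card_recs_eq_card_trees[OF sink_graph_exits[OF fW]])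
  have 1: "measure_pmf.prob (sandpile_measure (wired G V)) {\<eta>. leftover N V ?E Q \<eta> = W \<and> restrict \<eta> Q \<in> \<Xi>}
      = card (recs N V ?E \<inter> {\<eta>. leftover N V ?E Q \<eta> = W \<and> restrict \<eta> Q \<in> \<Xi>}) / card (recs N V ?E)"
    unfolding sandpile_measure_eq[OF assms(1-3)]
    by (rule measure_pmf_of_set) (rule finite_nonempty_recs[OF assms(1-3)])+
  have 2: "recs N V ?E \<inter> {\<eta>. leftover N V ?E Q \<eta> = W \<and> restrict \<eta> Q \<in> \<Xi>}
      = {\<eta> \<in> recs N V ?E. leftover N V ?E Q \<eta> = W \<and> restrict \<eta> Q \<in> \<Xi>}" by auto
  have 3: "card \<dots> = k * card {\<eta> \<in> recs N W ?X. restrict \<eta> Q \<in> \<Xi>}"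
    using card_recs_split[OF sg assms(4,5), of \<Xi>] x by (simp add: k_def)
  have 4: "tree_prob Q W V = card (trees N V ?E \<inter> {T. T \<inter> touching N EG W \<in> trees N W ?X}) / card (trees N V ?E)"
    unfolding tree_prob_def spanning_trees_eq[OF assms(1,2)]
    by (rule measure_pmf_of_set) (rule finite_nonempty_trees[OF assms(1-3)])+
  have 5: "trees N V ?E \<inter> {T. T \<inter> touching N EG W \<in> trees N W ?X}
      = {T \<in> trees N V ?E. T \<inter> touching N ?E W \<in> trees N W ?X}" by (auto simp: t)
  have "?X \<subseteq> touching N ?E W" by (auto simp: t exits_at_def)
  then have 6: "card {T \<in> trees N V ?E. T \<inter> touching N ?E W \<in> trees N W ?X} = k * card (trees N W ?X)"
    using card_trees_split[OF sg assms(5)] k by simp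
  show ?thesis
  proof (cases "card (recs N W ?X) = 0")
    case True
    then have "recs N W ?X = {}" using finite_recs[OF fW, of N ?X] by simp
    then show ?thesis using 1 2 3 by (simp add: local_prob_def)
  next
    case False
    then show ?thesis using 1 2 3 4 5 6 nR nB by (simp add: local_prob_def)
  qed
qed

lemma sandpile_pocket_prob_total:
  assumes "finite V" "V \<subseteq> verts G" "V \<noteq> {}" "Q \<subseteq> W" "W \<subseteq> V"
  shows "measure_pmf.prob (sandpile_measure (wired G V)) {\<eta>. leftover N V (touching N EG V) Q \<eta> = W} = tree_prob Q W V"
proof -
  have fW: "finite W" using assms(5,1) by (rule finite_subset)
  have eq: "measure_pmf.prob (sandpile_measure (wired G V)) {\<eta>. leftover N V (touching N EG V) Q \<eta> = W}
     = local_prob Q W UNIV * tree_prob Q W V"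
    using sandpile_pocket_prob[OF assms, of UNIV] by simp
  show ?thesis
  proof (cases "recs N W (exits_at N EG Q W) = {}")
    case False
    then have "local_prob Q W UNIV = 1" using finite_recs[OF fW, of N "exits_at N EG Q W"] by (simp add: local_prob_def)
    then show ?thesis using eq by simp
  next
    \<comment> \<open>Here \<open>local_prob\<close> is not 1, but there is no tree on
      \<open>W\<close> either, so both sides vanish.\<close>
    case True
    then have "card (trees N W (exits_at N EG Q W)) = 0"
      using card_recs_eq_card_trees[OF sink_graph_exits[OF fW], of Q] by simp
    then have "trees N W (exits_at N EG Q W) = {}"
      using finite_trees[of "exits_at N EG Q W" N W] sink_graph_exits[OF fW, of Q] by (simp add: sink_graph_def)
    then have "tree_prob Q W V = 0" by (simp add: tree_prob_def)
    then show ?thesis using eq by simp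
  qed
qed

text \<open>The event is decomposed by the left-over set. Left-over sets not in \<open>F\<close> are
  not analysed; their total mass is exactly
  \<open>1 - (\<Sum>W\<in>F. tree_prob Q W V)\<close>.\<close>

lemma sandpile_prob_bounds:
  assumes V: "finite V" "V \<subseteq> verts G" "V \<noteq> {}"
    and F: "finite F" "\<And>W. W \<in> F \<Longrightarrow> Q \<subseteq> W \<and> W \<subseteq> V"
  shows "(\<Sum>W\<in>F. local_prob Q W \<Xi> * tree_prob Q W V)
      \<le> measure_pmf.prob (sandpile_measure (wired G V)) {\<eta>. restrict \<eta> Q \<in> \<Xi>}"
    and "measure_pmf.prob (sandpile_measure (wired G V)) {\<eta>. restrict \<eta> Q \<in> \<Xi>}
      \<le> (\<Sum>W\<in>F. local_prob Q W \<Xi> * tree_prob Q W V) + (1 - (\<Sum>W\<in>F. tree_prob Q W V))"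
proof -
  let ?p = "sandpile_measure (wired G V)" and ?L = "leftover N V (touching N EG V) Q"
  let ?A = "\<lambda>W. {\<eta>. ?L \<eta> = W \<and> restrict \<eta> Q \<in> \<Xi>}" and ?B = "\<lambda>W. {\<eta>. ?L \<eta> = W}"
  have sA: "(\<Sum>W\<in>F. local_prob Q W \<Xi> * tree_prob Q W V) = measure_pmf.prob ?p (\<Union>W\<in>F. ?A W)"
  proof -
    have "measure_pmf.prob ?p (\<Union>W\<in>F. ?A W) = (\<Sum>W\<in>F. measure_pmf.prob ?p (?A W))"
      using F(1) by (intro measure_pmf.finite_measure_finite_Union) (auto simp: disjoint_family_on_def)
    also have "\<dots> = (\<Sum>W\<in>F. local_prob Q W \<Xi> * tree_prob Q W V)"
      using F(2) by (intro sum.cong refl sandpile_pocket_prob[OF V]) auto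
    finally show ?thesis by simp
  qed
  have sB: "(\<Sum>W\<in>F. tree_prob Q W V) = measure_pmf.prob ?p (\<Union>W\<in>F. ?B W)"
  proof -
    have "measure_pmf.prob ?p (\<Union>W\<in>F. ?B W) = (\<Sum>W\<in>F. measure_pmf.prob ?p (?B W))"
      using F(1) by (intro measure_pmf.finite_measure_finite_Union) (auto simp: disjoint_family_on_def)
    also have "\<dots> = (\<Sum>W\<in>F. tree_prob Q W V)"
      using F(2) by (intro sum.cong refl sandpile_pocket_prob_total[OF V]) auto
    finally show ?thesis by simp
  qed
  show "(\<Sum>W\<in>F. local_prob Q W \<Xi> * tree_prob Q W V) \<le> measure_pmf.prob ?p {\<eta>. restrict \<eta> Q \<in> \<Xi>}"
    unfolding sA by (intro measure_pmf.finite_measure_mono) auto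
  have "measure_pmf.prob ?p {\<eta>. restrict \<eta> Q \<in> \<Xi>}
      \<le> measure_pmf.prob ?p ((\<Union>W\<in>F. ?A W) \<union> (- (\<Union>W\<in>F. ?B W)))"
    by (intro measure_pmf.finite_measure_mono) auto
  also have "\<dots> \<le> measure_pmf.prob ?p (\<Union>W\<in>F. ?A W) + measure_pmf.prob ?p (- (\<Union>W\<in>F. ?B W))"
    by (intro measure_Un_le) auto
  also have "measure_pmf.prob ?p (- (\<Union>W\<in>F. ?B W)) = 1 - measure_pmf.prob ?p (\<Union>W\<in>F. ?B W)"
    using measure_pmf.prob_compl[of "\<Union>W\<in>F. ?B W" ?p] by (simp add: Compl_eq_Diff_UNIV)
  finally show "measure_pmf.prob ?p {\<eta>. restrict \<eta> Q \<in> \<Xi>}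
      \<le> (\<Sum>W\<in>F. local_prob Q W \<Xi> * tree_prob Q W V) + (1 - (\<Sum>W\<in>F. tree_prob Q W V))"
    unfolding sA sB .
qed

section \<open>Exhaustions\<close>

lemma exhaustion_finite: "exhaustion G V \<Longrightarrow> finite (V n)"
  by (simp add: exhaustion_def)

lemma exhaustion_sub: "exhaustion G V \<Longrightarrow> V n \<subseteq> verts G"
  by (auto simp: exhaustion_def)

lemma exhaustion_eventually:
  assumes "exhaustion G V" "finite S" "S \<subseteq> verts G"
  shows "\<forall>\<^sub>F n in sequentially. S \<subseteq> V n"
proof -
  have "\<forall>\<^sub>F n in sequentially. x \<in> V n" if x: "x \<in> S" for x
  proof -
    have "x \<in> \<Union>(range V)" using assms(1,3) x unfolding exhaustion_def by blast
    then obtain m where m: "x \<in> V m" by auto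
    then have "x \<in> V n" if "n \<ge> m" for n
      using incseqD[of V m n] assms(1) that by (auto simp: exhaustion_def)
    then show ?thesis by (auto simp: eventually_sequentially)
  qed
  then have "\<forall>\<^sub>F n in sequentially. \<forall>x\<in>S. x \<in> V n"
    by (simp add: eventually_ball_finite_distrib assms(2))
  then show ?thesis by (rule eventually_mono) auto
qed

lemma exhaustion_eventually_nonempty:
  assumes "exhaustion G V" shows "\<forall>\<^sub>F n in sequentially. V n \<noteq> {}"
proof -
  obtain x where "x \<in> verts G" using inf by fastforce
  then have "\<forall>\<^sub>F n in sequentially. {x} \<subseteq> V n" by (intro exhaustion_eventually[OF assms]) auto
  then show ?thesis by (rule eventually_mono) auto
qed

lemma exhaustion_exists: "\<exists>V. exhaustion G V"
proof -
  have "verts G \<noteq> {}" using inf by auto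
  then have "exhaustion G (\<lambda>n. from_nat_into (verts G) ` {..n})"
    using range_from_nat_into[OF _ countable_verts] unfolding exhaustion_def
    by (auto simp: incseq_def intro: from_nat_into)
  then show ?thesis by blast
qed

end

locale one_ended_wusf = infinite_graph G for G :: "('v, 'e) mgraph" +
  fixes \<mu> :: "('e \<Rightarrow> bool) measure"
  assumes wusf: "is_wusf G \<mu>"
    and one_end: "AE \<omega> in \<mu>. \<forall>x\<in>verts G.
      card (tree_ends (open_subgraph G \<omega>) (component (open_subgraph G \<omega>) x)) = 1"
begin

section \<open>Passing to the limit through the forest\<close>

sublocale prob_space \<mu> using wusf by (simp add: is_wusf_def)

lemma sets_mu: "sets \<mu> = sets (\<Pi>\<^sub>M e\<in>EG. count_space UNIV)"
  using wusf by (simp add: is_wusf_def)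

lemma wusf_limit:
  assumes "exhaustion G V" "finite F" "F \<subseteq> EG" "B \<subseteq> Pow F"
  shows "(\<lambda>n. measure_pmf.prob (pmf_of_set (spanning_trees (wired G (V n)))) {T. T \<inter> F \<in> B})
    \<longlonglongrightarrow> measure \<mu> {\<omega> \<in> space \<mu>. {e \<in> F. \<omega> e} \<in> B}"
  using wusf assms by (simp add: is_wusf_def)

lemma local_event_sets:
  assumes "finite F" "F \<subseteq> EG"
  shows "{\<omega> \<in> space \<mu>. {e \<in> F. \<omega> e} \<in> B} \<in> sets \<mu>"
proof -
  have m: "(\<lambda>\<omega>. {e \<in> F. \<omega> e}) \<in> measurable \<mu> (count_space (Pow F))"
  proof (rule measurable_count_space_eq2[THEN iffD2, OF _ conjI])
    show "\<forall>A\<in>Pow F. (\<lambda>\<omega>. {e \<in> F. \<omega> e}) -` {A} \<inter> space \<mu> \<in> sets \<mu>"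
    proof
      fix A assume A: "A \<in> Pow F"
      have c: "Measurable.pred \<mu> (\<lambda>\<omega>. \<omega> e)" if "e \<in> F" for e
      proof -
        have "(\<lambda>\<omega>. \<omega> e) \<in> measurable (\<Pi>\<^sub>M e\<in>EG. count_space (UNIV :: bool set)) (count_space UNIV)"
          using that assms by (intro measurable_component_singleton) auto
        then show ?thesis using measurable_cong_sets[OF sets_mu refl] by blast
      qed
      have "(\<lambda>\<omega>. {e \<in> F. \<omega> e}) -` {A} \<inter> space \<mu> = {\<omega> \<in> space \<mu>. \<forall>e\<in>F. \<omega> e = (e \<in> A)}"
        using A by auto
      also have "\<dots> \<in> sets \<mu>"
        using c assms(1) by (intro sets.sets_Collect_finite_All) (auto intro!: pred_sets1 simp: pred_def)
      finally show "(\<lambda>\<omega>. {e \<in> F. \<omega> e}) -` {A} \<inter> space \<mu> \<in> sets \<mu>" .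
    qed
  qed (use assms in auto)
  have "{\<omega> \<in> space \<mu>. {e \<in> F. \<omega> e} \<in> B} = (\<lambda>\<omega>. {e \<in> F. \<omega> e}) -` (B \<inter> Pow F) \<inter> space \<mu>" by auto
  also have "\<dots> \<in> sets \<mu>" by (rule measurable_sets[OF m]) auto
  finally show ?thesis .
qed

text \<open>A fixed finite \<open>F\<close> with a circuit lies in no spanning tree, so the event
  that \<open>F\<close> is open has probability 0 along an exhaustion and hence in the limit. There
  are countably many such \<open>F\<close>.\<close>

lemma AE_no_circuit: "AE \<omega> in \<mu>. \<forall>F. finite F \<and> F \<subseteq> EG \<and> (\<forall>e\<in>F. \<omega> e) \<longrightarrow> \<not> circuit N F"
proof -
  obtain V where V: "exhaustion G V" using exhaustion_exists by auto
  have "AE \<omega> in \<mu>. (\<forall>e\<in>F. \<omega> e) \<longrightarrow> \<not> circuit N F" if F: "F \<in> {F. finite F \<and> F \<subseteq> EG}" for F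
  proof (cases "circuit N F")
    case True
    have Fin: "finite F" "F \<subseteq> EG" using F by auto
    let ?A = "{\<omega> \<in> space \<mu>. {e \<in> F. \<omega> e} \<in> {F}}"
    have "\<forall>\<^sub>F n in sequentially. measure_pmf.prob (pmf_of_set (spanning_trees (wired G (V n)))) {T. T \<inter> F \<in> {F}} = 0"
      using exhaustion_eventually_nonempty[OF V]
    proof (rule eventually_mono)
      fix n assume "V n \<noteq> {}"
      note v = exhaustion_finite[OF V, of n] exhaustion_sub[OF V, of n] this
      have "trees N (V n) (touching N EG (V n)) \<inter> {T. T \<inter> F \<in> {F}} = {}"
        using trees_no_circuit[OF sink_graph_touching_verts[OF v(1)]] True by auto
      then show "measure_pmf.prob (pmf_of_set (spanning_trees (wired G (V n)))) {T. T \<inter> F \<in> {F}} = 0"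
        unfolding spanning_trees_eq[OF v(1,2)] using finite_nonempty_trees[OF v]
        by (subst measure_pmf_of_set) auto
    qed
    then have "(\<lambda>n. measure_pmf.prob (pmf_of_set (spanning_trees (wired G (V n)))) {T. T \<inter> F \<in> {F}}) \<longlonglongrightarrow> 0"
      by (rule tendsto_eventually)
    then have "measure \<mu> ?A = 0"
      using wusf_limit[OF V Fin, of "{F}"] LIMSEQ_unique by blast
    moreover have "?A \<in> sets \<mu>" by (rule local_event_sets[OF Fin])
    ultimately have "?A \<in> null_sets \<mu>" by (simp add: emeasure_eq_measure null_setsI)
    then have "AE \<omega> in \<mu>. \<omega> \<notin> ?A" by (rule AE_not_in)
    then show ?thesis using AE_space by eventually_elim auto
  qed simp
  then have "AE \<omega> in \<mu>. \<forall>F\<in>{F. finite F \<and> F \<subseteq> EG}. (\<forall>e\<in>F. \<omega> e) \<longrightarrow> \<not> circuit N F"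
    using countable_edges by (subst AE_ball_countable) (auto intro: countable_Collect_finite_subset)
  then show ?thesis by eventually_elim auto
qed

definition pocket_event :: "'v set \<Rightarrow> 'v set \<Rightarrow> ('e \<Rightarrow> bool) set" where
  "pocket_event Q W = {\<omega> \<in> space \<mu>. {e \<in> touching N EG W. \<omega> e} \<in> trees N W (exits_at N EG Q W)}"

lemma pocket_event_sets: "finite W \<Longrightarrow> pocket_event Q W \<in> sets \<mu>"
  unfolding pocket_event_def using finite_touching touching_subset by (intro local_event_sets)

lemma AE_pocket:
  assumes "finite Q" "Q \<subseteq> verts G"
  shows "AE \<omega> in \<mu>. \<omega> \<in> (\<Union>W\<in>{W. finite W \<and> Q \<subseteq> W \<and> W \<subseteq> verts G}. pocket_event Q W)"
  using one_end AE_no_circuit AE_space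
proof eventually_elim
  case (elim \<omega>)
  let ?O = "{e \<in> EG. \<omega> e}"
  have "\<exists>W. finite W \<and> Q \<subseteq> W \<and> W \<subseteq> verts G \<and> ?O \<inter> touching N EG W \<in> trees N W (exits_at N EG Q W)"
    using elim by (intro one_end_pocket[OF refl assms]) auto
  then obtain W where W: "finite W" "Q \<subseteq> W" "W \<subseteq> verts G"
    "?O \<inter> touching N EG W \<in> trees N W (exits_at N EG Q W)" by auto
  have "?O \<inter> touching N EG W = {e \<in> touching N EG W. \<omega> e}" by (auto simp: touching_def)
  then have "\<omega> \<in> pocket_event Q W" using W elim by (simp add: pocket_event_def)
  then show ?case using W by auto
qed

text \<open>The pocket events cover almost everything and there are countably many of them, so
  finitely many have a union of nearly full measure; subadditivity then bounds the sum from
  below.\<close>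

lemma pocket_events_exhaust:
  assumes "finite Q" "Q \<subseteq> verts G" "\<epsilon> > 0"
  shows "\<exists>F. finite F \<and> (\<forall>W\<in>F. finite W \<and> Q \<subseteq> W \<and> W \<subseteq> verts G) \<and>
    (\<Sum>W\<in>F. measure \<mu> (pocket_event Q W)) > 1 - \<epsilon>"
proof -
  let ?I = "{W. finite W \<and> Q \<subseteq> W \<and> W \<subseteq> verts G}"
  have c: "countable ?I"
    by (rule countable_subset[OF _ countable_Collect_finite_subset[OF countable_verts]]) auto
  have ne: "?I \<noteq> {}" using assms by auto
  define w where "w = from_nat_into ?I"
  have w: "w n \<in> ?I" for n unfolding w_def by (rule from_nat_into[OF ne])
  have rw: "range w = ?I" unfolding w_def by (rule range_from_nat_into[OF ne c])
  define A where "A n = (\<Union>i\<le>n. pocket_event Q (w i))" for n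
  have sA: "range A \<subseteq> sets \<mu>" unfolding A_def using pocket_event_sets w by (auto intro!: sets.finite_UN)
  have "incseq A" unfolding A_def incseq_def by (auto intro: order_trans)
  then have lim: "(\<lambda>n. measure \<mu> (A n)) \<longlonglongrightarrow> measure \<mu> (\<Union>n. A n)"
    by (rule finite_Lim_measure_incseq[OF sA])
  have "(\<Union>n. A n) = (\<Union>W\<in>?I. pocket_event Q W)"
    unfolding A_def rw[symmetric] by auto
  then have "AE \<omega> in \<mu>. \<omega> \<in> (\<Union>n. A n)" using AE_pocket[OF assms(1,2)] by simp
  then have "measure \<mu> (\<Union>n. A n) = 1" using sA by (subst prob_eq_1) auto
  then have "\<forall>\<^sub>F n in sequentially. measure \<mu> (A n) > 1 - \<epsilon>"
    using lim assms(3) by (intro order_tendstoD(1)[OF lim]) simp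
  then obtain n where n: "measure \<mu> (A n) > 1 - \<epsilon>" by (auto simp: eventually_sequentially)
  have "A n = (\<Union>W\<in>w ` {..n}. pocket_event Q W)" by (auto simp: A_def)
  moreover have "measure \<mu> (\<Union>W\<in>w ` {..n}. pocket_event Q W) \<le> (\<Sum>W\<in>w ` {..n}. measure \<mu> (pocket_event Q W))"
    using pocket_event_sets w by (intro finite_measure_subadditive_finite) auto
  ultimately have "(\<Sum>W\<in>w ` {..n}. measure \<mu> (pocket_event Q W)) > 1 - \<epsilon>" using n by simp
  moreover have "\<forall>W\<in>w ` {..n}. finite W \<and> Q \<subseteq> W \<and> W \<subseteq> verts G" using w by auto
  ultimately show ?thesis by (intro exI[of _ "w ` {..n}"]) auto
qed

lemma tree_prob_limit:
  assumes "exhaustion G V" "finite W"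
  shows "(\<lambda>n. tree_prob Q W (V n)) \<longlonglongrightarrow> measure \<mu> (pocket_event Q W)"
  unfolding tree_prob_def pocket_event_def
  using assms finite_touching touching_subset[of N EG W]
  by (intro wusf_limit) (auto simp: trees_def exits_at_def)

theorem sandpile_limit:
  assumes Q: "finite Q" "Q \<subseteq> verts G"
  shows "\<exists>L. \<forall>V. exhaustion G V \<longrightarrow>
    (\<lambda>n. measure_pmf.prob (sandpile_measure (wired G (V n))) {\<eta>. restrict \<eta> Q \<in> \<Xi>}) \<longlonglongrightarrow> L"
proof -
  let ?a = "\<lambda>V n. measure_pmf.prob (sandpile_measure (wired G (V n))) {\<eta>. restrict \<eta> Q \<in> \<Xi>}"
  have "\<exists>L. \<forall>V\<in>{V. exhaustion G V}. ?a V \<longlonglongrightarrow> L"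
  proof (rule common_limit)
    show "{V. exhaustion G V} \<noteq> {}" using exhaustion_exists by auto
    fix \<epsilon> :: real assume e: "\<epsilon> > 0"
    obtain F where F: "finite F" "\<And>W. W \<in> F \<Longrightarrow> finite W \<and> Q \<subseteq> W \<and> W \<subseteq> verts G"
      "(\<Sum>W\<in>F. measure \<mu> (pocket_event Q W)) > 1 - \<epsilon> / 2"
      using pocket_events_exhaust[OF Q, of "\<epsilon> / 2"] e by auto
    \<comment> \<open>This constant involves only the forest measure and the local ratios, so it is
      the same for every exhaustion. Half of \<epsilon> pays for the convergence of the finite sum,
      half for the mass outside \<open>F\<close>.\<close>
    define c where "c = (\<Sum>W\<in>F. local_prob Q W \<Xi> * measure \<mu> (pocket_event Q W))"
    have "\<forall>\<^sub>F n in sequentially. \<bar>?a V n - c\<bar> < \<epsilon>" if V: "exhaustion G V" for V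
    proof -
      have "(\<lambda>n. \<Sum>W\<in>F. local_prob Q W \<Xi> * tree_prob Q W (V n)) \<longlonglongrightarrow> c"
        unfolding c_def using F(2) by (intro tendsto_sum tendsto_mult tendsto_const tree_prob_limit[OF V]) auto
      then have 1: "\<forall>\<^sub>F n in sequentially. dist (\<Sum>W\<in>F. local_prob Q W \<Xi> * tree_prob Q W (V n)) c < \<epsilon> / 2"
        using e by (intro tendstoD) auto
      have "(\<lambda>n. \<Sum>W\<in>F. tree_prob Q W (V n)) \<longlonglongrightarrow> (\<Sum>W\<in>F. measure \<mu> (pocket_event Q W))"
        using F(2) by (intro tendsto_sum tree_prob_limit[OF V]) auto
      then have 2: "\<forall>\<^sub>F n in sequentially. (\<Sum>W\<in>F. tree_prob Q W (V n)) > 1 - \<epsilon> / 2"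
        by (rule order_tendstoD(1)) (rule F(3))
      have 3: "\<forall>\<^sub>F n in sequentially. \<Union>F \<subseteq> V n"
        using F(1,2) by (intro exhaustion_eventually[OF V]) auto
      show ?thesis
        using 1 2 3 exhaustion_eventually_nonempty[OF V]
      proof eventually_elim
        case (elim n)
        have F': "Q \<subseteq> W \<and> W \<subseteq> V n" if "W \<in> F" for W using F(2)[OF that] elim(3) that by auto
        show ?case
          using elim(1,2) sandpile_prob_bounds[OF exhaustion_finite[OF V] exhaustion_sub[OF V] elim(4) F(1) F', of "\<Xi>"]
          unfolding dist_real_def by linarith
      qed
    qed
    then show "\<exists>c. \<forall>V\<in>{V. exhaustion G V}. \<forall>\<^sub>F n in sequentially. \<bar>?a V n - c\<bar> < \<epsilon>" by auto
  qed
  then show ?thesis by auto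
qed

end

section \<open>The infinite-volume measure\<close>

lemma prod_count_space_cylinder_sets:
  assumes "finite Q" "Q \<subseteq> I"
  shows "{\<eta> \<in> space (\<Pi>\<^sub>M x\<in>I. count_space (D x)). restrict \<eta> Q = \<xi>} \<in> sets (\<Pi>\<^sub>M x\<in>I. count_space (D x))"
proof (cases "\<xi> \<in> extensional Q")
  case True
  let ?M = "\<Pi>\<^sub>M x\<in>I. count_space (D x)"
  have "{\<eta> \<in> space ?M. restrict \<eta> Q = \<xi>} = {\<eta> \<in> space ?M. \<forall>x\<in>Q. \<eta> x = \<xi> x}"
    using True by (auto simp: extensional_def restrict_def fun_eq_iff)
  also have "\<dots> \<in> sets ?M"
  proof (rule sets.sets_Collect_finite_All[OF _ assms(1)])
    fix x assume "x \<in> Q"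
    then have "(\<lambda>\<eta>. \<eta> x) \<in> measurable ?M (count_space (D x))"
      using assms(2) by (intro measurable_component_singleton) auto
    from measurable_sets[OF this, of "{\<xi> x} \<inter> D x"]
    have "(\<lambda>\<eta>. \<eta> x) -` ({\<xi> x} \<inter> D x) \<inter> space ?M \<in> sets ?M" by simp
    also have "(\<lambda>\<eta>. \<eta> x) -` ({\<xi> x} \<inter> D x) \<inter> space ?M = {\<eta> \<in> space ?M. \<eta> x = \<xi> x}"
      using \<open>x \<in> Q\<close> assms(2) by (auto simp: space_PiM PiE_iff extensional_def)
    finally show "{\<eta> \<in> space ?M. \<eta> x = \<xi> x} \<in> sets ?M" .
  qed
  finally show ?thesis .
next
  case False
  then have "{\<eta> \<in> space (\<Pi>\<^sub>M x\<in>I. count_space (D x)). restrict \<eta> Q = \<xi>} = {}" by auto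
  then show ?thesis by (simp only: sets.empty_sets)
qed

text \<open>As each \<open>D x\<close> is finite, a cylinder over \<open>J\<close> is a finite
  disjoint union of the sets fixing one configuration on \<open>J\<close>, and the cylinders
  determine the measure.\<close>

lemma prod_count_space_eqI:
  assumes "prob_space M" "prob_space M'"
    and sets: "sets M = sets (\<Pi>\<^sub>M x\<in>I. count_space (D x))" "sets M' = sets (\<Pi>\<^sub>M x\<in>I. count_space (D x))"
    and D: "\<And>x. x \<in> I \<Longrightarrow> finite (D x)"
    and eq: "\<And>Q \<xi>. finite Q \<Longrightarrow> Q \<subseteq> I \<Longrightarrow> \<xi> \<in> (\<Pi>\<^sub>E x\<in>Q. D x) \<Longrightarrow>
      measure M {\<eta> \<in> space M. restrict \<eta> Q = \<xi>} = measure M' {\<eta> \<in> space M'. restrict \<eta> Q = \<xi>}"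
  shows "M = M'"
proof (rule measure_eqI_PiM_infinite[OF sets])
  interpret M: prob_space M by fact
  interpret M': prob_space M' by fact
  show "finite_measure M" by unfold_locales
  let ?P = "\<Pi>\<^sub>M x\<in>I. count_space (D x)"
  note sp = sets_eq_imp_space_eq[OF sets(1)] sets_eq_imp_space_eq[OF sets(2)]
  fix A J assume J: "finite J" "J \<subseteq> I" "\<And>i. i \<in> J \<Longrightarrow> A i \<in> sets (count_space (D i))"
  define C where "C \<xi> = {\<eta> \<in> space ?P. restrict \<eta> J = \<xi>}" for \<xi>
  have AD: "Pi\<^sub>E J A \<subseteq> Pi\<^sub>E J D" using J(3) by (intro PiE_mono) auto
  have "finite (Pi\<^sub>E J D)" using J(1,2) D by (intro finite_PiE) auto
  then have fin: "finite (Pi\<^sub>E J A)" using AD by (rule rev_finite_subset)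
  have emb: "prod_emb I (\<lambda>x. count_space (D x)) J (Pi\<^sub>E J A) = (\<Union>\<xi>\<in>Pi\<^sub>E J A. C \<xi>)"
    by (auto simp: prod_emb_def C_def space_PiM)
  have CM: "C \<xi> \<in> sets M" "C \<xi> \<in> sets M'" for \<xi>
    unfolding C_def sets using prod_count_space_cylinder_sets[OF J(1,2)] by auto
  have disj: "disjoint_family_on C (Pi\<^sub>E J A)" by (auto simp: disjoint_family_on_def C_def)
  have "measure M (\<Union>\<xi>\<in>Pi\<^sub>E J A. C \<xi>) = (\<Sum>\<xi>\<in>Pi\<^sub>E J A. measure M (C \<xi>))"
    using fin CM disj by (intro M.finite_measure_finite_Union) auto
  also have "\<dots> = (\<Sum>\<xi>\<in>Pi\<^sub>E J A. measure M' (C \<xi>))"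
    using eq[OF J(1,2)] AD by (intro sum.cong refl) (auto simp: C_def sp)
  also have "\<dots> = measure M' (\<Union>\<xi>\<in>Pi\<^sub>E J A. C \<xi>)"
    using fin CM disj by (intro M'.finite_measure_finite_Union[symmetric]) auto
  finally show "emeasure M (prod_emb I (\<lambda>x. count_space (D x)) J (Pi\<^sub>E J A))
      = emeasure M' (prod_emb I (\<lambda>x. count_space (D x)) J (Pi\<^sub>E J A))"
    unfolding emb by (simp add: M.emeasure_eq_measure M'.emeasure_eq_measure)
qed

context one_ended_wusf
begin

abbreviation "heights Q \<equiv> (\<Pi>\<^sub>E x\<in>Q. {0..<deg G x})"

section \<open>Limits of the cylinder probabilities\<close>

lemma deg_eq: "deg G x = vdeg N EG x"
  by (simp add: deg_def incident_def vdeg_def)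

lemma deg_pos: "x \<in> verts G \<Longrightarrow> 0 < deg G x"
proof -
  assume x: "x \<in> verts G"
  then have "linked N {x} (touching N EG {x})" by (intro linked_edges) auto
  then obtain e where "e \<in> touching N EG {x}" "N e \<inter> {x} \<noteq> {}" using linkedD[of N "{x}" _ "{x}"] by blast
  then have "e \<in> incident G x" by (auto simp: touching_def incident_def)
  then show ?thesis using finite_incident[of x] by (auto simp: deg_def card_gt_0_iff)
qed

lemma finite_heights: "finite Q \<Longrightarrow> finite (heights Q)"
  by (intro finite_PiE) auto

text \<open>The choice is unambiguous for finite \<open>Q \<subseteq> verts G\<close>: a common
  limit exists, and there is an exhaustion to pin it down.\<close>

definition sandpile_lim :: "'v set \<Rightarrow> ('v \<Rightarrow> nat) set \<Rightarrow> real" where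
  "sandpile_lim Q \<Xi> = (SOME L. \<forall>V. exhaustion G V \<longrightarrow>
    (\<lambda>n. measure_pmf.prob (sandpile_measure (wired G (V n))) {\<eta>. restrict \<eta> Q \<in> \<Xi>}) \<longlonglongrightarrow> L)"

lemma sandpile_lim:
  assumes "finite Q" "Q \<subseteq> verts G" "exhaustion G V"
  shows "(\<lambda>n. measure_pmf.prob (sandpile_measure (wired G (V n))) {\<eta>. restrict \<eta> Q \<in> \<Xi>}) \<longlonglongrightarrow> sandpile_lim Q \<Xi>"
  using someI_ex[OF sandpile_limit[OF assms(1,2), of \<Xi>]] assms(3) unfolding sandpile_lim_def by blast

lemma sandpile_lim_nonneg:
  assumes "finite Q" "Q \<subseteq> verts G" shows "0 \<le> sandpile_lim Q \<Xi>"
proof -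
  obtain V where V: "exhaustion G V" using exhaustion_exists by auto
  show ?thesis by (rule LIMSEQ_le_const[OF sandpile_lim[OF assms V]]) auto
qed

lemma sandpile_lim_UNIV:
  assumes "finite Q" "Q \<subseteq> verts G" shows "sandpile_lim Q UNIV = 1"
proof -
  obtain V where V: "exhaustion G V" using exhaustion_exists by auto
  have "(\<lambda>n. 1) \<longlonglongrightarrow> sandpile_lim Q UNIV" using sandpile_lim[OF assms V, of UNIV] by simp
  then show ?thesis by (simp add: LIMSEQ_const_iff)
qed

text \<open>Once \<open>Q \<subseteq> V n\<close>, the wired degrees on \<open>Q\<close> are those
  of \<open>G\<close>, so all mass sits on the fixed finite set \<open>heights Q\<close>. Finite
  additivity passes to the limit and no mass escapes.\<close>

lemma sandpile_lim_eq_sum: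
  assumes "finite Q" "Q \<subseteq> verts G"
  shows "sandpile_lim Q \<Xi> = (\<Sum>\<xi>\<in>\<Xi> \<inter> heights Q. sandpile_lim Q {\<xi>})"
proof -
  obtain V where V: "exhaustion G V" using exhaustion_exists by auto
  let ?p = "\<lambda>n. sandpile_measure (wired G (V n))"
  have "\<forall>\<^sub>F n in sequentially. (\<Sum>\<xi>\<in>\<Xi> \<inter> heights Q. measure_pmf.prob (?p n) {\<eta>. restrict \<eta> Q \<in> {\<xi>}})
      = measure_pmf.prob (?p n) {\<eta>. restrict \<eta> Q \<in> \<Xi>}"
    using exhaustion_eventually[OF V assms] exhaustion_eventually_nonempty[OF V]
  proof eventually_elim
    case (elim n)
    note v = exhaustion_finite[OF V, of n] exhaustion_sub[OF V, of n] elim(2)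
    have supp: "restrict \<eta> Q \<in> heights Q" if "\<eta> \<in> set_pmf (?p n)" for \<eta>
    proof -
      have "\<eta> \<in> recs N (V n) (touching N EG (V n))"
        using that finite_nonempty_recs[OF v] by (simp add: sandpile_measure_eq[OF v] set_pmf_of_set)
      then have st: "\<eta> x < vdeg N (touching N EG (V n)) x" if "x \<in> V n" for x
        using that by (auto simp: recs_def PiE_iff)
      have "\<eta> x < deg G x" if "x \<in> Q" for x
      proof -
        have "x \<in> V n" using that elim(1) by auto
        then show ?thesis using st[of x] vdeg_touching[of x "V n" N EG] by (simp add: deg_eq)
      qed
      then show ?thesis by auto
    qed
    have "(\<Sum>\<xi>\<in>\<Xi> \<inter> heights Q. measure_pmf.prob (?p n) {\<eta>. restrict \<eta> Q \<in> {\<xi>}})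
        = measure_pmf.prob (?p n) (\<Union>\<xi>\<in>\<Xi> \<inter> heights Q. {\<eta>. restrict \<eta> Q \<in> {\<xi>}})"
      using finite_heights[OF assms(1)]
      by (intro measure_pmf.finite_measure_finite_Union[symmetric]) (auto simp: disjoint_family_on_def)
    also have "\<dots> = measure_pmf.prob (?p n) {\<eta>. restrict \<eta> Q \<in> \<Xi>}"
      using supp by (intro measure_prob_cong_0) (auto simp: set_pmf_iff)
    finally show ?case .
  qed
  moreover have "(\<lambda>n. \<Sum>\<xi>\<in>\<Xi> \<inter> heights Q. measure_pmf.prob (?p n) {\<eta>. restrict \<eta> Q \<in> {\<xi>}})
      \<longlonglongrightarrow> (\<Sum>\<xi>\<in>\<Xi> \<inter> heights Q. sandpile_lim Q {\<xi>})"
    by (intro tendsto_sum sandpile_lim[OF assms V])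
  ultimately have "(\<lambda>n. measure_pmf.prob (?p n) {\<eta>. restrict \<eta> Q \<in> \<Xi>}) \<longlonglongrightarrow> (\<Sum>\<xi>\<in>\<Xi> \<inter> heights Q. sandpile_lim Q {\<xi>})"
    by (rule Lim_transform_eventually[rotated])
  then show ?thesis using sandpile_lim[OF assms V] LIMSEQ_unique by blast
qed

lemma sandpile_lim_outside:
  assumes "finite Q" "Q \<subseteq> verts G" "\<xi> \<notin> heights Q"
  shows "sandpile_lim Q {\<xi>} = 0"
  using sandpile_lim_eq_sum[OF assms(1,2), of "{\<xi>}"] assms(3) by simp

text \<open>Both choices are made from the same predicate, since restricting to \<open>Q'\<close>
  and then to \<open>Q\<close> is restricting to \<open>Q\<close>.\<close>

lemma sandpile_lim_restrict:
  assumes "Q \<subseteq> Q'"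
  shows "sandpile_lim Q' {\<zeta>. restrict \<zeta> Q \<in> \<Xi>} = sandpile_lim Q \<Xi>"
  unfolding sandpile_lim_def using assms by (simp add: restrict_restrict Int_absorb1)

definition marginal :: "'v set \<Rightarrow> ('v \<Rightarrow> nat) pmf" where
  "marginal Q = embed_pmf (\<lambda>\<xi>. sandpile_lim Q {\<xi>})"

lemma pmf_marginal:
  assumes "finite Q" "Q \<subseteq> verts G"
  shows "pmf (marginal Q) \<xi> = sandpile_lim Q {\<xi>}"
  unfolding marginal_def
proof (rule pmf_embed_pmf)
  show "\<And>\<xi>. 0 \<le> sandpile_lim Q {\<xi>}" by (rule sandpile_lim_nonneg[OF assms])
  have "(\<integral>\<^sup>+\<xi>. ennreal (sandpile_lim Q {\<xi>}) \<partial>count_space UNIV) = (\<Sum>\<xi>\<in>heights Q. ennreal (sandpile_lim Q {\<xi>}))"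
    using finite_heights[OF assms(1)] sandpile_lim_outside[OF assms] by (intro nn_integral_count_space') auto
  also have "\<dots> = ennreal (\<Sum>\<xi>\<in>heights Q. sandpile_lim Q {\<xi>})"
    using sandpile_lim_nonneg[OF assms] by (intro sum_ennreal) auto
  also have "(\<Sum>\<xi>\<in>heights Q. sandpile_lim Q {\<xi>}) = 1"
    using sandpile_lim_eq_sum[OF assms, of UNIV] sandpile_lim_UNIV[OF assms] by simp
  finally show "(\<integral>\<^sup>+\<xi>. ennreal (sandpile_lim Q {\<xi>}) \<partial>count_space UNIV) = 1" by simp
qed

lemma set_marginal: "finite Q \<Longrightarrow> Q \<subseteq> verts G \<Longrightarrow> set_pmf (marginal Q) \<subseteq> heights Q"
proof
  fix \<xi> assume a: "finite Q" "Q \<subseteq> verts G" "\<xi> \<in> set_pmf (marginal Q)"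
  then have "sandpile_lim Q {\<xi>} \<noteq> 0" using pmf_marginal[OF a(1,2), of \<xi>] by (simp add: set_pmf_iff)
  then show "\<xi> \<in> heights Q" using sandpile_lim_outside[OF a(1,2), of \<xi>] by blast
qed

lemma measure_marginal:
  assumes "finite Q" "Q \<subseteq> verts G"
  shows "measure_pmf.prob (marginal Q) \<Xi> = sandpile_lim Q \<Xi>"
proof -
  have "measure_pmf.prob (marginal Q) \<Xi> = measure_pmf.prob (marginal Q) (\<Xi> \<inter> heights Q)"
    using set_marginal[OF assms] by (intro measure_prob_cong_0) (auto simp: set_pmf_iff)
  also have "\<dots> = (\<Sum>\<xi>\<in>\<Xi> \<inter> heights Q. sandpile_lim Q {\<xi>})"
    using finite_heights[OF assms(1)] pmf_marginal[OF assms] by (simp add: measure_measure_pmf_finite)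
  finally show ?thesis by (simp only: sandpile_lim_eq_sum[OF assms, of \<Xi>])
qed

text \<open>Kolmogorov's consistency condition.\<close>

lemma marginal_restrict:
  assumes "Q \<subseteq> Q'" "finite Q'" "Q' \<subseteq> verts G"
  shows "map_pmf (\<lambda>\<zeta>. restrict \<zeta> Q) (marginal Q') = marginal Q"
proof (rule pmf_eqI)
  fix \<xi>
  have Q: "finite Q" "Q \<subseteq> verts G" using assms finite_subset[OF assms(1,2)] by auto
  have "pmf (map_pmf (\<lambda>\<zeta>. restrict \<zeta> Q) (marginal Q')) \<xi> = sandpile_lim Q' {\<zeta>. restrict \<zeta> Q \<in> {\<xi>}}"
    using measure_marginal[OF assms(2,3)] by (simp add: pmf_map vimage_def)
  also have "\<dots> = pmf (marginal Q) \<xi>"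
    unfolding pmf_marginal[OF Q] by (rule sandpile_lim_restrict[OF assms(1)])
  finally show "pmf (map_pmf (\<lambda>\<zeta>. restrict \<zeta> Q) (marginal Q')) \<xi> = pmf (marginal Q) \<xi>" .
qed

text \<open>Kolmogorov's extension theorem is available for Polish spaces; \<open>nat\<close> is not an instance of
  that class, so the marginals are transported to \<open>real\<close> and the limit is rounded back.\<close>

definition real_marginal :: "'v set \<Rightarrow> ('v \<Rightarrow> real) measure" where
  "real_marginal Q = distr (measure_pmf (marginal Q)) (\<Pi>\<^sub>M x\<in>Q. borel) (\<lambda>\<xi>. \<lambda>x\<in>Q. real (\<xi> x))"

section \<open>Kolmogorov extension and rounding\<close>

lemma measurable_marginal: "(\<lambda>\<xi>. \<lambda>x\<in>Q. real (\<xi> x)) \<in> measurable (measure_pmf p) (\<Pi>\<^sub>M x\<in>Q. borel)"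
  by (auto simp: space_PiM)

lemma real_marginal_restrict:
  assumes "J \<subseteq> H" "finite H" "H \<subseteq> verts G"
  shows "real_marginal J = distr (real_marginal H) (\<Pi>\<^sub>M x\<in>J. borel) (\<lambda>f. restrict f J)"
proof -
  have "distr (real_marginal H) (\<Pi>\<^sub>M x\<in>J. borel) (\<lambda>f. restrict f J)
      = distr (measure_pmf (marginal H)) (\<Pi>\<^sub>M x\<in>J. borel) ((\<lambda>f. restrict f J) \<circ> (\<lambda>\<xi>. \<lambda>x\<in>H. real (\<xi> x)))"
    unfolding real_marginal_def
    by (rule distr_distr[OF measurable_restrict_subset[OF assms(1)] measurable_marginal])
  also have "(\<lambda>f. restrict f J) \<circ> (\<lambda>\<xi>. \<lambda>x\<in>H. real (\<xi> x)) = (\<lambda>\<xi>. \<lambda>x\<in>J. real (\<xi> x)) \<circ> (\<lambda>\<zeta>. restrict \<zeta> J)"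
    using assms(1) by (auto simp: fun_eq_iff restrict_def)
  also have "distr (measure_pmf (marginal H)) (\<Pi>\<^sub>M x\<in>J. borel) \<dots>
      = distr (distr (measure_pmf (marginal H)) (count_space UNIV) (\<lambda>\<zeta>. restrict \<zeta> J)) (\<Pi>\<^sub>M x\<in>J. borel) (\<lambda>\<xi>. \<lambda>x\<in>J. real (\<xi> x))"
    by (rule distr_distr[symmetric]) (auto simp: space_PiM)
  also have "\<dots> = real_marginal J"
    unfolding real_marginal_def marginal_restrict[OF assms, symmetric] map_pmf_rep_eq ..
  finally show ?thesis by (rule sym)
qed

lemma polish_projective_marginal: "polish_projective (verts G) real_marginal"
proof (intro polish_projective.intro projective_family.intro)
  fix J assume "finite J" "J \<subseteq> verts G"
  show "prob_space (real_marginal J)"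
    unfolding real_marginal_def by (rule prob_space.prob_space_distr[OF _ measurable_marginal]) unfold_locales
qed (rule real_marginal_restrict)

text \<open>A left inverse of \<open>real\<close> on \<open>{0..<d}\<close>. The cap at
  \<open>d - 1\<close>, together with \<open>nat\<close> sending negative numbers to 0, keeps all
  values in this range when \<open>d > 0\<close>.\<close>

definition round_to :: "nat \<Rightarrow> real \<Rightarrow> nat" where
  "round_to d r = min (nat \<lfloor>r\<rfloor>) (d - 1)"

lemma round_to_measurable: "d > 0 \<Longrightarrow> round_to d \<in> measurable borel (count_space {0..<d})"
proof -
  assume "d > 0"
  have "round_to d \<in> measurable borel (count_space UNIV)" unfolding round_to_def by measurable
  then have "round_to d \<in> measurable borel (restrict_space (count_space UNIV) {0..<d})"
    using \<open>d > 0\<close> by (intro measurable_restrict_space2) (auto simp: round_to_def)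
  then show ?thesis by (simp add: restrict_count_space)
qed

theorem sandpile_measure_exists:
  "\<exists>\<nu>. prob_space \<nu> \<and> sets \<nu> = sets (\<Pi>\<^sub>M x\<in>verts G. count_space {0..<deg G x}) \<and>
    (\<forall>Q \<xi>. finite Q \<and> Q \<subseteq> verts G \<and> \<xi> \<in> heights Q \<longrightarrow>
      measure \<nu> {\<eta> \<in> space \<nu>. restrict \<eta> Q = \<xi>} = sandpile_lim Q {\<xi>})"
proof -
  interpret P: polish_projective "verts G" real_marginal by (rule polish_projective_marginal)
  let ?M = "\<Pi>\<^sub>M x\<in>verts G. count_space {0..<deg G x}"
  define g where "g = (\<lambda>f. \<lambda>x\<in>verts G. round_to (deg G x) (f x))"
  have setsP: "sets P.lim = sets (\<Pi>\<^sub>M x\<in>verts G. borel)" by simp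
  have gm: "g \<in> measurable P.lim ?M"
    unfolding g_def
  proof (rule measurable_restrict)
    fix x assume x: "x \<in> verts G"
    have "(\<lambda>f. f x) \<in> measurable (\<Pi>\<^sub>M x\<in>verts G. borel :: real measure) borel"
      using x by (rule measurable_component_singleton)
    then have "(\<lambda>f. f x) \<in> measurable P.lim borel" using measurable_cong_sets[OF setsP refl] by blast
    from measurable_compose[OF this round_to_measurable[OF deg_pos[OF x]]]
    show "(\<lambda>f. round_to (deg G x) (f x)) \<in> measurable P.lim (count_space {0..<deg G x})" .
  qed
  define \<nu> where "\<nu> = distr P.lim ?M g"
  have "measure \<nu> {\<eta> \<in> space \<nu>. restrict \<eta> Q = \<xi>} = sandpile_lim Q {\<xi>}"
    if Q: "finite Q" "Q \<subseteq> verts G" and \<xi>: "\<xi> \<in> heights Q" for Q \<xi>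
  proof -
    let ?B = "\<Pi>\<^sub>M x\<in>Q. borel :: real measure"
    \<comment> \<open>The real vectors on \<open>Q\<close> that round to \<xi>; the cylinder of
      \<xi> pulls back along \<open>g\<close> to the cylinder over \<open>X\<close>.\<close>
    define X where "X = {f \<in> space ?B. \<forall>x\<in>Q. round_to (deg G x) (f x) = \<xi> x}"
    have X: "X \<in> sets ?B"
      unfolding X_def
    proof (rule sets.sets_Collect_finite_All[OF _ Q(1)])
      fix x assume x: "x \<in> Q"
      then have "x \<in> verts G" using Q(2) by auto
      have "(\<lambda>f. f x) \<in> measurable ?B borel"
        using x by (rule measurable_component_singleton)
      from measurable_compose[OF this round_to_measurable[OF deg_pos[OF \<open>x \<in> verts G\<close>]]]
      have "(\<lambda>f. round_to (deg G x) (f x)) \<in> measurable ?B (count_space {0..<deg G x})" .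
      from measurable_sets[OF this, of "{\<xi> x}"]
      have "(\<lambda>f. round_to (deg G x) (f x)) -` {\<xi> x} \<inter> space ?B \<in> sets ?B" using \<xi> x by (auto simp: PiE_iff)
      also have "(\<lambda>f. round_to (deg G x) (f x)) -` {\<xi> x} \<inter> space ?B = {f \<in> space ?B. round_to (deg G x) (f x) = \<xi> x}"
        by auto
      finally show "{f \<in> space ?B. round_to (deg G x) (f x) = \<xi> x} \<in> sets ?B" .
    qed
    have spl: "space P.lim = (\<Pi>\<^sub>E x\<in>verts G. UNIV)" using sets_eq_imp_space_eq[OF setsP] by (simp add: space_PiM)
    have emb: "g -` {\<eta> \<in> space ?M. restrict \<eta> Q = \<xi>} \<inter> space P.lim = prod_emb (verts G) (\<lambda>_. borel) Q X"
    proof (rule set_eqI)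
      fix f
      show "f \<in> g -` {\<eta> \<in> space ?M. restrict \<eta> Q = \<xi>} \<inter> space P.lim \<longleftrightarrow> f \<in> prod_emb (verts G) (\<lambda>_. borel) Q X"
      proof (cases "f \<in> space P.lim")
        case True
        then have "g f \<in> space ?M" using measurable_space[OF gm] by auto
        moreover have "restrict (g f) Q = \<xi> \<longleftrightarrow> (\<forall>x\<in>Q. round_to (deg G x) (f x) = \<xi> x)"
        proof
          assume "restrict (g f) Q = \<xi>"
          then show "\<forall>x\<in>Q. round_to (deg G x) (f x) = \<xi> x" using Q(2) by (auto simp: g_def)
        next
          assume "\<forall>x\<in>Q. round_to (deg G x) (f x) = \<xi> x"
          then show "restrict (g f) Q = \<xi>"
            using \<xi> Q(2) by (intro extensionalityI[of _ Q]) (auto simp: g_def PiE_iff)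
        qed
        moreover have "f \<in> prod_emb (verts G) (\<lambda>_. borel) Q X \<longleftrightarrow> (\<forall>x\<in>Q. round_to (deg G x) (f x) = \<xi> x)"
          using True by (auto simp: prod_emb_def X_def spl space_PiM)
        ultimately show ?thesis using True by auto
      qed (auto simp: prod_emb_def spl space_PiM)
    qed
    have "measure \<nu> {\<eta> \<in> space \<nu>. restrict \<eta> Q = \<xi>}
        = measure P.lim (g -` {\<eta> \<in> space ?M. restrict \<eta> Q = \<xi>} \<inter> space P.lim)"
      unfolding \<nu>_def space_distr by (rule measure_distr[OF gm prod_count_space_cylinder_sets[OF Q]])
    also have "\<dots> = measure P.lim (prod_emb (verts G) (\<lambda>_. borel) Q X)" by (simp only: emb)
    also have "\<dots> = measure (real_marginal Q) X" by (rule P.measure_lim_emb[OF Q(2,1) X])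
    also have "\<dots> = measure_pmf.prob (marginal Q) ((\<lambda>\<zeta>. \<lambda>x\<in>Q. real (\<zeta> x)) -` X \<inter> space (measure_pmf (marginal Q)))"
      unfolding real_marginal_def by (rule measure_distr[OF measurable_marginal X])
    \<comment> \<open>Other integer vectors may round to \<xi> because of the cap, but they lie
      outside \<open>heights Q\<close>, where the marginal has no mass.\<close>
    also have "\<dots> = measure_pmf.prob (marginal Q) {\<xi>}"
    proof (rule measure_prob_cong_0)
      fix \<zeta> assume \<zeta>: "\<zeta> \<in> (\<lambda>\<zeta>. \<lambda>x\<in>Q. real (\<zeta> x)) -` X \<inter> space (measure_pmf (marginal Q)) - {\<xi>}"
      have "\<zeta> \<notin> heights Q"
      proof
        assume b: "\<zeta> \<in> heights Q"
        have "\<zeta> = \<xi>"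
        proof (rule extensionalityI[of _ Q])
          fix x assume x: "x \<in> Q"
          then have "round_to (deg G x) (real (\<zeta> x)) = \<xi> x" using \<zeta> by (auto simp: X_def)
          moreover have "\<zeta> x < deg G x" using b x by (auto simp: PiE_iff)
          ultimately show "\<zeta> x = \<xi> x" by (simp add: round_to_def)
        qed (use b \<xi> in \<open>auto simp: PiE_iff\<close>)
        then show False using \<zeta> by auto
      qed
      then show "pmf (marginal Q) \<zeta> = 0" using set_marginal[OF Q] by (auto simp: set_pmf_iff)
    next
      fix \<zeta> assume \<zeta>: "\<zeta> \<in> {\<xi>} - (\<lambda>\<zeta>. \<lambda>x\<in>Q. real (\<zeta> x)) -` X \<inter> space (measure_pmf (marginal Q))"
      have "round_to (deg G x) (real (\<xi> x)) = \<xi> x" if "x \<in> Q" for x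
      proof -
        have "\<xi> x < deg G x" using that \<xi> by (auto simp: PiE_iff)
        then show ?thesis by (simp add: round_to_def)
      qed
      then have "(\<lambda>x\<in>Q. real (\<xi> x)) \<in> X" by (auto simp: X_def space_PiM)
      then show "pmf (marginal Q) \<zeta> = 0" using \<zeta> by auto
    qed
    also have "\<dots> = sandpile_lim Q {\<xi>}" by (rule measure_marginal[OF Q])
    finally show ?thesis .
  qed
  moreover have "prob_space \<nu>" unfolding \<nu>_def by (rule P.P.prob_space_distr[OF gm])
  moreover have "sets \<nu> = sets ?M" by (simp add: \<nu>_def)
  ultimately show ?thesis by blast
qed

end

theorem theorem3:
  fixes G :: "('v, 'e) mgraph" and \<mu> :: "('e \<Rightarrow> bool) measure"
  assumes "wf_mgraph G"
    and "locally_finite_mgraph G"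
    and "connected_mgraph G"
    and "infinite (verts G)"
    and "is_wusf G \<mu>"
    and "AE \<omega> in \<mu>. \<forall>x\<in>verts G.
           card (tree_ends (open_subgraph G \<omega>) (component (open_subgraph G \<omega>) x)) = 1"
  shows "\<exists>!\<nu> :: ('v \<Rightarrow> nat) measure.
           prob_space \<nu> \<and>
           sets \<nu> = sets (\<Pi>\<^sub>M x\<in>verts G. count_space {0..<deg G x}) \<and>
           (\<forall>W Q \<xi>. exhaustion G W \<and> finite Q \<and> Q \<subseteq> verts G \<and>
                    \<xi> \<in> (\<Pi>\<^sub>E x\<in>Q. {0..<deg G x}) \<longrightarrow>
              (\<lambda>n. measure_pmf.prob (sandpile_measure (wired G (W n))) {\<eta>. restrict \<eta> Q = \<xi>})
                \<longlonglongrightarrow> measure \<nu> {\<eta> \<in> space \<nu>. restrict \<eta> Q = \<xi>})"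
proof -
  interpret one_ended_wusf G \<mu>
    using assms by unfold_locales
  have lim: "(\<lambda>n. measure_pmf.prob (sandpile_measure (wired G (W n))) {\<eta>. restrict \<eta> Q = \<xi>}) \<longlonglongrightarrow> sandpile_lim Q {\<xi>}"
    if "exhaustion G W" "finite Q" "Q \<subseteq> verts G" for W Q \<xi>
    using sandpile_lim[OF that(2,3,1), of "{\<xi>}"] by simp
  obtain V where V: "exhaustion G V" using exhaustion_exists by auto
  obtain \<nu> where \<nu>: "prob_space \<nu>" "sets \<nu> = sets (\<Pi>\<^sub>M x\<in>verts G. count_space {0..<deg G x})"
    "\<And>Q \<xi>. finite Q \<Longrightarrow> Q \<subseteq> verts G \<Longrightarrow> \<xi> \<in> heights Q \<Longrightarrow>
      measure \<nu> {\<eta> \<in> space \<nu>. restrict \<eta> Q = \<xi>} = sandpile_lim Q {\<xi>}"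
    using sandpile_measure_exists by auto
  show ?thesis
  proof (rule ex1I[of _ \<nu>])
    show "prob_space \<nu> \<and> sets \<nu> = sets (\<Pi>\<^sub>M x\<in>verts G. count_space {0..<deg G x}) \<and>
      (\<forall>W Q \<xi>. exhaustion G W \<and> finite Q \<and> Q \<subseteq> verts G \<and> \<xi> \<in> heights Q \<longrightarrow>
        (\<lambda>n. measure_pmf.prob (sandpile_measure (wired G (W n))) {\<eta>. restrict \<eta> Q = \<xi>})
          \<longlonglongrightarrow> measure \<nu> {\<eta> \<in> space \<nu>. restrict \<eta> Q = \<xi>})"
      using \<nu> lim by simp
  next
    fix \<nu>' :: "('v \<Rightarrow> nat) measure"
    assume \<nu>': "prob_space \<nu>' \<and> sets \<nu>' = sets (\<Pi>\<^sub>M x\<in>verts G. count_space {0..<deg G x}) \<and>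
      (\<forall>W Q \<xi>. exhaustion G W \<and> finite Q \<and> Q \<subseteq> verts G \<and> \<xi> \<in> heights Q \<longrightarrow>
        (\<lambda>n. measure_pmf.prob (sandpile_measure (wired G (W n))) {\<eta>. restrict \<eta> Q = \<xi>})
          \<longlonglongrightarrow> measure \<nu>' {\<eta> \<in> space \<nu>'. restrict \<eta> Q = \<xi>})"
    show "\<nu>' = \<nu>"
    \<comment> \<open>A single exhaustion suffices for uniqueness: uniqueness of limits fixes all
      cylinder probabilities of a competitor.\<close>
    proof (rule prod_count_space_eqI[of \<nu>' \<nu> "verts G" "\<lambda>x. {0..<deg G x}"])
      fix Q \<xi> assume Q: "finite Q" "Q \<subseteq> verts G" "\<xi> \<in> heights Q"
      then have "(\<lambda>n. measure_pmf.prob (sandpile_measure (wired G (V n))) {\<eta>. restrict \<eta> Q = \<xi>})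
          \<longlonglongrightarrow> measure \<nu>' {\<eta> \<in> space \<nu>'. restrict \<eta> Q = \<xi>}" using \<nu>' V by blast
      then have "measure \<nu>' {\<eta> \<in> space \<nu>'. restrict \<eta> Q = \<xi>} = sandpile_lim Q {\<xi>}"
        using lim[OF V Q(1,2)] LIMSEQ_unique by blast
      then show "measure \<nu>' {\<eta> \<in> space \<nu>'. restrict \<eta> Q = \<xi>} = measure \<nu> {\<eta> \<in> space \<nu>. restrict \<eta> Q = \<xi>}"
        using \<nu>(3)[OF Q] by simp
    qed (use \<nu> \<nu>' in auto)
  qed
qed

end
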